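(* Let $X$ be a separable Banach space and let $(\Omega,\mathcal F,\mathbb P,\theta,T,X)$ be the linear random dynamical system generated by $A$ as in the context. Let $k:\Omega\to\mathbb N$ be a $\theta$-invariant measurable function. (i) If there exists a measurably contracting $k$-cone family, then there exists a measurably dominated splitting $X=E(\cdot)\oplus F(\cdot)$ with $\dim E(\cdot)=k$. (ii) If there exists a measurably dominated splitting $X=E(\cdot)\oplus F(\cdot)$ with $\dim E(\cdot)=k$, then there exists an eventually measurably contracting $k$-cone family. (iii) When $k=1$, there exists a measurably contracting $1$-cone family if and only if there exists a measurably dominated splitting $X=E(\cdot)\oplus F(\cdot)$ with $\dim E(\cdot)=1$.
   Context: Setting. $(X,|\cdot|)$ is a separable Banach space, $L(X)$ the bounded linear operators on $X$. $(\Omega,\mathcal F,\mathbb P)$ is a complete probability space and $\theta:\Omega\to\Omega$ is a bijection such that $\theta,\theta^{-1}$ are measurable and $\mathbb P$-preserving. $A:\Omega\to L(X)$ is strongly measurable ($\omega\mapsto A(\omega)x$ is measurable for each $x\in X$) and $A(\omega)$ is injective for a.e. $\omega$. $T^n(\omega)=A(\theta^{n-1}\omega)\cdots A(\omega)$ for $n\in\mathbb N$, $T^0=\mathrm{id}$. Separation index. With $S=\{v\in X:|v|=1\}$, for a subspace or cone $L\subset X$ and a nonempty $C\subset X$, $\underline{\mathrm{dist}}(L,C)=\inf_{v\in L\cap S}\inf_{u\in C}|v-u|$. $k$-cone. A closed $C\subset X$ is a $k$-cone if: $lv\in C$ for all $v\in C$, $l\in\mathbb R$; $C$ contains a $k$-dimensional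 subspace; there is a $k$-codimensional subspace $L$ with $L\cap C=\{0\}$. It is solid if $\mathrm{int}\,C\ne\emptyset$. Measurably contracting. A family $\mathcal C=\{C(\omega)\}_{\omega\in\Omega}$ of solid cones is a measurably contracting $k$-cone family if: C1) $k:\Omega\to\mathbb N$ is measurable and $\theta$-invariant and, for $\mathbb P$-a.e. $\omega$, $C(\omega)$ is a closed solid $k(\omega)$-cone and $A(\omega)C(\omega)\subset C(\theta\omega)$. C2) There is a measurable splitting $X=E_0(\omega)\oplus F_0(\omega)$ (the associated projections are strongly measurable) with $\dim E_0(\omega)=\mathrm{codim}\,F_0(\omega)=k(\omega)$, $E_0(\omega)\subset\mathrm{int}\,C(\omega)\cup\{0\}$ and $F_0(\omega)\cap C(\omega)=\{0\}$ for a.e. $\omega$. C3) There is a measurable $\chi:\Omega\to[1,\infty)$ such that for a.e. $\omega$, $\lim_{n\to\pm\infty}\frac1n\log\chi(\theta^n\omega)=0$ and $\underline{\mathrm{dist}}(A(\omega)C(\omega),X\setminus C(\theta\omega))\ge\frac1{\chi(\omega)}$. Eventually measurably contracting. A family $\mathcal C=\{C(\omega)\}_{\omega\in\Omega}$ of solid cones is an eventually measurably contracting $k$-cone family if: C1) $k:\Omega\to\mathbb N$ is measurable and $\theta$-invariant and, for $\mathbb P$-a.e. $\omega$, $C(\omega)$ is a closed solid $k(\omega)$-cone and $A(\omega)C(\omega)\subset C(\theta\omega)$. C2) There is a measurable splitting $X=E_0(\omega)\oplus F_0(\omega)$ (the associated projections are strongly measurable) with $\dim E_0(\omega)=\mathrm{codim}\,F_0(\omega)=k(\omega)$,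 $E_0(\omega)\subset\mathrm{int}\,C(\omega)\cup\{0\}$ and $F_0(\omega)\cap C(\omega)=\{0\}$ for a.e. $\omega$. C3') There are measurable $\chi:\Omega\to[1,\infty)$ and $N:\Omega\to\mathbb N$ such that for a.e. $\omega$, $\lim_{n\to\pm\infty}\frac1n\log\chi(\theta^n\omega)=0$ and, for all $m\ge N(\omega)$, $\underline{\mathrm{dist}}(T^m(\omega)C(\omega),X\setminus C(\theta^m\omega))\ge\frac1{\chi(\theta^m\omega)}$. Measurably dominated splitting. The system admits a measurably dominated splitting with $\dim E=k$ if there is a $\theta$-invariant set $\tilde\Omega$ of full measure such that: D1) for all $\omega\in\tilde\Omega$ there is a splitting $X=E(\omega)\oplus F(\omega)$ with $\dim E(\omega)=\mathrm{codim}\,F(\omega)=k(\omega)$ ($k:\Omega\to\mathbb N$ measurable, $\theta$-invariant), $A(\omega)E(\omega)=E(\theta\omega)$, $A(\omega)F(\omega)\subset F(\theta\omega)$; D2) the associated projections $\pi_E,\pi_F$ are strongly measurable and $\lim_{n\to\pm\infty}\frac1n\log\underline{\mathrm{dist}}(E(\theta^n\omega),F(\theta^n\omega))=0$, i.e. $\lim_{n\to\pm\infty}\frac1n\log\max\{\|\pi_E(\theta^n\omega)\|,\|\pi_F(\theta^n\omega)\|\}=0$; D3) there are a $\theta$-invariant measurable $\delta:\Omega\to(0,\infty)$ and a measurable $K:\Omega\to[1,\infty)$ with $\lim_{n\to\pm\infty}\frac1n\log K(\theta^n\omega)=0$ such that for all $\omega\in\tilde\Omega$ and $n\ge0$, $\big\|(T^n(\omega)|_{E(\omega)})^{-1}\big\|\,\big\|T^n(\omega)|_{F(\omega)}\big\|\le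 K(\omega)e^{-n\delta(\omega)}$. *)

theory Defs
  imports "HOL-Probability.Probability"
begin

text \<open>
  The Banach space is a type of class \<open>{banach, second_countable_topology}\<close> (for metric spaces,
  second countable means separable), and \<open>L(X)\<close> is the type of bounded linear functions on it.
  The probability space is the measure \<open>M\<close> with carrier \<open>space M\<close>; nothing is assumed about
  \<open>\<theta>\<close> outside the carrier.
\<close>

definition strongly_measurable ::
    "'w measure \<Rightarrow> ('w \<Rightarrow> ('x::real_normed_vector \<Rightarrow>\<^sub>L 'x)) \<Rightarrow> bool" where
  "strongly_measurable M B \<longleftrightarrow> (\<forall>x. (\<lambda>\<omega>. blinfun_apply (B \<omega>) x) \<in> borel_measurable M)"

locale linear_rds = prob_space M + complete_measure M
  for M :: "'w measure" +
  fixes \<theta> :: "'w \<Rightarrow> 'w"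
    and A :: "'w \<Rightarrow> ('x::{banach, second_countable_topology} \<Rightarrow>\<^sub>L 'x)"
  assumes theta_bij: "bij_betw \<theta> (space M) (space M)"
    and theta_measurable: "\<theta> \<in> measurable M M"
    and theta_inv_measurable: "inv_into (space M) \<theta> \<in> measurable M M"
    and theta_preserving: "distr M M \<theta> = M"
    and theta_inv_preserving: "distr M M (inv_into (space M) \<theta>) = M"
    and A_measurable: "strongly_measurable M A"
    and A_inj: "AE \<omega> in M. inj (blinfun_apply (A \<omega>))"

definition theta_iter :: "'w measure \<Rightarrow> ('w \<Rightarrow> 'w) \<Rightarrow> int \<Rightarrow> 'w \<Rightarrow> 'w" where
  "theta_iter M \<theta> n \<omega> =
     (if n \<ge> 0 then (\<theta> ^^ nat n) \<omega> else (inv_into (space M) \<theta> ^^ nat (- n)) \<omega>)"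

primrec cocycle ::
    "('w \<Rightarrow> 'w) \<Rightarrow> ('w \<Rightarrow> ('x::real_normed_vector \<Rightarrow>\<^sub>L 'x)) \<Rightarrow> nat \<Rightarrow> 'w \<Rightarrow> ('x \<Rightarrow>\<^sub>L 'x)" where
  "cocycle \<theta> A 0 \<omega> = id_blinfun"
| "cocycle \<theta> A (Suc n) \<omega> = A ((\<theta> ^^ n) \<omega>) o\<^sub>L cocycle \<theta> A n \<omega>"

text \<open>The limit of \<open>1/n log f(\<theta>\<^sup>n \<omega>)\<close> is 0 both for \<open>n \<rightarrow> \<infinity>\<close> and for \<open>n \<rightarrow> -\<infinity>\<close>.\<close>

definition subexponential_along ::
    "'w measure \<Rightarrow> ('w \<Rightarrow> 'w) \<Rightarrow> ('w \<Rightarrow> real) \<Rightarrow> 'w \<Rightarrow> bool" where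
  "subexponential_along M \<theta> f \<omega> \<longleftrightarrow>
     ((\<lambda>n::int. ln (f (theta_iter M \<theta> n \<omega>)) / of_int n) \<longlongrightarrow> 0) at_top \<and>
     ((\<lambda>n::int. ln (f (theta_iter M \<theta> n \<omega>)) / of_int n) \<longlongrightarrow> 0) at_bot"

text \<open>Here the naturals start at 1: for \<open>k = 0\<close> a dominated splitting always exists trivially,
  but the only 0-cone is \<open>{0}\<close>, which is not solid when \<open>X \<noteq> {0}\<close>.\<close>

definition invariant_index :: "'w measure \<Rightarrow> ('w \<Rightarrow> 'w) \<Rightarrow> ('w \<Rightarrow> nat) \<Rightarrow> bool" where
  "invariant_index M \<theta> k \<longleftrightarrow>
     k \<in> measurable M (count_space UNIV) \<and> (\<forall>\<omega>\<in>space M. 1 \<le> k \<omega> \<and> k (\<theta> \<omega>) = k \<omega>)"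

text \<open>\<open>dim\<close> is 0 on infinite-dimensional subspaces, so a finite basis is asked for explicitly.\<close>

definition has_dim :: "'x::real_vector set \<Rightarrow> nat \<Rightarrow> bool" where
  "has_dim E k \<longleftrightarrow> (\<exists>B. finite B \<and> independent B \<and> card B = k \<and> span B = E)"

text \<open>No closedness is required: the complement is an algebraic one.\<close>

definition has_codim :: "'x::real_vector set \<Rightarrow> nat \<Rightarrow> bool" where
  "has_codim F k \<longleftrightarrow> subspace F \<and>
     (\<exists>E. has_dim E k \<and> E \<inter> F = {0} \<and> (\<forall>x. \<exists>e\<in>E. \<exists>f\<in>F. x = e + f))"

text \<open>Extended-real valued, so that the infimum over an empty set is \<open>\<infinity>\<close>. This matters when
  \<open>k(\<omega>) = dim X\<close>: then the only \<open>k\<close>-cone is \<open>X\<close> and its complement is empty.\<close>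

definition sep_index :: "'x::real_normed_vector set \<Rightarrow> 'x set \<Rightarrow> ereal" where
  "sep_index L C = (INF v\<in>L \<inter> sphere 0 1. INF u\<in>C. ereal (norm (v - u)))"

definition k_cone :: "nat \<Rightarrow> 'x::real_normed_vector set \<Rightarrow> bool" where
  "k_cone k C \<longleftrightarrow> closed C \<and> (\<forall>v\<in>C. \<forall>l::real. l *\<^sub>R v \<in> C) \<and>
     (\<exists>E. has_dim E k \<and> E \<subseteq> C) \<and> (\<exists>L. has_codim L k \<and> L \<inter> C = {0})"

definition solid :: "'x::topological_space set \<Rightarrow> bool" where
  "solid C \<longleftrightarrow> interior C \<noteq> {}"

text \<open>A family of solid cones is defined at every \<open>\<omega>\<close>; being a \<open>k(\<omega>)\<close>-cone is only required
  almost everywhere, in \<open>cone_C1\<close>.\<close>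

definition solid_cone_family :: "'w measure \<Rightarrow> ('w \<Rightarrow> 'x::real_normed_vector set) \<Rightarrow> bool" where
  "solid_cone_family M C \<longleftrightarrow>
     (\<forall>\<omega>\<in>space M. closed (C \<omega>) \<and> (\<forall>v\<in>C \<omega>. \<forall>l::real. l *\<^sub>R v \<in> C \<omega>) \<and> solid (C \<omega>))"

text \<open>\<open>X = E \<oplus> F\<close> with projections \<open>P\<close> onto \<open>E\<close> along \<open>F\<close> and \<open>Q\<close> onto \<open>F\<close> along \<open>E\<close>. These are
  uniquely determined by \<open>E\<close> and \<open>F\<close>; that they are bounded forces \<open>E\<close> and \<open>F\<close> to be closed.\<close>

definition splitting_with ::
    "nat \<Rightarrow> 'x::real_normed_vector set \<Rightarrow> 'x set \<Rightarrow> ('x \<Rightarrow>\<^sub>L 'x) \<Rightarrow> ('x \<Rightarrow>\<^sub>L 'x) \<Rightarrow> bool" where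
  "splitting_with k E F P Q \<longleftrightarrow> has_dim E k \<and> has_codim F k \<and> E \<inter> F = {0} \<and>
     (\<forall>x. blinfun_apply P x \<in> E \<and> blinfun_apply Q x \<in> F \<and>
          blinfun_apply P x + blinfun_apply Q x = x)"

definition cone_C1 ::
    "'w measure \<Rightarrow> ('w \<Rightarrow> 'w) \<Rightarrow> ('w \<Rightarrow> ('x::real_normed_vector \<Rightarrow>\<^sub>L 'x)) \<Rightarrow> ('w \<Rightarrow> nat) \<Rightarrow>
     ('w \<Rightarrow> 'x set) \<Rightarrow> bool" where
  "cone_C1 M \<theta> A k C \<longleftrightarrow> invariant_index M \<theta> k \<and>
     (AE \<omega> in M. k_cone (k \<omega>) (C \<omega>) \<and> solid (C \<omega>) \<and> blinfun_apply (A \<omega>) ` C \<omega> \<subseteq> C (\<theta> \<omega>))"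

definition cone_C2 ::
    "'w measure \<Rightarrow> ('w \<Rightarrow> nat) \<Rightarrow> ('w \<Rightarrow> 'x::real_normed_vector set) \<Rightarrow> bool" where
  "cone_C2 M k C \<longleftrightarrow> (\<exists>E F P Q. strongly_measurable M P \<and> strongly_measurable M Q \<and>
     (AE \<omega> in M. splitting_with (k \<omega>) (E \<omega>) (F \<omega>) (P \<omega>) (Q \<omega>) \<and>
        E \<omega> \<subseteq> interior (C \<omega>) \<union> {0} \<and> F \<omega> \<inter> C \<omega> = {0}))"

definition cone_C3 ::
    "'w measure \<Rightarrow> ('w \<Rightarrow> 'w) \<Rightarrow> ('w \<Rightarrow> ('x::real_normed_vector \<Rightarrow>\<^sub>L 'x)) \<Rightarrow>
     ('w \<Rightarrow> 'x set) \<Rightarrow> bool" where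
  "cone_C3 M \<theta> A C \<longleftrightarrow> (\<exists>c. c \<in> borel_measurable M \<and> (\<forall>\<omega>\<in>space M. 1 \<le> c \<omega>) \<and>
     (AE \<omega> in M. subexponential_along M \<theta> c \<omega> \<and>
        sep_index (blinfun_apply (A \<omega>) ` C \<omega>) (- C (\<theta> \<omega>)) \<ge> ereal (1 / c \<omega>)))"

definition cone_C3_eventual ::
    "'w measure \<Rightarrow> ('w \<Rightarrow> 'w) \<Rightarrow> ('w \<Rightarrow> ('x::real_normed_vector \<Rightarrow>\<^sub>L 'x)) \<Rightarrow>
     ('w \<Rightarrow> 'x set) \<Rightarrow> bool" where
  "cone_C3_eventual M \<theta> A C \<longleftrightarrow> (\<exists>c N. c \<in> borel_measurable M \<and> (\<forall>\<omega>\<in>space M. 1 \<le> c \<omega>) \<and>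
     N \<in> measurable M (count_space UNIV) \<and> (\<forall>\<omega>\<in>space M. (1::nat) \<le> N \<omega>) \<and>
     (AE \<omega> in M. subexponential_along M \<theta> c \<omega> \<and>
        (\<forall>m\<ge>N \<omega>. sep_index (blinfun_apply (cocycle \<theta> A m \<omega>) ` C \<omega>) (- C ((\<theta> ^^ m) \<omega>))
           \<ge> ereal (1 / c ((\<theta> ^^ m) \<omega>)))))"

definition measurably_contracting ::
    "'w measure \<Rightarrow> ('w \<Rightarrow> 'w) \<Rightarrow> ('w \<Rightarrow> ('x::real_normed_vector \<Rightarrow>\<^sub>L 'x)) \<Rightarrow> ('w \<Rightarrow> nat) \<Rightarrow>
     ('w \<Rightarrow> 'x set) \<Rightarrow> bool" where
  "measurably_contracting M \<theta> A k C \<longleftrightarrow>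
     solid_cone_family M C \<and> cone_C1 M \<theta> A k C \<and> cone_C2 M k C \<and> cone_C3 M \<theta> A C"

definition eventually_measurably_contracting ::
    "'w measure \<Rightarrow> ('w \<Rightarrow> 'w) \<Rightarrow> ('w \<Rightarrow> ('x::real_normed_vector \<Rightarrow>\<^sub>L 'x)) \<Rightarrow> ('w \<Rightarrow> nat) \<Rightarrow>
     ('w \<Rightarrow> 'x set) \<Rightarrow> bool" where
  "eventually_measurably_contracting M \<theta> A k C \<longleftrightarrow>
     solid_cone_family M C \<and> cone_C1 M \<theta> A k C \<and> cone_C2 M k C \<and> cone_C3_eventual M \<theta> A C"

text \<open>The operator norm of the restriction of \<open>f\<close> to the subspace \<open>S\<close>; compare \<open>onorm\<close>.\<close>

definition onorm_on ::
    "'x::real_normed_vector set \<Rightarrow> ('x \<Rightarrow> 'y::real_normed_vector) \<Rightarrow> real" where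
  "onorm_on S f = (SUP x\<in>S. norm (f x) / norm x)"

text \<open>\<open>T\<^sup>n(\<omega>)\<close> maps \<open>E(\<omega>)\<close> onto \<open>E(\<theta>\<^sup>n \<omega>)\<close>, hence bijectively because the two have the same
  finite dimension, and \<open>inv_into (E \<omega>)\<close> is the inverse of this restriction. The infimum defining
  \<open>sep_index (E \<omega>) (F \<omega>)\<close> is finite since \<open>k(\<omega>) \<ge> 1\<close>.\<close>

definition measurably_dominated_splitting ::
    "'w measure \<Rightarrow> ('w \<Rightarrow> 'w) \<Rightarrow> ('w \<Rightarrow> ('x::real_normed_vector \<Rightarrow>\<^sub>L 'x)) \<Rightarrow> ('w \<Rightarrow> nat) \<Rightarrow>
     ('w \<Rightarrow> 'x set) \<Rightarrow> ('w \<Rightarrow> 'x set) \<Rightarrow> bool" where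
  "measurably_dominated_splitting M \<theta> A k E F \<longleftrightarrow> invariant_index M \<theta> k \<and>
     (\<exists>\<Omega>0 P Q \<delta> K.
        \<Omega>0 \<in> sets M \<and> emeasure M \<Omega>0 = emeasure M (space M) \<and> \<theta> ` \<Omega>0 = \<Omega>0 \<and>
        (\<forall>\<omega>\<in>\<Omega>0. splitting_with (k \<omega>) (E \<omega>) (F \<omega>) (P \<omega>) (Q \<omega>) \<and>
           blinfun_apply (A \<omega>) ` E \<omega> = E (\<theta> \<omega>) \<and> blinfun_apply (A \<omega>) ` F \<omega> \<subseteq> F (\<theta> \<omega>)) \<and>
        strongly_measurable M P \<and> strongly_measurable M Q \<and>
        (\<forall>\<omega>\<in>\<Omega>0. subexponential_along M \<theta> (\<lambda>\<omega>'. real_of_ereal (sep_index (E \<omega>') (F \<omega>'))) \<omega>) \<and>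
        \<delta> \<in> borel_measurable M \<and> (\<forall>\<omega>\<in>space M. 0 < \<delta> \<omega> \<and> \<delta> (\<theta> \<omega>) = \<delta> \<omega>) \<and>
        K \<in> borel_measurable M \<and> (\<forall>\<omega>\<in>space M. 1 \<le> K \<omega>) \<and>
        (\<forall>\<omega>\<in>\<Omega>0. subexponential_along M \<theta> K \<omega>) \<and>
        (\<forall>\<omega>\<in>\<Omega>0. \<forall>n::nat.
           onorm_on (E ((\<theta> ^^ n) \<omega>)) (inv_into (E \<omega>) (blinfun_apply (cocycle \<theta> A n \<omega>))) *
           onorm_on (F \<omega>) (blinfun_apply (cocycle \<theta> A n \<omega>))
             \<le> K \<omega> * exp (- real n * \<delta> \<omega>)))"

end

theory Submission
  imports Defs
begin

text \<open>
  Write \<open>\<psi>\<close> for the inverse of \<open>\<theta>\<close>.  Let \<open>v\<close> be at distance at least \<open>|v| / c(\<psi> \<omega>)\<close> from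
  the complement of \<open>C(\<omega>)\<close>, and let the orbit of \<open>w\<close> never meet the cones.  If the segment
  \<open>{v + s w. |s| \<le> r}\<close> lies in \<open>C(\<omega>)\<close>, then C3 lets one enlarge \<open>r\<close> by the factor
  \<open>1 + 1 / (4 c(\<omega>)\<^sup>2)\<close> after applying \<open>A(\<omega>)\<close>.  Hence \<open>T\<^sup>n w\<close> is small against \<open>T\<^sup>n v\<close> by the product of
  these factors, and by Birkhoff's theorem that product grows exponentially at a positive
  \<open>\<theta>\<close>-invariant rate, with a tempered error since \<open>c\<close> is tempered.  The same estimate makes the
  projections defined by the pullbacks \<open>(T\<^sup>n)\<^sup>-\<^sup>1 F\<^sub>0(\<theta>\<^sup>n \<omega>)\<close> converge in norm, which gives \<open>F\<close>, and then
  those defined by the pushforwards \<open>T\<^sup>n E\<^sub>0(\<psi>\<^sup>n \<omega>)\<close>, which gives \<open>E\<close>.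

  Conversely the set of all \<open>x\<close> with \<open>e\<^bsup>n\<delta>\<^esup> |T\<^sup>n \<pi>\<^sub>F x| \<le> |T\<^sup>n \<pi>\<^sub>E x|\<close> for every \<open>n\<close> is a forward
  invariant cone, narrowed by the factor \<open>e\<^bsup>-\<delta>\<^esup>\<close> in each step.  A narrowed cone is separated
  from the complement of the full one once the factor beats \<open>K\<close>, which happens after finitely
  many steps; if \<open>dim E = 1\<close>, then \<open>|T\<^sup>n|\<close> is multiplicative on \<open>E\<close> and one step suffices.

  Below \<open>z\<close> stands for the paper's \<open>\<omega>\<close>.
\<close>

section \<open>Finite-dimensional subspaces and their complements\<close>

text \<open>Birkhoff's theorem is applied to \<open>ln (1 + 1 / (4 * (c z)\<^sup>2))\<close>, which
  lies in (0, 1] and so is integrable however large \<open>c\<close> is; temperedness of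
  \<open>c\<close> is spent on prefactors. Both directions of time share one rate, because \<theta>
  and its inverse have the same invariant sets. Half of that rate is kept as \<delta>; the other
  half absorbs errors uniformly over the base points of an orbit, as the pushforwards require, since
  they start from ever earlier points. F has to come before E: two pushforward projections of a
  vector differ by a vector of F, and the estimate applies to it because its orbit avoids the cones
  for all times. Subspaces carry no chosen bases, so each approximating projection is obtained
  measurably as a limit of approximate solutions of a linear equation, taken from a countable dense
  set. Conversely, imposing the inequality for all n makes the cone contract with no constant. K
  returns when the cone is compared with the norm: in general it multiplies the F part of the vector
  itself, in dimension one only that of a perturbation.\<close>

lemma has_dim_subspace: "has_dim E k \<Longrightarrow> subspace E"
  unfolding has_dim_def by auto

lemma has_dim_image:
  assumes "linear f" "inj_on f E" "has_dim E k"
  shows "has_dim (f ` E) k"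
proof -
  obtain B where B: "finite B" "independent B" "card B = k" "span B = E"
    using assms(3) unfolding has_dim_def by blast
  interpret f: linear f by fact
  have "independent (f ` B)" using linear_independent_injective_image[OF assms(1) B(2)] assms(2) B(4) by simp
  moreover have "card (f ` B) = k"
    using card_image[of f B] inj_on_subset[OF assms(2)] B span_superset by blast
  moreover have "span (f ` B) = f ` E" using linear_span_image[OF assms(1), of B] B(4) by simp
  ultimately show ?thesis unfolding has_dim_def using B(1) by blast
qed

lemma has_dim_subset_eq:
  assumes "has_dim E k" "has_dim E' k" "E \<subseteq> E'"
  shows "E = E'"
proof (rule ccontr)
  assume "E \<noteq> E'"
  then obtain x where x: "x \<in> E'" "x \<notin> E" using assms(3) by blast
  obtain B where B: "finite B" "independent B" "card B = k" "span B = E"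
    using assms(1) unfolding has_dim_def by blast
  obtain B' where B': "finite B'" "independent B'" "card B' = k" "span B' = E'"
    using assms(2) unfolding has_dim_def by blast
  have "independent (insert x B)" using B x by (simp add: independent_insertI)
  moreover have "insert x B \<subseteq> span B'" using x B B' assms(3) span_superset by blast
  ultimately have "card (insert x B) \<le> card B'" using independent_span_bound[OF B'(1)] by blast
  moreover have "x \<notin> B" using x B span_superset by blast
  ultimately show False using B B' by simp
qed

text \<open>Linearity comes from uniqueness of the decomposition. Continuity is a separate matter
  and will follow from a separation estimate.\<close>

lemma direct_sum_projection:
  fixes E F :: "'x::real_vector set"
  assumes E: "subspace E" and F: "subspace F" and EF: "E \<inter> F = {0}" and ex: "\<And>x. \<exists>e\<in>E. x - e \<in> F"
  obtains p where "linear p" "range p = E" "\<And>x. p x = 0 \<longleftrightarrow> x \<in> F" "\<And>x. x - p x \<in> F"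
    "\<And>x. x \<in> E \<Longrightarrow> p x = x"
proof -
  obtain p where p: "\<And>x. p x \<in> E" "\<And>x. x - p x \<in> F" using ex by metis
  have uniq: "p x = e" if "e \<in> E" "x - e \<in> F" for x e
  proof -
    have "(x - e) - (x - p x) \<in> F" using subspace_diff[OF F that(2) p(2)] .
    moreover have "(x - e) - (x - p x) = p x - e" by simp
    ultimately have "p x - e \<in> F" by metis
    moreover have "p x - e \<in> E" using subspace_diff[OF E p(1) that(1)] .
    ultimately have "p x - e = 0" using EF by blast
    then show ?thesis by simp
  qed
  have "linear p"
  proof
    fix x y
    have "(x - p x) + (y - p y) \<in> F" using subspace_add[OF F p(2) p(2)] .
    moreover have "(x - p x) + (y - p y) = (x + y) - (p x + p y)" by simp
    ultimately show "p (x + y) = p x + p y" using uniq[OF subspace_add[OF E p(1) p(1)]] by metis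
  next
    fix r x
    have "r *\<^sub>R (x - p x) \<in> F" using subspace_scale[OF F p(2)] .
    then show "p (r *\<^sub>R x) = r *\<^sub>R p x"
      using uniq[OF subspace_scale[OF E p(1)]] by (simp add: scaleR_diff_right)
  qed
  moreover have id: "p x = x" if "x \<in> E" for x using that uniq[of x x] subspace_0[OF F] by simp
  moreover have "range p = E" using p(1) id by (metis image_subsetI rangeI subsetI subset_antisym)
  moreover have "p x = 0 \<longleftrightarrow> x \<in> F" for x
    using p(2)[of x] uniq[of 0 x] subspace_0[OF E] by (metis diff_zero)
  ultimately show ?thesis using that p(2) by blast
qed

lemma codim_projection:
  fixes F :: "'x::real_vector set"
  assumes "has_codim F k"
  obtains E p where "has_dim E k" "E \<inter> F = {0}" "linear p" "range p = E" "\<And>x. p x = 0 \<longleftrightarrow> x \<in> F"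
    "\<And>x. x - p x \<in> F" "\<And>x. x \<in> E \<Longrightarrow> p x = x"
proof -
  obtain E where F: "subspace F" and E: "has_dim E k" "E \<inter> F = {0}" "\<And>x. \<exists>e\<in>E. \<exists>f\<in>F. x = e + f"
    using assms unfolding has_codim_def by blast
  have "\<exists>e\<in>E. x - e \<in> F" for x using E(3)[of x] by (metis add_diff_cancel_left')
  from direct_sum_projection[OF has_dim_subspace[OF E(1)] F E(2) this] that[OF E(1,2)]
  show ?thesis by metis
qed

text \<open>Projecting along \<open>F\<close> onto a known complement is injective on
  \<open>E\<close>, so by counting dimensions the image of \<open>E\<close> is all of that
  complement; any \<open>x\<close> then differs from some \<open>e\<close> by a vector of the kernel
  \<open>F\<close>.\<close>

lemma has_dim_codim_complement:
  assumes "has_dim E k" "has_codim F k" "E \<inter> F = {0}"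
  shows "\<exists>e\<in>E. x - e \<in> F"
proof -
  obtain E' p where p: "has_dim E' k" "E' \<inter> F = {0}" "linear p" "range p = E'"
    "\<And>x. p x = 0 \<longleftrightarrow> x \<in> F" "\<And>x. x - p x \<in> F" "\<And>x. x \<in> E' \<Longrightarrow> p x = x"
    using codim_projection[OF assms(2)] by metis
  interpret p: linear p by fact
  have "inj_on p E"
    using linear_inj_on_iff_eq_0[OF p(3) has_dim_subspace[OF assms(1)]] p(5) assms(3) by blast
  then have "has_dim (p ` E) k" using has_dim_image p.linear_axioms assms(1) by blast
  then have "p ` E = E'" using has_dim_subset_eq p(1,4) by blast
  then obtain e where e: "e \<in> E" "p x = p e" using p(4) by (metis imageE rangeI)
  then have "p (x - e) = 0" by (simp add: p.diff)
  then show ?thesis using p(5) e by blast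
qed

text \<open>The projections along \<open>F\<close> identify any two complements of \<open>F\<close>,
  and one of them is known to have dimension \<open>k\<close>.\<close>

lemma has_dim_complement:
  assumes "has_codim F k" "subspace E" "E \<inter> F = {0}" "\<And>x. \<exists>e\<in>E. x - e \<in> F"
  shows "has_dim E k"
proof -
  obtain E' p' where E': "has_dim E' k" "E' \<inter> F = {0}" "linear p'" "range p' = E'"
    "\<And>x. p' x = 0 \<longleftrightarrow> x \<in> F" "\<And>x. x - p' x \<in> F" "\<And>x. x \<in> E' \<Longrightarrow> p' x = x"
    using codim_projection[OF assms(1)] by metis
  have F: "subspace F" using assms(1) unfolding has_codim_def by blast
  obtain p where p: "linear p" "range p = E" "\<And>x. p x = 0 \<longleftrightarrow> x \<in> F" "\<And>x. x - p x \<in> F"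
    "\<And>x. x \<in> E \<Longrightarrow> p x = x"
    using direct_sum_projection[OF assms(2) F assms(3,4)] by metis
  have "inj_on p E'"
    using linear_inj_on_iff_eq_0[OF p(1) has_dim_subspace[OF E'(1)]] p(3) E'(2) by blast
  then have "has_dim (p ` E') k" using has_dim_image[OF p(1) _ E'(1)] by blast
  moreover have "p ` E' = E"
  proof -
    have "p (p' x) = p x" for x
    proof -
      have "p (x - p' x) = 0" using p(3) E'(6) by blast
      then show ?thesis using linear_diff[OF p(1)] by simp
    qed
    then have "p ` range p' = range p" by (simp add: image_image)
    then show ?thesis using p(2) E'(4) by simp
  qed
  ultimately show ?thesis by simp
qed

text \<open>Induction on the basis. The step needs the new vector \<open>b\<close> at positive
  distance from \<open>span B\<close>; the coordinate bound for \<open>B\<close> supplies it, since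
  it makes \<open>span B\<close> closed.\<close>

lemma independent_coordinates_bounded:
  fixes B :: "'x::real_normed_vector set"
  assumes "finite B" "independent B"
  shows "\<exists>c. \<forall>a. \<forall>b\<in>B. \<bar>a b\<bar> \<le> c * norm (\<Sum>b\<in>B. a b *\<^sub>R b)"
  using assms
proof (induction B)
  case empty
  then show ?case by simp
next
  case (insert b B)
  have indB: "independent B" "b \<notin> span B"
    using insert.prems insert.hyps by (auto simp: independent_insert)
  obtain c where c: "\<And>a b. b \<in> B \<Longrightarrow> \<bar>a b\<bar> \<le> c * norm (\<Sum>b\<in>B. a b *\<^sub>R b)"
    using insert.IH indB by blast
  \<comment> \<open>Otherwise \<open>b\<close> is a limit of vectors of \<open>span B\<close>; their
    coordinates are Cauchy by the induction hypothesis, and the limits of the coordinates exhibit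
    \<open>b\<close> in the span.\<close>
  have "\<exists>d>0. \<forall>y\<in>span B. d \<le> norm (b - y)"
  proof (rule ccontr)
    assume "\<not> ?thesis"
    then have "\<forall>n. \<exists>y\<in>span B. norm (b - y) < inverse (real (Suc n))"
      by (meson inverse_positive_iff_positive not_le of_nat_0_less_iff zero_less_Suc)
    then obtain y where y: "\<And>n. y n \<in> span B" "\<And>n. norm (b - y n) < inverse (real (Suc n))"
      by metis
    have "(\<lambda>n. norm (b - y n)) \<longlonglongrightarrow> 0"
      using y(2) by (intro tendsto_sandwich[OF _ _ tendsto_const LIMSEQ_inverse_real_of_nat])
        (auto intro!: always_eventually less_imp_le)
    then have "(\<lambda>n. b - y n) \<longlonglongrightarrow> 0" by (rule tendsto_norm_zero_cancel)
    from tendsto_diff[OF tendsto_const[of b] this] have lim: "y \<longlonglongrightarrow> b" by simp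
    have "\<forall>n. \<exists>a. y n = (\<Sum>v\<in>B. a v *\<^sub>R v)"
      using y(1) insert.hyps(1) by (auto simp: span_finite)
    then obtain a where a: "\<And>n. y n = (\<Sum>v\<in>B. a n v *\<^sub>R v)" by metis
    have Cau: "Cauchy (\<lambda>n. a n v)" if v: "v \<in> B" for v
    proof (rule metric_CauchyI)
      fix e :: real assume "e > 0"
      define e' where "e' = e / (\<bar>c\<bar> + 1)"
      have e': "e' > 0" using \<open>e > 0\<close> unfolding e'_def by simp
      obtain N where N: "\<And>m n. m \<ge> N \<Longrightarrow> n \<ge> N \<Longrightarrow> dist (y m) (y n) < e'"
        using metric_CauchyD[OF LIMSEQ_imp_Cauchy[OF lim] e'] by blast
      have "dist (a m v) (a n v) < e" if "m \<ge> N" "n \<ge> N" for m n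
      proof -
        have "\<bar>a m v - a n v\<bar> \<le> c * norm (y m - y n)"
          using c[OF v, of "\<lambda>v. a m v - a n v"] by (simp add: a scaleR_left_diff_distrib sum_subtractf)
        also have "\<dots> \<le> (\<bar>c\<bar> + 1) * norm (y m - y n)" by (intro mult_right_mono) auto
        also have "\<dots> < (\<bar>c\<bar> + 1) * e'" using N[OF that] by (intro mult_strict_left_mono) (auto simp: dist_norm)
        also have "\<dots> = e" unfolding e'_def by simp
        finally show ?thesis by (simp add: dist_real_def)
      qed
      then show "\<exists>M. \<forall>m\<ge>M. \<forall>n\<ge>M. dist (a m v) (a n v) < e" by blast
    qed
    have "\<forall>v\<in>B. \<exists>l. (\<lambda>n. a n v) \<longlonglongrightarrow> l" using Cau Cauchy_convergent convergent_def by blast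
    then obtain l where l: "\<And>v. v \<in> B \<Longrightarrow> (\<lambda>n. a n v) \<longlonglongrightarrow> l v" by metis
    have "y \<longlonglongrightarrow> (\<Sum>v\<in>B. l v *\<^sub>R v)" unfolding a using l by (intro tendsto_sum tendsto_scaleR) auto
    then have "b = (\<Sum>v\<in>B. l v *\<^sub>R v)" using lim LIMSEQ_unique by blast
    then have "b \<in> span B" by (simp add: span_sum span_scale span_base)
    then show False using indB by blast
  qed
  then obtain d where d: "d > 0" "\<And>y. y \<in> span B \<Longrightarrow> d \<le> norm (b - y)" by blast
  \<comment> \<open>The coordinate at \<open>b\<close> is at most \<open>norm x / d\<close>;
    removing it leaves a vector of norm at most \<open>norm x * (1 + norm b / d)\<close>, to which
    \<open>c\<close> applies.\<close>
  define c' where "c' = 1 / d + \<bar>c\<bar> * (1 + norm b / d)"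
  have "\<bar>a v\<bar> \<le> c' * norm (\<Sum>b\<in>insert b B. a b *\<^sub>R b)" if v: "v \<in> insert b B" for a v
  proof -
    define y where "y = (\<Sum>b\<in>B. a b *\<^sub>R b)"
    define x where "x = a b *\<^sub>R b + y"
    have x: "(\<Sum>b\<in>insert b B. a b *\<^sub>R b) = x" using insert.hyps by (simp add: x_def y_def)
    have yB: "y \<in> span B" unfolding y_def by (simp add: span_sum span_scale span_base)
    have s: "\<bar>a b\<bar> \<le> norm x / d"
    proof (cases "a b = 0")
      case False
      have "d \<le> norm (b - (- (1 / a b)) *\<^sub>R y)" using d(2) span_scale[OF yB] by blast
      then have "\<bar>a b\<bar> * d \<le> \<bar>a b\<bar> * norm (b - (- (1 / a b)) *\<^sub>R y)" by (intro mult_left_mono) auto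
      also have "\<dots> = norm (a b *\<^sub>R (b - (- (1 / a b)) *\<^sub>R y))" by simp
      also have "a b *\<^sub>R (b - (- (1 / a b)) *\<^sub>R y) = x" using False by (simp add: x_def algebra_simps)
      finally show ?thesis using d(1) by (simp add: field_simps)
    qed (use d in simp)
    have "norm y \<le> norm x + \<bar>a b\<bar> * norm b"
      using norm_triangle_ineq4[of x "a b *\<^sub>R b"] by (simp add: x_def)
    also have "\<dots> \<le> norm x + norm x / d * norm b" using s by (intro add_left_mono mult_right_mono) auto
    finally have y: "norm y \<le> norm x * (1 + norm b / d)" by (simp add: algebra_simps)
    show ?thesis
    proof (cases "v = b")
      case True
      have "norm x / d \<le> c' * norm x" using d(1) by (simp add: c'_def algebra_simps)
      then show ?thesis unfolding x using s True by simp
    next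
      case False
      then have "v \<in> B" using v by simp
      then have "\<bar>a v\<bar> \<le> c * norm y" using c unfolding y_def by blast
      also have "\<dots> \<le> \<bar>c\<bar> * (norm x * (1 + norm b / d))" using y by (intro mult_mono) auto
      also have "\<dots> \<le> c' * norm x" using d(1) by (simp add: c'_def algebra_simps)
      finally show ?thesis unfolding x .
    qed
  qed
  then show ?case by blast
qed

text \<open>Serves twice: to bound the inverse of \<open>T n z\<close> on \<open>E z\<close>, and to
  control linear equations whose solutions are sought in a finite-dimensional range.\<close>

lemma has_dim_bounded_below:
  fixes E :: "'x::real_normed_vector set" and f :: "'x \<Rightarrow> 'y::real_normed_vector"
  assumes "has_dim E k" "linear f" "\<And>x. x \<in> E \<Longrightarrow> f x = 0 \<Longrightarrow> x = 0"
  obtains c where "c > 0" "\<And>x. x \<in> E \<Longrightarrow> norm x \<le> c * norm (f x)"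
proof -
  obtain B where B: "finite B" "independent B" "card B = k" "span B = E"
    using assms(1) unfolding has_dim_def by blast
  interpret f: linear f by fact
  have inj: "inj_on f (span B)"
    using linear_inj_on_iff_eq_0[OF assms(2) subspace_span[of B]] assms(3) B(4) by blast
  have injB: "inj_on f B" using inj inj_on_subset span_superset by blast
  have "independent (f ` B)" using linear_independent_injective_image[OF assms(2) B(2) inj] .
  then obtain c where c: "\<And>a b. b \<in> f ` B \<Longrightarrow> \<bar>a b\<bar> \<le> c * norm (\<Sum>b\<in>f ` B. a b *\<^sub>R b)"
    using independent_coordinates_bounded[of "f ` B"] B(1) by blast
  define c' where "c' = \<bar>c\<bar> * (\<Sum>b\<in>B. norm b) + 1"
  have "norm x \<le> c' * norm (f x)" if "x \<in> E" for x
  proof -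
    obtain a where a: "x = (\<Sum>v\<in>B. a v *\<^sub>R v)" using \<open>x \<in> E\<close> B by (auto simp: span_finite)
    have fx: "(\<Sum>b\<in>f ` B. a (inv_into B f b) *\<^sub>R b) = f x"
      using injB by (simp add: sum.reindex a f.sum f.scale)
    have ab: "\<bar>a b\<bar> \<le> \<bar>c\<bar> * norm (f x)" if "b \<in> B" for b
    proof -
      have "\<bar>a b\<bar> \<le> c * norm (f x)"
        using c[of "f b" "\<lambda>b. a (inv_into B f b)"] that injB unfolding fx by simp
      also have "\<dots> \<le> \<bar>c\<bar> * norm (f x)" by (intro mult_right_mono) auto
      finally show ?thesis .
    qed
    have "norm x \<le> (\<Sum>b\<in>B. \<bar>a b\<bar> * norm b)"
      unfolding a using norm_sum[of "\<lambda>v. a v *\<^sub>R v" B] by simp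
    also have "\<dots> \<le> (\<Sum>b\<in>B. \<bar>c\<bar> * norm (f x) * norm b)"
      using ab by (intro sum_mono mult_right_mono) auto
    also have "\<dots> = \<bar>c\<bar> * (\<Sum>b\<in>B. norm b) * norm (f x)"
      by (simp add: sum_distrib_left sum_distrib_right algebra_simps)
    also have "\<dots> \<le> c' * norm (f x)" by (intro mult_right_mono) (auto simp: c'_def)
    finally show ?thesis .
  qed
  moreover have "c' > 0" unfolding c'_def
    by (intro add_nonneg_pos mult_nonneg_nonneg sum_nonneg) auto
  ultimately show ?thesis using that by blast
qed

section \<open>Domination in a sequence of contracting cones\<close>

definition is_projection :: "'x::real_normed_vector set \<Rightarrow> 'x set \<Rightarrow> ('x \<Rightarrow>\<^sub>L 'x) \<Rightarrow> bool" where
  "is_projection E F P \<longleftrightarrow> (\<forall>x. blinfun_apply P x \<in> E \<and> x - blinfun_apply P x \<in> F)"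

text \<open>The choice makes the projection a total function of the two subspaces; it is meaningful
  for pairs to which \<open>projection_exists\<close> applies.\<close>

definition proj :: "'x::real_normed_vector set \<Rightarrow> 'x set \<Rightarrow> ('x \<Rightarrow>\<^sub>L 'x)" where
  "proj E F = (SOME P. is_projection E F P)"

lemma is_projection_unique:
  assumes "is_projection E F P" "subspace E" "subspace F" "E \<inter> F = {0}" "e \<in> E" "x - e \<in> F"
  shows "blinfun_apply P x = e"
proof -
  have "(x - e) - (x - P x) \<in> F" using assms unfolding is_projection_def by (blast intro: subspace_diff)
  moreover have "(x - e) - (x - P x) = P x - e" by simp
  moreover have "P x - e \<in> E" using assms unfolding is_projection_def by (blast intro: subspace_diff)
  ultimately have "P x - e \<in> E \<inter> F" by simp
  then show ?thesis using assms(4) by simp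
qed

text \<open>The separation inequality does double duty: for \<open>u = v\<close> it makes the
  intersection trivial, and for \<open>v = p x\<close>, \<open>u = p x - x\<close> it is the norm
  bound, since then \<open>v - u = x\<close>.\<close>

lemma projection_exists:
  fixes E F :: "'x::real_normed_vector set"
  assumes E: "has_dim E k" and F: "has_codim F k" and c: "c \<ge> 1"
    and sep: "\<And>v u. v \<in> E \<Longrightarrow> u \<in> F \<Longrightarrow> norm v \<le> c * norm (v - u)"
  shows "E \<inter> F = {0}" "is_projection E F (proj E F)" "norm (proj E F) \<le> c"
proof -
  have sE: "subspace E" using E by (rule has_dim_subspace)
  have sF: "subspace F" using F unfolding has_codim_def by blast
  show EF: "E \<inter> F = {0}" using sep subspace_0[OF sE] subspace_0[OF sF] by fastforce
  obtain p where p: "linear p" "range p = E" "\<And>x. p x = 0 \<longleftrightarrow> x \<in> F" "\<And>x. x - p x \<in> F"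
    "\<And>x. x \<in> E \<Longrightarrow> p x = x"
    using direct_sum_projection[OF sE sF EF has_dim_codim_complement[OF E F EF]] by metis
  have b: "norm (p x) \<le> c * norm x" for x
  proof -
    have "p x - x \<in> F" using subspace_neg[OF sF p(4)[of x]] by simp
    then show ?thesis using sep[of "p x" "p x - x"] p(2) by force
  qed
  have "bounded_linear p"
    using p(1) b by (intro bounded_linear_intro[where K=c]) (auto simp: linear_iff mult.commute)
  then have app: "blinfun_apply (Blinfun p) = p" by (rule bounded_linear_Blinfun_apply)
  have "is_projection E F (Blinfun p)" unfolding is_projection_def app using p(2,4) by blast
  then show P: "is_projection E F (proj E F)" unfolding proj_def by (rule someI)
  show "norm (proj E F) \<le> c"
  proof (rule norm_blinfun_bound)
    fix x
    have "proj E F x = p x" using is_projection_unique[OF P sE sF EF] p(2,4) by blast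
    then show "norm (proj E F x) \<le> c * norm x" using b by simp
  qed (use c in simp)
qed

lemma convergent_of_tail_bound:
  fixes X :: "nat \<Rightarrow> 'a::banach"
  assumes "\<And>n m. n \<le> m \<Longrightarrow> norm (X n - X m) \<le> b n" "b \<longlonglongrightarrow> 0"
  shows "X \<longlonglongrightarrow> lim X"
proof -
  have "Cauchy X"
  proof (rule CauchyI)
    fix e :: real assume "e > 0"
    then have "\<forall>\<^sub>F n in sequentially. b n < e / 2" using order_tendstoD(2)[OF assms(2), of "e / 2"] by simp
    then obtain N where N: "b N < e / 2" using eventually_sequentially by auto
    have "norm (X m - X n) < e" if "m \<ge> N" "n \<ge> N" for m n
    proof -
      have "norm (X m - X n) \<le> norm (X N - X m) + norm (X N - X n)"
        using norm_triangle_ineq4[of "X N - X n" "X N - X m"] by simp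
      also have "\<dots> < e" using assms(1)[OF that(1)] assms(1)[OF that(2)] N by linarith
      finally show ?thesis .
    qed
    then show "\<exists>M. \<forall>m\<ge>M. \<forall>n\<ge>M. norm (X m - X n) < e" by blast
  qed
  then show ?thesis using Cauchy_convergent_iff convergent_LIMSEQ_iff by blast
qed

lemma cocycle_add:
  "cocycle \<theta> A (m + n) z = cocycle \<theta> A m ((\<theta> ^^ n) z) o\<^sub>L cocycle \<theta> A n z"
  by (induction m) (auto simp: funpow_add blinfun_eqI intro!: blinfun_eqI)

section \<open>Iterates of a map and of its inverse on an invariant set\<close>

locale invertible_dynamics =
  fixes W :: "'w set" and \<theta> \<psi> :: "'w \<Rightarrow> 'w"
  assumes theta_W: "z \<in> W \<Longrightarrow> \<theta> z \<in> W" and psi_W: "z \<in> W \<Longrightarrow> \<psi> z \<in> W"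
    and theta_psi: "z \<in> W \<Longrightarrow> \<theta> (\<psi> z) = z" and psi_theta: "z \<in> W \<Longrightarrow> \<psi> (\<theta> z) = z"
begin

lemma theta_pow_W: "z \<in> W \<Longrightarrow> (\<theta> ^^ n) z \<in> W"
  by (induction n) (auto simp: theta_W)

lemma psi_pow_W: "z \<in> W \<Longrightarrow> (\<psi> ^^ n) z \<in> W"
  by (induction n) (auto simp: psi_W)

lemma theta_pow_psi_pow: "z \<in> W \<Longrightarrow> (\<theta> ^^ n) ((\<psi> ^^ n) z) = z"
proof (induction n arbitrary: z)
  case (Suc n)
  have "(\<theta> ^^ Suc n) ((\<psi> ^^ Suc n) z) = (\<theta> ^^ n) (\<theta> (\<psi> ((\<psi> ^^ n) z)))"
    by (simp add: funpow_swap1)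
  then show ?case using Suc psi_pow_W theta_psi by simp
qed simp

lemma theta_pow_psi_pow_add: "z \<in> W \<Longrightarrow> (\<theta> ^^ n) ((\<psi> ^^ (n + m)) z) = (\<psi> ^^ m) z"
  using theta_pow_psi_pow[of "(\<psi> ^^ m) z" n] psi_pow_W by (simp add: funpow_add)

end

text \<open>Measure theory is kept out: up to the invariant splitting everything is proved orbit by
  orbit. \<open>separation\<close> is C3 freed from the normalization of the vector.\<close>

locale contracting_cones = invertible_dynamics W \<theta> \<psi>
  for W :: "'w set" and \<theta> \<psi> :: "'w \<Rightarrow> 'w" +
  fixes A :: "'w \<Rightarrow> 'x::banach \<Rightarrow>\<^sub>L 'x" and k :: "'w \<Rightarrow> nat" and C :: "'w \<Rightarrow> 'x set"
    and E0 F0 :: "'w \<Rightarrow> 'x set" and c :: "'w \<Rightarrow> real"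
  assumes A_kernel: "z \<in> W \<Longrightarrow> blinfun_apply (A z) v = 0 \<Longrightarrow> v = 0"
    and k_inv: "z \<in> W \<Longrightarrow> k (\<theta> z) = k z"
    and C_closed: "z \<in> W \<Longrightarrow> closed (C z)"
    and C_scale: "z \<in> W \<Longrightarrow> v \<in> C z \<Longrightarrow> l *\<^sub>R v \<in> C z"
    and C_inv: "z \<in> W \<Longrightarrow> v \<in> C z \<Longrightarrow> blinfun_apply (A z) v \<in> C (\<theta> z)"
    and E0_dim: "z \<in> W \<Longrightarrow> has_dim (E0 z) (k z)" and E0_C: "z \<in> W \<Longrightarrow> E0 z \<subseteq> C z"
    and F0_codim: "z \<in> W \<Longrightarrow> has_codim (F0 z) (k z)" and F0_C: "z \<in> W \<Longrightarrow> F0 z \<inter> C z = {0}"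
    and c_ge_1: "z \<in> W \<Longrightarrow> c z \<ge> 1"
    and separation: "z \<in> W \<Longrightarrow> v \<in> C z \<Longrightarrow> u \<notin> C (\<theta> z) \<Longrightarrow>
      norm (blinfun_apply (A z) v) \<le> c z * norm (blinfun_apply (A z) v - u)"
begin

abbreviation "T \<equiv> cocycle \<theta> A"

text \<open>Bounds the ratio of \<open>norm (T n z w) * norm v\<close> to
  \<open>norm w * norm (T n z v)\<close>. The factor \<open>c (\<psi> z)\<close> comes from the
  radius of the initial segment around \<open>v\<close>, the product from its growth during the
  first \<open>n - 1\<close> steps; the last step turns membership in the cone into a norm estimate
  and contributes the remaining factor.\<close>

definition "dom_const n z = (if n = 0 then 1 else
  (1 + c ((\<theta> ^^ (n - 1)) z)) * c (\<psi> z) / (\<Prod>i<n-1. 1 + 1 / (4 * (c ((\<theta> ^^ i) z))\<^sup>2)))"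

text \<open>
  C3 puts \<open>A(\<psi> z) C(\<psi> z)\<close> into the set below.  Unlike that image it is closed, so the limit space
  \<open>E\<close> stays inside it.
\<close>

definition "core z = {v. \<forall>u. u \<notin> C z \<longrightarrow> norm v \<le> c (\<psi> z) * norm (v - u)}"

lemma k_theta_pow: "z \<in> W \<Longrightarrow> k ((\<theta> ^^ n) z) = k z"
  by (induction n) (auto simp: k_inv theta_pow_W)

lemma k_psi_pow: "z \<in> W \<Longrightarrow> k ((\<psi> ^^ n) z) = k z"
  using k_theta_pow[of "(\<psi> ^^ n) z" n] by (simp add: theta_pow_psi_pow psi_pow_W)

lemma zero_in_C: "z \<in> W \<Longrightarrow> 0 \<in> C z"
  using F0_C by blast

lemma c_pos: "z \<in> W \<Longrightarrow> c z > 0"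
  using c_ge_1 by (meson less_le_trans zero_less_one)

lemma dom_const_nonneg: "z \<in> W \<Longrightarrow> 0 \<le> dom_const n z"
  unfolding dom_const_def using c_pos[OF theta_pow_W] c_pos[OF psi_W]
  by (auto intro!: divide_nonneg_nonneg mult_nonneg_nonneg prod_nonneg add_nonneg_nonneg
      simp: less_imp_le)

lemma core_subset: "z \<in> W \<Longrightarrow> core z \<subseteq> C z"
  using zero_in_C unfolding core_def by force

lemma A_core: "z \<in> W \<Longrightarrow> v \<in> C z \<Longrightarrow> blinfun_apply (A z) v \<in> core (\<theta> z)"
  using separation unfolding core_def by (simp add: psi_theta)

lemma closed_core: "closed (core z)"
proof -
  have "core z = (\<Inter>u\<in>-C z. {v. norm v \<le> c (\<psi> z) * norm (v - u)})"
    unfolding core_def by auto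
  also have "closed \<dots>" by (intro closed_INT ballI closed_Collect_le continuous_intros)
  finally show ?thesis .
qed

text \<open>The definition of \<open>core\<close> speaks only of \<open>u\<close> outside the cone,
  which excludes 0. That case is added by \<open>c \<ge> 1\<close>, so that the inequality is
  available on whole subspaces meeting the cone only in 0.\<close>

lemma core_sep:
  assumes "z \<in> W" "v \<in> core z" "u \<in> C z \<Longrightarrow> u = 0"
  shows "norm v \<le> c (\<psi> z) * norm (v - u)"
proof (cases "u = 0")
  case True
  have "1 * norm v \<le> c (\<psi> z) * norm v"
    using c_ge_1[OF psi_W[OF assms(1)]] by (intro mult_right_mono) auto
  then show ?thesis using True by simp
next
  case False
  then show ?thesis using assms unfolding core_def by blast
qed

lemma outside_scale:
  assumes "z \<in> W" "u \<in> C z \<Longrightarrow> u = 0" "s *\<^sub>R u \<in> C z"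
  shows "s *\<^sub>R u = 0"
proof (cases "s = 0")
  case False
  then have "u \<in> C z" using C_scale[OF assms(1,3), of "1 / s"] by simp
  then show ?thesis using assms(2) by simp
qed simp

lemma T_Suc: "T (Suc n) z x = A ((\<theta> ^^ n) z) (T n z x)"
  by simp

lemma T_Suc_shift: "T (Suc n) z x = T n (\<theta> z) (A z x)"
  using cocycle_add[of \<theta> A n 1 z] by simp

lemma T_add: "T (m + n) z x = T m ((\<theta> ^^ n) z) (T n z x)"
  by (simp add: cocycle_add)

lemma T_C: "z \<in> W \<Longrightarrow> v \<in> C z \<Longrightarrow> T n z v \<in> C ((\<theta> ^^ n) z)"
  by (induction n) (auto simp: C_inv theta_pow_W)

lemma T_inj: "z \<in> W \<Longrightarrow> T n z v = 0 \<Longrightarrow> v = 0"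
  by (induction n) (auto dest: A_kernel[OF theta_pow_W])

lemma T_Suc_core: "z \<in> W \<Longrightarrow> v \<in> C z \<Longrightarrow> T (Suc n) z v \<in> core ((\<theta> ^^ Suc n) z)"
  using A_core[OF theta_pow_W T_C] by simp

lemma T_core: "z \<in> W \<Longrightarrow> v \<in> core z \<Longrightarrow> T n z v \<in> core ((\<theta> ^^ n) z)"
  using T_Suc_core core_subset by (cases n) fastforce+

lemma psi_theta_pow: "z \<in> W \<Longrightarrow> \<psi> ((\<theta> ^^ Suc n) z) = (\<theta> ^^ n) z"
  using psi_theta theta_pow_W by simp

text \<open>The vectors of \<open>F\<close> avoid the cones for all times, those of the \<open>n\<close>-th pullback only up to time \<open>n\<close>.\<close>

definition avoids :: "nat \<Rightarrow> 'w \<Rightarrow> 'x \<Rightarrow> bool" where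
  "avoids n z w \<longleftrightarrow> (\<forall>j\<le>n. T j z w \<in> C ((\<theta> ^^ j) z) \<longrightarrow> T j z w = 0)"

text \<open>Induction on the time. Once the vector with parameter \<open>t\<close> is in the cone at
  time \<open>j\<close>, its next image \<open>a\<close> lies in the core, so there is room around
  it proportional to \<open>norm a\<close>; as \<open>norm a\<close> also controls
  \<open>norm (t *\<^sub>R w')\<close>, the parameter can grow by a fixed proportion.\<close>

lemma cone_radius_growth:
  assumes z: "z \<in> W" and v: "v \<in> core z" and w: "avoids n z w"
  shows "j \<le> n \<Longrightarrow> \<bar>s\<bar> * norm w * c (\<psi> z) < (\<Prod>i<j. 1 + 1 / (4 * (c ((\<theta> ^^ i) z))\<^sup>2)) * norm v \<Longrightarrow>
    T j z (v + s *\<^sub>R w) \<in> C ((\<theta> ^^ j) z)"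
proof (induction j arbitrary: s)
  case 0
  show ?case
  proof (rule ccontr)
    assume "\<not> ?thesis"
    then have "v + s *\<^sub>R w \<notin> C z" by simp
    then have "norm v \<le> c (\<psi> z) * norm (v - (v + s *\<^sub>R w))" using v unfolding core_def by blast
    then show False using 0 by (simp add: algebra_simps)
  qed
next
  case (Suc j)
  define cj where "cj = c ((\<theta> ^^ j) z)"
  have cj: "cj \<ge> 1" unfolding cj_def using c_ge_1 theta_pow_W z by blast
  \<comment> \<open>Enlarging \<open>t\<close> by \<open>t * q\<close> moves \<open>a\<close> by
    \<open>q * norm (t *\<^sub>R w')\<close>, at most \<open>2 * q * cj * norm a\<close>; with this
    \<open>q\<close> that is half of the available room \<open>norm a / cj\<close>.\<close>
  define q where "q = 1 / (4 * cj\<^sup>2)"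
  have q: "q > 0" using cj unfolding q_def by simp
  define t where "t = s / (1 + q)"
  have st: "s = t * (1 + q)" using q unfolding t_def by simp
  have "\<bar>s\<bar> * norm w * c (\<psi> z) = (\<bar>t\<bar> * norm w * c (\<psi> z)) * (1 + q)" using q by (simp add: st abs_mult)
  moreover have "(\<Prod>i<Suc j. 1 + 1 / (4 * (c ((\<theta> ^^ i) z))\<^sup>2)) * norm v =
      ((\<Prod>i<j. 1 + 1 / (4 * (c ((\<theta> ^^ i) z))\<^sup>2)) * norm v) * (1 + q)" by (simp add: q_def cj_def)
  ultimately have "\<bar>t\<bar> * norm w * c (\<psi> z) < (\<Prod>i<j. 1 + 1 / (4 * (c ((\<theta> ^^ i) z))\<^sup>2)) * norm v"
    using Suc.prems(2) q by (metis add_pos_pos mult_less_cancel_right_pos zero_less_one)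
  then have IH: "T j z (v + t *\<^sub>R w) \<in> C ((\<theta> ^^ j) z)" using Suc.IH Suc.prems(1) by simp
  define b where "b = T (Suc j) z v"
  define w' where "w' = T (Suc j) z w"
  define a where "a = T (Suc j) z (v + t *\<^sub>R w)"
  have a_eq: "a = b + t *\<^sub>R w'"
    unfolding a_def b_def w'_def by (simp add: blinfun.add_right blinfun.scaleR_right)
  have goal: "T (Suc j) z (v + s *\<^sub>R w) = a + (t * q) *\<^sub>R w'"
    unfolding a_def w'_def st by (simp add: blinfun.add_right blinfun.scaleR_right algebra_simps)
  have W': "(\<theta> ^^ Suc j) z \<in> W" using theta_pow_W z by blast
  have aG: "a \<in> core ((\<theta> ^^ Suc j) z)"
    unfolding a_def T_Suc using A_core[OF theta_pow_W[OF z] IH] by simp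
  have bG: "b \<in> core ((\<theta> ^^ Suc j) z)" unfolding b_def using T_core z v by blast
  have w'C: "w' \<in> C ((\<theta> ^^ Suc j) z) \<Longrightarrow> w' = 0"
    unfolding w'_def using w Suc.prems(1) unfolding avoids_def by blast
  have psi: "c (\<psi> ((\<theta> ^^ Suc j) z)) = cj" unfolding cj_def using psi_theta_pow z by simp
  \<comment> \<open>\<open>b\<close> lies in the core and \<open>(-t) *\<^sub>R w'\<close> is
    outside the cone or 0, so \<open>norm b\<close> is controlled by the difference of the two,
    which is \<open>a\<close>.\<close>
  have lower: "norm (t *\<^sub>R w') \<le> 2 * cj * norm a"
  proof -
    have "norm b \<le> cj * norm (b - (-t) *\<^sub>R w')"
      using core_sep[OF W' bG, of "(-t) *\<^sub>R w'"] outside_scale[OF W' w'C] unfolding psi by blast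
    then have 1: "norm b \<le> cj * norm a" by (simp add: a_eq)
    have 2: "norm (t *\<^sub>R w') \<le> norm a + norm b"
      using norm_triangle_ineq4[of a b] by (simp add: a_eq)
    have "1 * norm a \<le> cj * norm a" using cj by (intro mult_right_mono) auto
    then show ?thesis using 1 2 by linarith
  qed
  show ?case
  proof (rule ccontr)
    assume *: "\<not> ?thesis"
    then have "norm a \<le> cj * norm (a - (a + (t * q) *\<^sub>R w'))"
      using aG unfolding core_def goal psi by blast
    then have "norm a \<le> cj * q * norm (t *\<^sub>R w')" using q by (simp add: abs_mult mult.assoc mult.left_commute)
    also have "\<dots> \<le> cj * q * (2 * cj * norm a)" using lower cj q by (intro mult_left_mono) auto
    also have "\<dots> = norm a / 2" using cj unfolding q_def by (simp add: field_simps power2_eq_square)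
    \<comment> \<open>Leaving the cone forces \<open>a = 0\<close> and then
      \<open>t *\<^sub>R w' = 0\<close>; but then the vector that left is 0, which belongs to the
      cone.\<close>
    finally have "a = 0" by simp
    then have "norm (t *\<^sub>R w') \<le> 0" using lower by (metis norm_zero mult_zero_right)
    then have "t *\<^sub>R w' = 0" unfolding norm_le_zero_iff .
    then have "T (Suc j) z (v + s *\<^sub>R w) = 0" using goal \<open>a = 0\<close> by auto
    then show False using * zero_in_C[OF W'] by simp
  qed
qed

text \<open>For an admissible radius \<open>t\<close> the image of \<open>v + t w\<close> is in the
  core while that of \<open>t w\<close> avoids the cone; hence the former is controlled by their
  difference, the image of \<open>v\<close>, and with it \<open>t * norm w'\<close>. The constant is
  read off at the largest radius.\<close>

lemma domination:
  assumes z: "z \<in> W" and v: "v \<in> core z" and w: "avoids n z w"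
  shows "norm (T n z w) * norm v \<le> dom_const n z * norm w * norm (T n z v)"
proof (cases n)
  case 0
  then show ?thesis by (simp add: dom_const_def)
next
  case (Suc j)
  define cj where "cj = c ((\<theta> ^^ j) z)"
  have cj: "cj \<ge> 1" unfolding cj_def using c_ge_1 theta_pow_W z by blast
  define R where "R = (\<Prod>i<j. 1 + 1 / (4 * (c ((\<theta> ^^ i) z))\<^sup>2))"
  have R: "R > 0" unfolding R_def by (intro prod_pos) (simp add: add_pos_nonneg)
  define b where "b = T n z v"
  define w' where "w' = T n z w"
  have W': "(\<theta> ^^ n) z \<in> W" using theta_pow_W z by blast
  have w'C: "w' \<in> C ((\<theta> ^^ n) z) \<Longrightarrow> w' = 0" using w unfolding w'_def avoids_def by blast
  have psi: "c (\<psi> ((\<theta> ^^ n) z)) = cj" unfolding cj_def Suc using psi_theta_pow z by simp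
  have key: "t * norm w' \<le> (1 + cj) * norm b" if t: "t \<ge> 0" "t * norm w * c (\<psi> z) < R * norm v" for t
  proof -
    have tC: "T j z (v + t *\<^sub>R w) \<in> C ((\<theta> ^^ j) z)"
      using cone_radius_growth[OF z v w, of j t] t unfolding R_def Suc by simp
    define a where "a = T n z (v + t *\<^sub>R w)"
    have aG: "a \<in> core ((\<theta> ^^ n) z)"
      unfolding a_def Suc T_Suc using A_core[OF theta_pow_W[OF z] tC] by simp
    have a_eq: "a = b + t *\<^sub>R w'"
      unfolding a_def b_def w'_def by (simp add: blinfun.add_right blinfun.scaleR_right)
    have "norm a \<le> cj * norm (a - t *\<^sub>R w')"
      using core_sep[OF W' aG, of "t *\<^sub>R w'"] outside_scale[OF W' w'C] unfolding psi by blast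
    then have 1: "norm a \<le> cj * norm b" by (simp add: a_eq)
    have "norm (t *\<^sub>R w') \<le> norm a + norm b"
      using norm_triangle_ineq4[of a b] by (simp add: a_eq)
    then show ?thesis using 1 t(1) by (simp add: algebra_simps)
  qed
  have D: "dom_const n z = (1 + cj) * c (\<psi> z) / R" unfolding dom_const_def Suc R_def cj_def by simp
  have cp: "c (\<psi> z) > 0" using c_pos psi_W z by blast
  show ?thesis
  proof (cases "w = 0 \<or> v = 0")
    case True
    then show ?thesis using D cp cj R by auto
  next
    case False
    \<comment> \<open>The critical radius. Admissibility is a strict inequality, so
      \<open>t0\<close> is approached by \<open>r * t0\<close> with \<open>r < 1\<close>.\<close>
    define t0 where "t0 = R * norm v / (norm w * c (\<psi> z))"
    have t0: "t0 > 0" unfolding t0_def using R False cp by simp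
    have "r * (t0 * norm w') \<le> (1 + cj) * norm b" if "0 < r" "r < 1" for r
    proof -
      have "r * t0 * norm w * c (\<psi> z) = r * (R * norm v)" unfolding t0_def using False cp by simp
      also have "\<dots> < R * norm v" using that R False by simp
      finally show ?thesis using key[of "r * t0"] that t0 by (simp add: mult.assoc)
    qed
    then have "t0 * norm w' \<le> (1 + cj) * norm b" by (rule field_le_mult_one_interval)
    then have "norm v * norm w' * R \<le> (1 + cj) * norm b * (norm w * c (\<psi> z))"
      unfolding t0_def using False cp by (simp add: field_simps)
    then show ?thesis unfolding D using R by (simp add: field_simps b_def w'_def)
  qed
qed

end

section \<open>The invariant splitting of a contracting cone family\<close>

context contracting_cones
begin

definition "E_pre n z = T n ((\<psi> ^^ n) z) ` E0 ((\<psi> ^^ n) z)"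
definition "F_pre n z = {x. T n z x \<in> F0 ((\<theta> ^^ n) z)}"

lemma inj_on_T: "z \<in> W \<Longrightarrow> inj_on (T n z) S"
proof (rule inj_onI)
  fix x y assume "z \<in> W" "T n z x = T n z y"
  then have "T n z (x - y) = 0" by (simp add: blinfun.diff_right)
  then show "x = y" using T_inj[OF \<open>z \<in> W\<close>] eq_iff_diff_eq_0 by blast
qed

lemma linear_T: "linear (blinfun_apply (T n z))"
  using blinfun.bounded_linear_right bounded_linear.linear by blast

lemma E_pre_dim: "z \<in> W \<Longrightarrow> has_dim (E_pre n z) (k z)"
  unfolding E_pre_def using has_dim_image[OF linear_T inj_on_T[OF psi_pow_W] E0_dim[OF psi_pow_W]]
  by (simp add: k_psi_pow)

text \<open>One application of \<open>A\<close> is what leads from the cone into the core. This is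
  why pushforwards with index at least 1 are used below.\<close>

lemma E_pre_core: "z \<in> W \<Longrightarrow> E_pre (Suc n) z \<subseteq> core z"
proof
  fix x assume z: "z \<in> W" and "x \<in> E_pre (Suc n) z"
  then obtain e where e: "e \<in> E0 ((\<psi> ^^ Suc n) z)" "x = T (Suc n) ((\<psi> ^^ Suc n) z) e"
    unfolding E_pre_def by blast
  show "x \<in> core z"
    using T_Suc_core[OF psi_pow_W[OF z, of "Suc n"], of e n] e E0_C[OF psi_pow_W[OF z, of "Suc n"]]
      theta_pow_psi_pow[OF z, of "Suc n"] by (metis subsetD)
qed

lemma T_E_pre: "z \<in> W \<Longrightarrow> T n ((\<psi> ^^ n) z) ` E_pre m ((\<psi> ^^ n) z) = E_pre (n + m) z"
proof -
  assume "z \<in> W"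
  have "(\<psi> ^^ m) ((\<psi> ^^ n) z) = (\<psi> ^^ (n + m)) z" by (metis add.commute comp_apply funpow_add)
  moreover have "(\<theta> ^^ m) ((\<psi> ^^ (n + m)) z) = (\<psi> ^^ n) z"
    using theta_pow_psi_pow_add[OF \<open>z \<in> W\<close>, of m n] by (simp add: add.commute)
  ultimately show ?thesis unfolding E_pre_def by (simp add: image_image T_add[of n m])
qed

lemma A_E_pre: "z \<in> W \<Longrightarrow> A z ` E_pre n z = E_pre (Suc n) (\<theta> z)"
  using T_E_pre[OF theta_W, of z 1 n] by (simp add: psi_theta)

text \<open>An orbit that enters the cone at time \<open>j\<close> is still there at time
  \<open>n\<close>, where \<open>F0\<close> meets the cone only in 0; injectivity carries the
  vanishing back to time \<open>j\<close>.\<close>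

lemma F_pre_avoids:
  assumes z: "z \<in> W" and x: "x \<in> F_pre n z"
  shows "avoids n z x"
  unfolding avoids_def
proof (intro allI impI)
  fix j assume j: "j \<le> n" and "T j z x \<in> C ((\<theta> ^^ j) z)"
  then have "T (n - j) ((\<theta> ^^ j) z) (T j z x) \<in> C ((\<theta> ^^ (n - j)) ((\<theta> ^^ j) z))"
    using T_C theta_pow_W z by blast
  moreover have "(\<theta> ^^ (n - j)) ((\<theta> ^^ j) z) = (\<theta> ^^ n) z"
    using j by (metis comp_apply funpow_add le_add_diff_inverse2)
  moreover have "T (n - j) ((\<theta> ^^ j) z) (T j z x) = T n z x"
    using T_add[of "n - j" j z x] j by simp
  ultimately have "T n z x \<in> C ((\<theta> ^^ n) z)" by simp
  then have "T n z x = 0" using x F0_C[OF theta_pow_W[OF z]] unfolding F_pre_def by blast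
  then show "T j z x = 0" using T_inj[OF z] by (metis blinfun.zero_right)
qed

lemma avoids_C: "avoids n z x \<Longrightarrow> x \<in> C z \<Longrightarrow> x = 0"
  unfolding avoids_def by (metis blinfun_apply_id_blinfun cocycle.simps(1) funpow_0 id_apply le0)

text \<open>A preimage of a space of codimension k could have smaller codimension. Here it does not:
  \<open>E_pre 1 z\<close> is carried injectively into the cone at time \<open>n\<close>, so its
  image is complementary to \<open>F0\<close> there.\<close>

lemma F_pre_codim:
  assumes z: "z \<in> W"
  shows "has_codim (F_pre n z) (k z)"
proof -
  define E where "E = E_pre 1 z"
  have E: "has_dim E (k z)" "E \<subseteq> C z" unfolding E_def
    using E_pre_dim E_pre_core[of _ 0] core_subset z by fastforce+
  have W': "(\<theta> ^^ n) z \<in> W" using theta_pow_W z by blast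
  have F0: "subspace (F0 ((\<theta> ^^ n) z))" using F0_codim[OF W'] unfolding has_codim_def by blast
  have sF: "subspace (F_pre n z)"
    using linear_subspace_vimage[OF linear_T F0] unfolding F_pre_def vimage_def .
  have "E \<inter> F_pre n z = {0}"
    using F_pre_avoids[OF z] avoids_C E subspace_0[OF sF] subspace_0[OF has_dim_subspace[OF E(1)]] by blast
  moreover have "\<exists>e\<in>E. \<exists>f\<in>F_pre n z. x = e + f" for x
  proof -
    have 1: "has_dim (T n z ` E) (k ((\<theta> ^^ n) z))"
      using has_dim_image[OF linear_T inj_on_T[OF z] E(1)] k_theta_pow z by simp
    have "T n z ` E \<subseteq> C ((\<theta> ^^ n) z)" using T_C z E(2) by blast
    then have 2: "T n z ` E \<inter> F0 ((\<theta> ^^ n) z) = {0}"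
      using F0_C[OF W'] subspace_0[OF F0] subspace_0[OF has_dim_subspace[OF 1]] by blast
    obtain e where e: "e \<in> E" "T n z x - T n z e \<in> F0 ((\<theta> ^^ n) z)"
      using has_dim_codim_complement[OF 1 F0_codim[OF W'] 2] by blast
    then have "x - e \<in> F_pre n z" unfolding F_pre_def by (simp add: blinfun.diff_right)
    then show ?thesis using e(1) by (intro bexI[of _ e] bexI[of _ "x - e"]) auto
  qed
  ultimately show ?thesis unfolding has_codim_def using sF E(1) by blast
qed

text \<open>The norm bound is the same for all such pairs at \<open>z\<close>; the limits of
  projections rest on this uniformity.\<close>

lemma proj_core:
  assumes z: "z \<in> W" and E: "has_dim E (k z)" "E \<subseteq> core z"
    and F: "has_codim F (k z)" "\<And>u. u \<in> F \<Longrightarrow> u \<in> C z \<Longrightarrow> u = 0"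
  shows "E \<inter> F = {0}" "proj E F x \<in> E" "x - proj E F x \<in> F" "norm (proj E F) \<le> c (\<psi> z)"
    "norm (proj E F x) \<le> c (\<psi> z) * norm x"
    "e \<in> E \<Longrightarrow> x - e \<in> F \<Longrightarrow> proj E F x = e"
proof -
  have sep: "norm v \<le> c (\<psi> z) * norm (v - u)" if "v \<in> E" "u \<in> F" for v u
    using core_sep[OF z] that E(2) F(2) by blast
  note p = projection_exists[OF E(1) F(1) c_ge_1[OF psi_W[OF z]] sep]
  show "E \<inter> F = {0}" using p by blast
  show P: "proj E F x \<in> E" "x - proj E F x \<in> F" using p(2) unfolding is_projection_def by auto
  show n: "norm (proj E F) \<le> c (\<psi> z)" using p(3) by blast
  show "norm (proj E F x) \<le> c (\<psi> z) * norm x"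
    using norm_blinfun[of "proj E F" x] mult_right_mono[OF n norm_ge_zero[of x]] by linarith
  show "proj E F x = e" if "e \<in> E" "x - e \<in> F"
    using is_projection_unique[OF p(2) has_dim_subspace[OF E(1)] _ p(1) that] F(1)
    unfolding has_codim_def by blast
qed

text \<open>The range is fixed and only the kernel moves with \<open>n\<close>, so each of these
  projections fixes the values of all the others.\<close>

definition "PF n z = proj (E_pre 1 z) (F_pre (Suc n) z)"

lemma PF:
  assumes z: "z \<in> W"
  shows "PF n z x \<in> E_pre 1 z" "x - PF n z x \<in> F_pre (Suc n) z"
    "norm (PF n z) \<le> c (\<psi> z)" "norm (PF n z x) \<le> c (\<psi> z) * norm x"
    "e \<in> E_pre 1 z \<Longrightarrow> x - e \<in> F_pre (Suc n) z \<Longrightarrow> PF n z x = e"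
proof -
  have "\<And>u. u \<in> F_pre (Suc n) z \<Longrightarrow> u \<in> C z \<Longrightarrow> u = 0"
    using F_pre_avoids[OF z] avoids_C by blast
  note p = proj_core[OF z E_pre_dim[OF z, of 1]
    E_pre_core[OF z, of 0, folded One_nat_def] F_pre_codim[OF z] this]
  show "PF n z x \<in> E_pre 1 z" "x - PF n z x \<in> F_pre (Suc n) z"
    "norm (PF n z) \<le> c (\<psi> z)" "norm (PF n z x) \<le> c (\<psi> z) * norm x"
    "e \<in> E_pre 1 z \<Longrightarrow> x - e \<in> F_pre (Suc n) z \<Longrightarrow> PF n z x = e"
    unfolding PF_def using p by blast+
qed

lemma subspace_F_pre: "z \<in> W \<Longrightarrow> subspace (F_pre n z)"
  using F_pre_codim unfolding has_codim_def by blast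

lemma avoids_mono: "avoids m z x \<Longrightarrow> n \<le> m \<Longrightarrow> avoids n z x"
  unfolding avoids_def by auto

text \<open>Let \<open>v = PF n z w\<close>. At time \<open>Suc n\<close> the images of
  \<open>v\<close> and \<open>w\<close> differ by a vector of \<open>F0\<close>, so core separation
  bounds the image of \<open>v\<close> by that of \<open>w\<close>. Domination gives the opposite
  comparison with a small factor; in the combination the norm of the image of \<open>w\<close>
  cancels.\<close>

lemma PF_small:
  assumes z: "z \<in> W" and w: "avoids (Suc n) z w"
  shows "norm (PF n z w) \<le> c ((\<theta> ^^ n) z) * dom_const (Suc n) z * norm w"
proof -
  define v where "v = PF n z w"
  define c' where "c' = c ((\<theta> ^^ n) z)"
  have v: "v \<in> core z" unfolding v_def using PF(1)[OF z] E_pre_core[OF z, of 0] by auto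
  have W': "(\<theta> ^^ Suc n) z \<in> W" using theta_pow_W z by blast
  have "T (Suc n) z (w - v) \<in> F0 ((\<theta> ^^ Suc n) z)"
    using PF(2)[OF z, where x=w and n=n] unfolding F_pre_def v_def by blast
  then have "T (Suc n) z (v - w) \<in> C ((\<theta> ^^ Suc n) z) \<Longrightarrow> T (Suc n) z (v - w) = 0"
    using F0_C[OF W'] C_scale[OF W', of "T (Suc n) z (v - w)" "-1"]
      blinfun.minus_right[of "T (Suc n) z" "v - w"]
    by (metis IntI minus_diff_eq neg_equal_0_iff_equal scaleR_minus1_left singletonD)
  then have "norm (T (Suc n) z v) \<le> c (\<psi> ((\<theta> ^^ Suc n) z)) * norm (T (Suc n) z v - T (Suc n) z (v - w))"
    using core_sep[OF W' T_core[OF z v]] by blast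
  also have "\<dots> = c' * norm (T (Suc n) z w)"
    unfolding psi_theta_pow[OF z] c'_def by (simp add: blinfun.diff_right del: cocycle.simps funpow.simps)
  finally have 1: "norm (T (Suc n) z v) \<le> c' * norm (T (Suc n) z w)" .
  have 2: "norm (T (Suc n) z w) * norm v \<le> dom_const (Suc n) z * norm w * norm (T (Suc n) z v)"
    using domination[OF z v w] .
  show ?thesis
  proof (cases "w = 0")
    case False
    then have pos: "norm (T (Suc n) z w) > 0" using T_inj[OF z] zero_less_norm_iff by blast
    have D: "dom_const (Suc n) z \<ge> 0" using dom_const_nonneg[OF z] .
    have "norm (T (Suc n) z w) * norm v \<le> dom_const (Suc n) z * norm w * (c' * norm (T (Suc n) z w))"
      using 2 mult_left_mono[OF 1, of "dom_const (Suc n) z * norm w"] D by simp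
    then have "norm (T (Suc n) z w) * norm v \<le> norm (T (Suc n) z w) * (c' * dom_const (Suc n) z * norm w)"
      by (simp add: mult_ac)
    then show ?thesis using pos unfolding v_def c'_def by (metis mult_le_cancel_left_pos)
  qed (simp add: blinfun.zero_right)
qed

end

text \<open>The two decaying sequences are the error bounds of \<open>PF_small\<close> and
  \<open>QE_step\<close>: the first makes the kernels converge, the second the ranges.\<close>

locale tempered_contracting_cones = contracting_cones W \<theta> \<psi> A k C E0 F0 c
  for W :: "'w set" and \<theta> \<psi> :: "'w \<Rightarrow> 'w" and A :: "'w \<Rightarrow> 'x::banach \<Rightarrow>\<^sub>L 'x"
    and k :: "'w \<Rightarrow> nat" and C E0 F0 :: "'w \<Rightarrow> 'x set" and c :: "'w \<Rightarrow> real" +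
  assumes forward_decay: "z \<in> W \<Longrightarrow> (\<lambda>n. c ((\<theta> ^^ n) z) * dom_const (Suc n) z) \<longlonglongrightarrow> 0"
    and backward_decay: "z \<in> W \<Longrightarrow> (\<lambda>n. (1 + c ((\<psi> ^^ Suc n) z)) * dom_const n ((\<psi> ^^ n) z)) \<longlonglongrightarrow> 0"
begin

section \<open>The limit of the pullbacks\<close>

definition "PF_lim z = lim (\<lambda>n. PF n z)"
definition "F z = {x. blinfun_apply (PF_lim z) x = 0}"

lemma PF_PF:
  assumes z: "z \<in> W" shows "PF n z (PF m z x) = PF m z x"
  using PF(5)[OF z PF(1)[OF z]] subspace_0[OF subspace_F_pre[OF z]] by simp

lemma PF_tendsto:
  assumes z: "z \<in> W" shows "(\<lambda>n. PF n z) \<longlonglongrightarrow> PF_lim z"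
  unfolding PF_lim_def
proof (rule convergent_of_tail_bound)
  fix n m :: nat assume nm: "n \<le> m"
  let ?b = "c ((\<theta> ^^ n) z) * dom_const (Suc n) z * (1 + c (\<psi> z))"
  have D: "c ((\<theta> ^^ n) z) * dom_const (Suc n) z \<ge> 0"
    using dom_const_nonneg[OF z] c_pos[OF theta_pow_W[OF z]] by (simp add: less_imp_le)
  show "norm (PF n z - PF m z) \<le> ?b"
  proof (rule norm_blinfun_bound)
    show "?b \<ge> 0" using D c_pos[OF psi_W[OF z]] by simp
    fix x
    \<comment> \<open>Since \<open>PF n z\<close> fixes the range of \<open>PF m z\<close>, the
      difference of the projections at \<open>x\<close> is \<open>PF n z w\<close>, and
      \<open>w\<close> avoids the cones up to time \<open>Suc m\<close>, hence up to
      \<open>Suc n\<close>.\<close>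
    define w where "w = x - PF m z x"
    have "w \<in> F_pre (Suc m) z" unfolding w_def using PF(2)[OF z] .
    then have "avoids (Suc n) z w" using F_pre_avoids[OF z] avoids_mono nm Suc_le_mono by blast
    then have "norm (PF n z w) \<le> c ((\<theta> ^^ n) z) * dom_const (Suc n) z * norm w"
      using PF_small[OF z] by blast
    also have "\<dots> \<le> c ((\<theta> ^^ n) z) * dom_const (Suc n) z * ((1 + c (\<psi> z)) * norm x)"
    proof (intro mult_left_mono D)
      have "norm w \<le> norm x + norm (PF m z x)" unfolding w_def by (rule norm_triangle_ineq4)
      then show "norm w \<le> (1 + c (\<psi> z)) * norm x" using PF(4)[OF z, where n=m and x=x] by (simp add: algebra_simps)
    qed
    also have "PF n z w = (PF n z - PF m z) x"
      unfolding w_def by (simp add: blinfun.diff_right blinfun.diff_left PF_PF[OF z])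
    finally show "norm ((PF n z - PF m z) x) \<le> ?b * norm x" by (simp add: mult_ac)
  qed
next
  show "(\<lambda>n. c ((\<theta> ^^ n) z) * dom_const (Suc n) z * (1 + c (\<psi> z))) \<longlonglongrightarrow> 0"
    using tendsto_mult_right[OF forward_decay[OF z]] by simp
qed

lemma PF_tendsto_apply: "z \<in> W \<Longrightarrow> (\<lambda>n. PF n z x) \<longlonglongrightarrow> PF_lim z x"
  using PF_tendsto by (intro tendsto_intros)

text \<open>\<open>PF 0 z\<close> fixes every \<open>PF m z x\<close>, hence by continuity their
  limit, and its values lie in the common range.\<close>

lemma PF_lim_E:
  assumes z: "z \<in> W" shows "PF_lim z x \<in> E_pre 1 z"
proof -
  have "(\<lambda>m. PF 0 z (PF m z x)) \<longlonglongrightarrow> PF 0 z (PF_lim z x)"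
    by (intro tendsto_intros PF_tendsto[OF z])
  then have "(\<lambda>m. PF m z x) \<longlonglongrightarrow> PF 0 z (PF_lim z x)" by (simp add: PF_PF[OF z])
  then have "PF_lim z x = PF 0 z (PF_lim z x)" using PF_tendsto_apply[OF z] LIMSEQ_unique by blast
  then show ?thesis using PF(1)[OF z] by metis
qed

lemma PF_lim_id:
  assumes z: "z \<in> W" and "e \<in> E_pre 1 z" shows "PF_lim z e = e"
proof -
  have "PF n z e = e" for n
    using PF(5)[OF z assms(2)] subspace_0[OF subspace_F_pre[OF z]] by simp
  then show ?thesis using PF_tendsto_apply[OF z, of e] LIMSEQ_unique[OF _ tendsto_const] by force
qed

lemma subspace_F: "subspace (F z)"
  unfolding F_def by (auto simp: subspace_def blinfun.add_right blinfun.scaleR_right blinfun.zero_right)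

lemma closed_F: "closed (F z)"
  unfolding F_def by (intro closed_Collect_eq continuous_intros)

lemma F_complement: "z \<in> W \<Longrightarrow> x - PF_lim z x \<in> F z"
  unfolding F_def using PF_lim_id PF_lim_E by (simp add: blinfun.diff_right)

lemma F_codim:
  assumes z: "z \<in> W" shows "has_codim (F z) (k z)"
proof -
  have E: "has_dim (E_pre 1 z) (k z)" using E_pre_dim[OF z] .
  have "x = 0" if "x \<in> E_pre 1 z" "x \<in> F z" for x
    using PF_lim_id[OF z that(1)] that(2) unfolding F_def by simp
  then have "E_pre 1 z \<inter> F z = {0}"
    using subspace_0[OF subspace_F] subspace_0[OF has_dim_subspace[OF E]] by blast
  moreover have "\<exists>e\<in>E_pre 1 z. \<exists>f\<in>F z. x = e + f" for x
  proof -
    define e where "e = PF_lim z x"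
    have "e \<in> E_pre 1 z" "x - e \<in> F z" "x = e + (x - e)"
      unfolding e_def using PF_lim_E[OF z, of x] F_complement[OF z, of x] by auto
    then show ?thesis by blast
  qed
  ultimately show ?thesis unfolding has_codim_def using E subspace_F[of z] by (intro conjI exI[of _ "E_pre 1 z"]) (assumption | simp)+
qed

lemma F_limit:
  assumes z: "z \<in> W" and x: "x \<in> F z"
  shows "(\<lambda>n. x - PF n z x) \<longlonglongrightarrow> x"
  using tendsto_diff[OF tendsto_const[of x] PF_tendsto_apply[OF z, of x]] x by (simp add: F_def)

text \<open>At finite level \<open>A z\<close> maps the pullback of order n + 2 at \<open>z\<close>
  into the one of order n + 1 at \<open>\<theta> z\<close>, which \<open>PF n (\<theta> z)\<close>
  annihilates. Norm convergence of the projections lets this pass to the limit.\<close>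

lemma F_inv:
  assumes z: "z \<in> W" and x: "x \<in> F z"
  shows "A z x \<in> F (\<theta> z)"
proof -
  have W': "\<theta> z \<in> W" using theta_W z .
  have zero: "PF n (\<theta> z) (A z (x - PF (Suc n) z x)) = 0" for n
  proof -
    have "x - PF (Suc n) z x \<in> F_pre (Suc (Suc n)) z" using PF(2)[OF z] .
    then have "A z (x - PF (Suc n) z x) \<in> F_pre (Suc n) (\<theta> z)"
      unfolding F_pre_def by (simp only: mem_Collect_eq T_Suc_shift[of "Suc n"] funpow_Suc_right comp_apply)
    then show ?thesis
      using PF(5)[OF W'] subspace_0[OF has_dim_subspace[OF E_pre_dim[OF W']]] by simp
  qed
  have "(\<lambda>n. PF n (\<theta> z) (A z (x - PF (Suc n) z x))) \<longlonglongrightarrow> PF_lim (\<theta> z) (A z x)"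
    by (intro tendsto_intros PF_tendsto[OF W'] LIMSEQ_Suc[OF F_limit[OF z x]])
  then have "(\<lambda>n. 0) \<longlonglongrightarrow> PF_lim (\<theta> z) (A z x)" unfolding zero .
  then show ?thesis unfolding F_def using LIMSEQ_unique[OF tendsto_const] by fastforce
qed

text \<open>Avoidance of the cone is not a closed condition, so one step of \<open>A\<close> is used
  to reach the core, where it becomes quantitative: \<open>y\<close> is bounded by
  \<open>c z\<close> times its component \<open>PF n (\<theta> z) y\<close>, which tends to
  0.\<close>

lemma F_C:
  assumes z: "z \<in> W" and x: "x \<in> F z" "x \<in> C z"
  shows "x = 0"
proof (rule ccontr)
  assume "x \<noteq> 0"
  have W': "\<theta> z \<in> W" using theta_W z .
  define y where "y = A z x"
  have y: "y \<noteq> 0" "y \<in> core (\<theta> z)" "y \<in> F (\<theta> z)"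
    unfolding y_def using A_kernel[OF z] \<open>x \<noteq> 0\<close> A_core[OF z] x F_inv[OF z] by auto
  have "norm y \<le> c z * norm (PF n (\<theta> z) y)" for n
  proof -
    have "y - PF n (\<theta> z) y \<in> F_pre (Suc n) (\<theta> z)" using PF(2)[OF W'] .
    then have "norm y \<le> c (\<psi> (\<theta> z)) * norm (y - (y - PF n (\<theta> z) y))"
      using core_sep[OF W' y(2)] F_pre_avoids[OF W'] avoids_C by blast
    then show ?thesis using psi_theta[OF z] by simp
  qed
  moreover have "(\<lambda>n. c z * norm (PF n (\<theta> z) y)) \<longlonglongrightarrow> c z * norm (PF_lim (\<theta> z) y)"
    by (intro tendsto_intros PF_tendsto[OF W'])
  ultimately have "norm y \<le> c z * norm (PF_lim (\<theta> z) y)" using LIMSEQ_le_const by blast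
  then show False using y(1,3) unfolding F_def by simp
qed

lemma T_F: "z \<in> W \<Longrightarrow> x \<in> F z \<Longrightarrow> T n z x \<in> F ((\<theta> ^^ n) z)"
  by (induction n) (auto simp: F_inv theta_pow_W)

lemma F_avoids: "z \<in> W \<Longrightarrow> x \<in> F z \<Longrightarrow> avoids n z x"
  unfolding avoids_def using T_F F_C theta_pow_W by blast

section \<open>The limit of the pushforwards\<close>

definition "QE n z = proj (E_pre (Suc n) z) (F z)"
definition "QE_lim z = lim (\<lambda>n. QE n z)"
definition "E z = range (blinfun_apply (QE_lim z))"

lemma QE:
  assumes z: "z \<in> W"
  shows "QE n z x \<in> E_pre (Suc n) z" "x - QE n z x \<in> F z"
    "norm (QE n z x) \<le> c (\<psi> z) * norm x"
    "e \<in> E_pre (Suc n) z \<Longrightarrow> x - e \<in> F z \<Longrightarrow> QE n z x = e"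
proof -
  note p = proj_core[OF z E_pre_dim[OF z] E_pre_core[OF z] F_codim[OF z] F_C[OF z]]
  show "QE n z x \<in> E_pre (Suc n) z" "x - QE n z x \<in> F z"
    "norm (QE n z x) \<le> c (\<psi> z) * norm x"
    "e \<in> E_pre (Suc n) z \<Longrightarrow> x - e \<in> F z \<Longrightarrow> QE n z x = e"
    unfolding QE_def using p by blast+
qed

text \<open>Dually to \<open>PF\<close>, here the kernel \<open>F z\<close> is common to all
  \<open>n\<close> and the range moves.\<close>

lemma QE_cong:
  assumes z: "z \<in> W" and xy: "x - y \<in> F z"
  shows "QE n z x = QE n z y"
proof (rule QE(4)[OF z QE(1)[OF z]])
  have "(x - y) + (y - QE n z y) \<in> F z" using subspace_add[OF subspace_F xy QE(2)[OF z]] .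
  then show "x - QE n z y \<in> F z" by simp
qed

text \<open>Go back \<open>n\<close> steps and split the preimage \<open>v'\<close> of
  \<open>v\<close> as \<open>e + f\<close> along \<open>E_pre 1\<close> and \<open>F\<close>. The
  image of \<open>e\<close> is \<open>QE n z v\<close>, that of \<open>f\<close> is the error. As
  \<open>v'\<close> is in the core, \<open>f\<close> is bounded by \<open>e\<close>, and domination
  makes the image of \<open>f\<close> small against that of \<open>e\<close>.\<close>

lemma QE_step:
  assumes z: "z \<in> W" and nm: "n \<le> m" and v: "v \<in> E_pre (Suc m) z"
  shows "norm (v - QE n z v) \<le>
    (1 + c ((\<psi> ^^ Suc n) z)) * dom_const n ((\<psi> ^^ n) z) * norm (QE n z v)"
proof -
  define \<eta> where "\<eta> = (\<psi> ^^ n) z"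
  define c' where "c' = c ((\<psi> ^^ Suc n) z)"
  have \<eta>: "\<eta> \<in> W" "(\<theta> ^^ n) \<eta> = z" "c (\<psi> \<eta>) = c'"
    unfolding \<eta>_def c'_def using psi_pow_W theta_pow_psi_pow z by auto
  have "E_pre (Suc m) z = T n \<eta> ` E_pre (Suc (m - n)) \<eta>"
    unfolding \<eta>_def T_E_pre[OF z] using nm by simp
  then obtain v' where v': "v' \<in> E_pre (Suc (m - n)) \<eta>" "v = T n \<eta> v'" using v by blast
  define e where "e = QE 0 \<eta> v'"
  define f where "f = v' - e"
  have e: "e \<in> E_pre 1 \<eta>" and f: "f \<in> F \<eta>" unfolding e_def f_def using QE(1,2)[OF \<eta>(1), where n=0] by auto
  have eG: "e \<in> core \<eta>" and v'G: "v' \<in> core \<eta>" using e v'(1) E_pre_core[OF \<eta>(1)] by auto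
  have Te: "T n \<eta> e \<in> E_pre (Suc n) z"
    using T_E_pre[OF z, of n 1] e unfolding \<eta>_def by auto
  have Tf: "T n \<eta> f \<in> F z" using T_F[OF \<eta>(1) f] \<eta>(2) by metis
  have vf: "v - T n \<eta> e = T n \<eta> f" unfolding v'(2) f_def by (simp add: blinfun.diff_right)
  have Q: "QE n z v = T n \<eta> e" using QE(4)[OF z Te] vf Tf by metis
  have "norm v' \<le> c' * norm (v' - f)" using core_sep[OF \<eta>(1) v'G] F_C[OF \<eta>(1) f] \<eta>(3) by metis
  then have "norm v' \<le> c' * norm e" by (simp add: f_def)
  moreover have "norm f \<le> norm v' + norm e" unfolding f_def by (rule norm_triangle_ineq4)
  ultimately have fe: "norm f \<le> (1 + c') * norm e" by (simp add: algebra_simps)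
  have dom: "norm (T n \<eta> f) * norm e \<le> dom_const n \<eta> * norm f * norm (T n \<eta> e)"
    using domination[OF \<eta>(1) eG F_avoids[OF \<eta>(1) f]] .
  have D: "dom_const n \<eta> \<ge> 0"
    using dom_const_nonneg[OF \<eta>(1)] .
  have "norm (T n \<eta> f) \<le> (1 + c') * dom_const n \<eta> * norm (T n \<eta> e)"
  proof (cases "e = 0")
    case True
    then have "f = 0" using fe by simp
    then show ?thesis using True by (simp add: blinfun.zero_right)
  next
    case False
    have "norm (T n \<eta> f) * norm e \<le> dom_const n \<eta> * ((1 + c') * norm e) * norm (T n \<eta> e)"
      using dom mult_right_mono[OF mult_left_mono[OF fe D] norm_ge_zero[of "T n \<eta> e"]] by linarith
    then have "norm (T n \<eta> f) * norm e \<le> ((1 + c') * dom_const n \<eta> * norm (T n \<eta> e)) * norm e"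
      by (simp add: mult_ac)
    then show ?thesis using False by (metis mult_le_cancel_right_pos zero_less_norm_iff)
  qed
  then show ?thesis using vf by (simp only: Q c'_def \<eta>_def)
qed

lemma QE_tendsto:
  assumes z: "z \<in> W" shows "(\<lambda>n. QE n z) \<longlonglongrightarrow> QE_lim z"
  unfolding QE_lim_def
proof (rule convergent_of_tail_bound)
  fix n m :: nat assume nm: "n \<le> m"
  let ?b = "(1 + c ((\<psi> ^^ Suc n) z)) * dom_const n ((\<psi> ^^ n) z)"
  have D: "?b \<ge> 0"
    using dom_const_nonneg[OF psi_pow_W[OF z]] c_pos[OF psi_pow_W[OF z, of "Suc n"]] by (simp add: less_imp_le)
  show "norm (QE n z - QE m z) \<le> ?b * c (\<psi> z)"
  proof (rule norm_blinfun_bound)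
    show "?b * c (\<psi> z) \<ge> 0" using D c_pos[OF psi_W[OF z]] by simp
    fix x
    \<comment> \<open>\<open>x\<close> and \<open>QE m z x\<close> differ by a vector of the common
      kernel.\<close>
    have Q: "QE n z (QE m z x) = QE n z x"
      using QE_cong[OF z QE(2)[OF z]] by metis
    have "norm ((QE n z - QE m z) x) = norm (QE m z x - QE n z (QE m z x))"
      unfolding Q by (simp add: blinfun.diff_left norm_minus_commute)
    also have "\<dots> \<le> ?b * norm (QE n z x)" using QE_step[OF z nm QE(1)[OF z, where n=m and x=x]] unfolding Q .
    also have "\<dots> \<le> ?b * (c (\<psi> z) * norm x)" by (intro mult_left_mono D QE(3)[OF z])
    finally show "norm ((QE n z - QE m z) x) \<le> ?b * c (\<psi> z) * norm x" by (simp only: mult.assoc)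
  qed
next
  show "(\<lambda>n. (1 + c ((\<psi> ^^ Suc n) z)) * dom_const n ((\<psi> ^^ n) z) * c (\<psi> z)) \<longlonglongrightarrow> 0"
    using tendsto_mult_right[OF backward_decay[OF z]] by simp
qed

lemma QE_tendsto_apply: "z \<in> W \<Longrightarrow> (\<lambda>n. QE n z x) \<longlonglongrightarrow> QE_lim z x"
  using QE_tendsto by (intro tendsto_intros)

lemma QE_lim_F:
  assumes z: "z \<in> W" shows "x - QE_lim z x \<in> F z"
  using closed_sequentially[OF closed_F _ tendsto_diff[OF tendsto_const QE_tendsto_apply[OF z]]]
    QE(2)[OF z] by blast

lemma E_core:
  assumes z: "z \<in> W" shows "E z \<subseteq> core z"
  unfolding E_def
  using closed_sequentially[OF closed_core _ QE_tendsto_apply[OF z]] QE(1)[OF z] E_pre_core[OF z] by blast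

lemma E_F: "z \<in> W \<Longrightarrow> E z \<inter> F z = {0}"
  using E_core core_subset F_C subspace_0[OF subspace_F]
    rangeI[of "blinfun_apply (QE_lim z)" 0, folded E_def] by (simp add: blinfun.zero_right) blast

lemma E_dim:
  assumes z: "z \<in> W" shows "has_dim (E z) (k z)"
proof (rule has_dim_complement[OF F_codim[OF z] _ E_F[OF z]])
  show "subspace (E z)" unfolding E_def
    by (intro linear_subspace_image bounded_linear.linear blinfun.bounded_linear_right subspace_UNIV)
  show "\<exists>e\<in>E z. x - e \<in> F z" for x unfolding E_def using QE_lim_F[OF z] by blast
qed

lemma splitting: "z \<in> W \<Longrightarrow> splitting_with (k z) (E z) (F z) (QE_lim z) (id_blinfun - QE_lim z)"
  unfolding splitting_with_def using E_dim F_codim E_F QE_lim_F by (auto simp: E_def blinfun.diff_left)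

text \<open>\<open>A\<close> intertwines \<open>QE n z\<close> with
  \<open>QE (Suc n) (\<theta> z)\<close>; the shift of the index disappears in the limit.\<close>

lemma A_QE_lim:
  assumes z: "z \<in> W" shows "A z (QE_lim z x) = QE_lim (\<theta> z) (A z x)"
proof -
  have W': "\<theta> z \<in> W" using theta_W z .
  have "QE (Suc n) (\<theta> z) (A z x) = A z (QE n z x)" for n
  proof (rule QE(4)[OF W'])
    show "A z (QE n z x) \<in> E_pre (Suc (Suc n)) (\<theta> z)" using A_E_pre[OF z] QE(1)[OF z] by blast
    show "A z x - A z (QE n z x) \<in> F (\<theta> z)"
      using F_inv[OF z QE(2)[OF z]] by (simp add: blinfun.diff_right)
  qed
  moreover have "(\<lambda>n. A z (QE n z x)) \<longlonglongrightarrow> A z (QE_lim z x)"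
    by (intro tendsto_intros QE_tendsto_apply[OF z])
  ultimately show ?thesis
    using LIMSEQ_Suc[OF QE_tendsto_apply[OF W', of "A z x"]] LIMSEQ_unique by simp
qed

lemma A_E:
  assumes z: "z \<in> W" shows "A z ` E z = E (\<theta> z)"
proof (rule has_dim_subset_eq)
  show "has_dim (A z ` E z) (k z)"
    using has_dim_image[OF linear_T[of 1] inj_on_T[OF z, of 1] E_dim[OF z]] by simp
  show "has_dim (E (\<theta> z)) (k z)" using E_dim[OF theta_W[OF z]] k_inv[OF z] by simp
  show "A z ` E z \<subseteq> E (\<theta> z)" unfolding E_def using A_QE_lim[OF z] by auto
qed

lemma E_F_domination:
  assumes "z \<in> W" "v \<in> E z" "w \<in> F z"
  shows "norm (T n z w) * norm v \<le> dom_const n z * norm w * norm (T n z v)"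
  using domination[OF assms(1) _ F_avoids[OF assms(1,3)]] E_core assms by blast

end

section \<open>Birkhoff's ergodic theorem\<close>

text \<open>The maximum of the first \<open>n + 1\<close> nonempty Birkhoff sums of \<open>f\<close> at \<open>x\<close>.\<close>

primrec max_birkhoff_sum :: "('w \<Rightarrow> 'w) \<Rightarrow> ('w \<Rightarrow> real) \<Rightarrow> nat \<Rightarrow> 'w \<Rightarrow> real" where
  "max_birkhoff_sum T f 0 x = f x"
| "max_birkhoff_sum T f (Suc n) x = f x + max 0 (max_birkhoff_sum T f n (T x))"

lemma birkhoff_sum_le_max: "(\<Sum>i<Suc n. f ((T ^^ i) x)) \<le> max_birkhoff_sum T f n x"
proof (induction n arbitrary: x)
  case (Suc n)
  have "(\<Sum>i<Suc (Suc n). f ((T ^^ i) x)) = f x + (\<Sum>i<Suc n. f ((T ^^ i) (T x)))"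
    by (subst sum.lessThan_Suc_shift) (simp add: funpow_swap1)
  also have "\<dots> \<le> f x + max_birkhoff_sum T f n (T x)" using Suc.IH by simp
  also have "\<dots> \<le> max_birkhoff_sum T f (Suc n) x" by simp
  finally show ?case .
qed simp

lemma max_birkhoff_sum_mono: "max_birkhoff_sum T f n x \<le> max_birkhoff_sum T f (Suc n) x"
proof (induction n arbitrary: x)
  case (Suc n)
  show ?case using Suc[of "T x"] by (simp del: max_birkhoff_sum.simps(2) add: max_birkhoff_sum.simps(2)[of T f _ x])
qed simp

lemma max_birkhoff_sum_ge: "f x \<le> max_birkhoff_sum T f n x"
  by (cases n) auto

text \<open>Only the sigma-algebra matters, the measure on it being zero. Invariance is strict
  rather than modulo null sets, so that functions measurable for it are invariant at every point of
  the space.\<close>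

definition invariant_sets :: "'w measure \<Rightarrow> ('w \<Rightarrow> 'w) \<Rightarrow> 'w measure" where
  "invariant_sets M T = measure_of (space M) {S \<in> sets M. T -` S \<inter> space M = S} (\<lambda>_. 0)"

lemma sets_invariant_sets:
  assumes T: "T \<in> measurable M M"
  shows "sets (invariant_sets M T) = {S \<in> sets M. T -` S \<inter> space M = S}"
proof -
  have "sigma_algebra (space M) {S \<in> sets M. T -` S \<inter> space M = S}"
    unfolding sigma_algebra_iff2
  proof (intro conjI ballI allI impI)
    show "{S \<in> sets M. T -` S \<inter> space M = S} \<subseteq> Pow (space M)" using sets.sets_into_space by auto
    show "{} \<in> {S \<in> sets M. T -` S \<inter> space M = S}" by simp
    fix S assume "S \<in> {S \<in> sets M. T -` S \<inter> space M = S}"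
    then show "space M - S \<in> {S \<in> sets M. T -` S \<inter> space M = S}"
      using measurable_space[OF T] by auto
  next
    fix S :: "nat \<Rightarrow> 'a set" assume "range S \<subseteq> {S \<in> sets M. T -` S \<inter> space M = S}"
    then have S: "S i \<in> sets M" "T -` S i \<inter> space M = S i" for i by auto
    have "T -` (\<Union>i. S i) \<inter> space M = (\<Union>i. T -` S i \<inter> space M)" by auto
    then show "(\<Union>i. S i) \<in> {S \<in> sets M. T -` S \<inter> space M = S}" using S by simp
  qed
  then show ?thesis unfolding invariant_sets_def by (rule sigma_algebra.sets_measure_of_eq)
qed

lemma space_invariant_sets: "space (invariant_sets M T) = space M"
  unfolding invariant_sets_def by (rule space_measure_of) (auto dest: sets.sets_into_space)

lemma subalgebra_invariant_sets: "T \<in> measurable M M \<Longrightarrow> subalgebra M (invariant_sets M T)"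
  unfolding subalgebra_def by (auto simp: space_invariant_sets sets_invariant_sets)

lemma invariant_sets_measurable_imp_invariant:
  fixes h :: "'w \<Rightarrow> real"
  assumes T: "T \<in> measurable M M" and h: "h \<in> borel_measurable (invariant_sets M T)" and x: "x \<in> space M"
  shows "h (T x) = h x"
proof -
  have "h -` {h x} \<inter> space M \<in> sets (invariant_sets M T)"
    using measurable_sets[OF h, of "{h x}"] by (simp add: space_invariant_sets)
  then have "T -` (h -` {h x} \<inter> space M) \<inter> space M = h -` {h x} \<inter> space M"
    unfolding sets_invariant_sets[OF T] by simp
  moreover have "x \<in> h -` {h x} \<inter> space M" using x by simp
  ultimately have "x \<in> T -` (h -` {h x} \<inter> space M)" by blast
  then show ?thesis by simp
qed

text \<open>By the recursion, \<open>?F (Suc n) x - ?F n (T x) = f x - min 0 (?F n (T x))\<close>.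
  Over the invariant set \<open>S\<close> the left side has nonnegative integral, because
  \<open>T\<close> preserves the measure and \<open>?F\<close> grows with \<open>n\<close>; on
  \<open>S\<close> the minimum is eventually 0.\<close>

lemma maximal_ergodic:
  fixes f :: "'w \<Rightarrow> real"
  assumes T: "T \<in> measurable M M" and pres: "distr M M T = M" and f: "integrable M f"
    and S: "S \<in> sets M" and inv: "T -` S \<inter> space M = S"
    and unbdd: "\<And>x. x \<in> S \<Longrightarrow> \<exists>n. max_birkhoff_sum T f n x > 0"
  shows "0 \<le> (\<integral>x. indicator S x * f x \<partial>M)"
proof -
  note [measurable] = T S borel_measurable_integrable[OF f]
  have compT: "integrable M (\<lambda>x. g (T x))" if "integrable M g" for g :: "'w \<Rightarrow> real"
    using integrable_distr[OF T] that pres by metis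
  have intT: "(\<integral>x. g (T x) \<partial>M) = (\<integral>x. g x \<partial>M)" if "integrable M g" for g :: "'w \<Rightarrow> real"
    using integral_distr[OF T, of g] pres borel_measurable_integrable[OF that] by simp
  let ?F = "max_birkhoff_sum T f"
  have F: "integrable M (?F n)" for n
  proof (induction n)
    case 0
    then show ?case using f by (simp cong: integrable_cong)
  next
    case (Suc n)
    then show ?case using f compT[OF Suc] by (simp cong: integrable_cong)
  qed
  note FT = compT[OF F]
  have indT: "indicator S (T x) = (indicator S x :: real)" if "x \<in> space M" for x
    using inv that by (auto simp: indicator_def)
  have mulS: "integrable M (\<lambda>x. indicator S x * g x)" if "integrable M g" for g :: "'w \<Rightarrow> real"
    using integrable_mult_indicator[OF S that] by simp
  define s where "s n x = indicator S x * (f x - min 0 (?F n (T x)))" for n x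
  have pos: "0 \<le> (\<integral>x. s n x \<partial>M)" for n
  proof -
    have "(\<integral>x. indicator S x * ?F n (T x) \<partial>M) = (\<integral>x. indicator S (T x) * ?F n (T x) \<partial>M)"
      by (intro Bochner_Integration.integral_cong) (auto simp: indT)
    also have "\<dots> = (\<integral>x. indicator S x * ?F n x \<partial>M)" using intT[OF mulS[OF F]] .
    finally have eq: "(\<integral>x. indicator S x * ?F n (T x) \<partial>M) = (\<integral>x. indicator S x * ?F n x \<partial>M)" .
    have "s n x = indicator S x * ?F (Suc n) x - indicator S x * ?F n (T x)" for x
      unfolding s_def by (auto simp: indicator_def)
    then have "(\<integral>x. s n x \<partial>M) = (\<integral>x. indicator S x * ?F (Suc n) x \<partial>M) - (\<integral>x. indicator S x * ?F n (T x) \<partial>M)"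
      using Bochner_Integration.integral_diff[OF mulS[OF F[of "Suc n"]] mulS[OF FT[of n]]] by presburger
    moreover have "(\<integral>x. indicator S x * ?F n x \<partial>M) \<le> (\<integral>x. indicator S x * ?F (Suc n) x \<partial>M)"
      by (intro integral_mono mulS F mult_left_mono max_birkhoff_sum_mono) auto
    ultimately show ?thesis using eq by linarith
  qed
  have "(\<lambda>n. \<integral>x. s n x \<partial>M) \<longlonglongrightarrow> (\<integral>x. indicator S x * f x \<partial>M)"
  \<comment> \<open>\<open>?F n (T x)\<close> is at least its first sum \<open>f (T x)\<close>, so
    the minimum is bounded uniformly in \<open>n\<close> by the absolute value of
    \<open>f (T x)\<close>.\<close>
  proof (rule integral_dominated_convergence[where w = "\<lambda>x. \<bar>f x\<bar> + \<bar>f (T x)\<bar>"])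
    show "(\<lambda>x. indicator S x * f x) \<in> borel_measurable M" by measurable
    show "s n \<in> borel_measurable M" for n
      unfolding s_def using borel_measurable_integrable[OF FT[of n]] by measurable
    show "integrable M (\<lambda>x. \<bar>f x\<bar> + \<bar>f (T x)\<bar>)" using f compT[OF f] by simp
    show "AE x in M. (\<lambda>n. s n x) \<longlonglongrightarrow> indicator S x * f x"
    proof (rule AE_I2)
      fix x assume x: "x \<in> space M"
      show "(\<lambda>n. s n x) \<longlonglongrightarrow> indicator S x * f x"
      proof (cases "x \<in> S")
        case True
        then have "T x \<in> S" using inv by blast
        then obtain N where N: "?F N (T x) > 0" using unbdd by blast
        have "?F n (T x) > 0" if "n \<ge> N" for n
          using N lift_Suc_mono_le[of "\<lambda>n. ?F n (T x)", OF max_birkhoff_sum_mono that] by linarith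
        then have "\<forall>\<^sub>F n in sequentially. s n x = indicator S x * f x"
          unfolding eventually_sequentially s_def using True by (intro exI[of _ N]) auto
        then show ?thesis by (rule tendsto_eventually)
      qed (simp add: s_def)
    qed
    show "AE x in M. norm (s n x) \<le> \<bar>f x\<bar> + \<bar>f (T x)\<bar>" for n
    proof (rule AE_I2)
      fix x
      show "norm (s n x) \<le> \<bar>f x\<bar> + \<bar>f (T x)\<bar>"
        using max_birkhoff_sum_ge[of f "T x" T n] by (auto simp: s_def indicator_def)
    qed
  qed
  then show ?thesis using pos LIMSEQ_le_const by blast
qed

text \<open>Let \<open>f = g - h - \<epsilon>\<close> and let \<open>S\<close> be the set where its
  sums are unbounded above. On invariant sets \<open>g\<close> and \<open>h\<close> have equal
  integrals, so \<open>f\<close> integrates over \<open>S\<close> to minus \<epsilon> times the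
  measure of \<open>S\<close>, while the maximal inequality makes this nonnegative; so
  \<open>S\<close> is null, and off \<open>S\<close> the supremum of the sums is the constant
  \<open>B\<close>.\<close>

lemma (in prob_space) birkhoff_upper:
  fixes g :: "'a \<Rightarrow> real"
  assumes T: "T \<in> measurable M M" and pres: "distr M M T = M" and g: "integrable M g"
    and sub: "subalgebra M Inv" and Inv: "\<And>S. S \<in> sets M \<Longrightarrow> T -` S \<inter> space M = S \<Longrightarrow> S \<in> sets Inv"
    and h: "\<And>x. x \<in> space M \<Longrightarrow> real_cond_exp M Inv g (T x) = real_cond_exp M Inv g x"
    and \<epsilon>: "\<epsilon> > 0"
  shows "AE x in M. \<exists>B. \<forall>n. (\<Sum>i<n. g ((T ^^ i) x)) \<le> real n * (real_cond_exp M Inv g x + \<epsilon>) + B"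
proof -
  interpret sub: finite_measure_subalgebra M Inv by unfold_locales fact
  define h where "h = real_cond_exp M Inv g"
  have hint: "integrable M h" unfolding h_def using sub.real_cond_exp_int(1)[OF g] .
  define f where "f x = g x - h x - \<epsilon>" for x
  have f: "integrable M f" unfolding f_def using g hint by simp
  let ?F = "max_birkhoff_sum T f"
  note [measurable] = T borel_measurable_integrable[OF f]
  have [measurable]: "?F n \<in> borel_measurable M" for n by (induction n) simp_all
  define S where "S = {x \<in> space M. \<forall>B::nat. \<exists>n. ?F n x > real B}"
  have S: "S \<in> sets M" unfolding S_def by measurable
  \<comment> \<open>Unboundedness, unlike positivity of some sum, is unaffected by dropping the
    first summand; this is what makes \<open>S\<close> strictly invariant.\<close>
  have unb: "(\<forall>B::nat. \<exists>n. ?F n x > real B) \<longleftrightarrow>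
     (\<forall>B::nat. \<exists>n. ?F n (T x) > real B)" for x
  proof
    assume L: "\<forall>B::nat. \<exists>n. ?F n x > real B"
    show "\<forall>B::nat. \<exists>n. ?F n (T x) > real B"
    proof
      fix B :: nat
      obtain B' :: nat where B': "real B + \<bar>f x\<bar> \<le> real B'" using real_arch_simple by blast
      obtain n where n: "?F n x > real B'" using L by blast
      have "n \<noteq> 0" using n B' by (intro notI) simp
      then obtain m where m: "n = Suc m" using not0_implies_Suc by blast
      then have "?F m (T x) > real B" using n B' by auto
      then show "\<exists>n. ?F n (T x) > real B" by blast
    qed
  next
    assume R: "\<forall>B::nat. \<exists>n. ?F n (T x) > real B"
    show "\<forall>B::nat. \<exists>n. ?F n x > real B"
    proof
      fix B :: nat
      obtain B' :: nat where B': "real B + \<bar>f x\<bar> \<le> real B'" using real_arch_simple by blast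
      obtain n where n: "?F n (T x) > real B'" using R by blast
      then have "?F (Suc n) x > real B" using B' by auto
      then show "\<exists>n. ?F n x > real B" by blast
    qed
  qed
  have inv: "T -` S \<inter> space M = S"
    unfolding S_def using unb measurable_space[OF T] by auto
  have "\<exists>n. ?F n x > 0" if "x \<in> S" for x
  proof -
    have "\<exists>n. ?F n x > real 0" using that unfolding S_def by blast
    then show ?thesis by simp
  qed
  then have pos: "0 \<le> (\<integral>x. indicator S x * f x \<partial>M)" by (rule maximal_ergodic[OF T pres f S inv])
  have mulS: "integrable M (\<lambda>x. indicator S x * u x)" if "integrable M u" for u :: "'a \<Rightarrow> real"
    using integrable_mult_indicator[OF S that] by simp
  have "(\<integral>x. indicator S x * g x \<partial>M) = (\<integral>x. indicator S x * h x \<partial>M)"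
    using sub.real_cond_exp_intA[OF g Inv[OF S inv]] unfolding set_lebesgue_integral_def h_def by simp
  moreover have "(\<lambda>x. indicator S x * f x) =
      (\<lambda>x. (indicator S x * g x - indicator S x * h x) - indicator S x * \<epsilon>)"
    by (auto simp: f_def indicator_def)
  moreover have "(\<integral>x. (indicator S x * g x - indicator S x * h x) - indicator S x * \<epsilon> \<partial>M) =
      (\<integral>x. indicator S x * g x \<partial>M) - (\<integral>x. indicator S x * h x \<partial>M) - measure M S * \<epsilon>"
    using mulS[OF g] mulS[OF hint] mulS[OF integrable_const] S
    by (simp add: Bochner_Integration.integral_diff)
  ultimately have "(\<integral>x. indicator S x * f x \<partial>M) = - (measure M S * \<epsilon>)" by simp
  then have "measure M S * \<epsilon> \<le> 0" using pos by simp
  then have "measure M S = 0" using \<epsilon> measure_nonneg[of M S] by (simp add: mult_le_0_iff)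
  then have "AE x in M. x \<notin> S"
    using S by (intro AE_not_in) (simp add: null_setsI emeasure_eq_measure)
  from this AE_space show ?thesis
  proof eventually_elim
    case (elim x)
    then obtain B :: nat where B: "\<And>n. ?F n x \<le> real B"
      unfolding S_def by (auto simp: not_less)
    have Tx: "(T ^^ i) x \<in> space M \<and> h ((T ^^ i) x) = h x" for i
      using elim assms(6) measurable_space[OF T] unfolding h_def by (induction i) auto
    have "(\<Sum>i<n. g ((T ^^ i) x)) \<le> real n * (h x + \<epsilon>) + real B" for n
    proof -
      have "(\<Sum>i<n. f ((T ^^ i) x)) \<le> real B"
      proof (cases n)
        case (Suc m)
        show ?thesis unfolding Suc using order_trans[OF birkhoff_sum_le_max B] .
      qed simp
      moreover have "(\<Sum>i<n. f ((T ^^ i) x)) = (\<Sum>i<n. g ((T ^^ i) x)) - real n * (h x + \<epsilon>)"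
        unfolding f_def using Tx by (simp add: sum_subtractf algebra_simps)
      ultimately show ?thesis by simp
    qed
    then show ?case unfolding h_def by blast
  qed
qed

text \<open>The upper estimate for \<open>g\<close> and for \<open>-g\<close>, along a sequence of
  \<epsilon>. The form \<open>real n * \<epsilon> + B\<close> of the error is the one in which
  temperedness will also be expressed, so that the two can be added.\<close>

lemma (in prob_space) birkhoff:
  fixes g :: "'a \<Rightarrow> real"
  assumes T: "T \<in> measurable M M" and pres: "distr M M T = M" and g: "integrable M g"
    and sub: "subalgebra M Inv" and Inv: "\<And>S. S \<in> sets M \<Longrightarrow> T -` S \<inter> space M = S \<Longrightarrow> S \<in> sets Inv"
    and h: "\<And>f x. f \<in> borel_measurable Inv \<Longrightarrow> x \<in> space M \<Longrightarrow> f (T x) = (f x :: real)"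
  shows "AE x in M. \<forall>\<epsilon>>0. \<exists>B. \<forall>n. \<bar>(\<Sum>i<n. g ((T ^^ i) x)) - real n * real_cond_exp M Inv g x\<bar> \<le> real n * \<epsilon> + B"
proof -
  interpret sub: finite_measure_subalgebra M Inv by unfold_locales fact
  have inv: "real_cond_exp M Inv f (T x) = real_cond_exp M Inv f x" if "x \<in> space M" for f x
    using h[OF borel_measurable_cond_exp that] .
  define e where "e m = inverse (real (Suc m))" for m
  have e: "e m > 0" for m unfolding e_def by simp
  have neg: "AE x in M. real_cond_exp M Inv (\<lambda>x. (-1) * g x) x = (-1) * real_cond_exp M Inv g x"
    using sub.real_cond_exp_cmult[OF g] .
  have up: "AE x in M. \<forall>m. \<exists>B. \<forall>n. (\<Sum>i<n. g ((T ^^ i) x)) \<le> real n * (real_cond_exp M Inv g x + e m) + B"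
    using birkhoff_upper[OF T pres g sub Inv inv e] by (simp add: AE_all_countable)
  have gneg: "integrable M (\<lambda>x. (-1) * g x)" using g by simp
  have down: "AE x in M. \<forall>m. \<exists>B. \<forall>n. (\<Sum>i<n. (-1) * g ((T ^^ i) x)) \<le>
      real n * (real_cond_exp M Inv (\<lambda>x. (-1) * g x) x + e m) + B"
    unfolding AE_all_countable using birkhoff_upper[OF T pres gneg sub Inv inv e] by blast
  from neg up down show ?thesis
  proof eventually_elim
    case (elim x)
    let ?h = "real_cond_exp M Inv g x"
    show ?case
    proof (intro allI impI)
      fix \<epsilon> :: real assume "\<epsilon> > 0"
      then obtain m where "e m < \<epsilon>" unfolding e_def using reals_Archimedean by blast
      obtain B1 where B1: "\<And>n. (\<Sum>i<n. g ((T ^^ i) x)) \<le> real n * (?h + e m) + B1"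
        using elim(2) by blast
      obtain B2 where B2: "\<And>n. (\<Sum>i<n. (-1) * g ((T ^^ i) x)) \<le> real n * ((-1) * ?h + e m) + B2"
        using elim(3) unfolding elim(1) by blast
      have "\<bar>(\<Sum>i<n. g ((T ^^ i) x)) - real n * ?h\<bar> \<le> real n * \<epsilon> + max B1 B2" for n
      proof -
        have "real n * e m \<le> real n * \<epsilon>" using \<open>e m < \<epsilon>\<close> by (intro mult_left_mono) auto
        moreover have "- (\<Sum>i<n. g ((T ^^ i) x)) \<le> real n * ((-1) * ?h + e m) + B2"
          using B2[of n] by (simp add: sum_negf)
        ultimately show ?thesis using B1[of n] by (simp add: algebra_simps abs_le_iff max_def)
      qed
      then show "\<exists>B. \<forall>n. \<bar>(\<Sum>i<n. g ((T ^^ i) x)) - real n * ?h\<bar> \<le> real n * \<epsilon> + B" by blast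
    qed
  qed
qed

section \<open>Tempered functions and orbit sums\<close>

text \<open>Replaces the two limits by one inequality over all integers, which can be evaluated at
  shifted arguments and added; \<open>B\<close> absorbs the finite window where the limits say
  nothing.\<close>

lemma int_sequence_sublinear_iff:
  fixes a :: "int \<Rightarrow> real"
  shows "((\<lambda>n. a n / of_int n) \<longlongrightarrow> 0) at_top \<and> ((\<lambda>n. a n / of_int n) \<longlongrightarrow> 0) at_bot \<longleftrightarrow>
    (\<forall>\<epsilon>>0. \<exists>B. \<forall>j. \<bar>a j\<bar> \<le> \<epsilon> * \<bar>of_int j\<bar> + B)"
proof (intro iffI allI impI conjI)
  fix \<epsilon> :: real assume L: "((\<lambda>n. a n / of_int n) \<longlongrightarrow> 0) at_top \<and> ((\<lambda>n. a n / of_int n) \<longlongrightarrow> 0) at_bot"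
    and \<epsilon>: "\<epsilon> > 0"
  have "\<forall>\<^sub>F n in at_top. \<bar>a n / of_int n\<bar> < \<epsilon>" "\<forall>\<^sub>F n in at_bot. \<bar>a n / of_int n\<bar> < \<epsilon>"
    using tendstoD[OF conjunct1[OF L] \<epsilon>] tendstoD[OF conjunct2[OF L] \<epsilon>] by auto
  then obtain N1 N2 :: int where N: "\<And>n. n \<ge> N1 \<Longrightarrow> \<bar>a n / of_int n\<bar> < \<epsilon>" "\<And>n. n \<le> N2 \<Longrightarrow> \<bar>a n / of_int n\<bar> < \<epsilon>"
    unfolding eventually_at_top_linorder eventually_at_bot_linorder by blast
  \<comment> \<open>The index 0 is inserted because division by 0 returns 0, so the quotient at
    \<open>j = 0\<close> does not control \<open>a 0\<close>.\<close>
  define B where "B = (\<Sum>j\<in>insert 0 {N2..N1}. \<bar>a j\<bar>)"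
  have "\<bar>a j\<bar> \<le> \<epsilon> * \<bar>of_int j\<bar> + B" for j
  proof (cases "j \<in> insert 0 {N2..N1}")
    case True
    then have "\<bar>a j\<bar> \<le> B" unfolding B_def by (intro member_le_sum) auto
    then show ?thesis using \<epsilon> by (simp add: add_increasing)
  next
    case False
    then have "\<bar>a j / of_int j\<bar> < \<epsilon>" "j \<noteq> 0" using N by force+
    then have "\<bar>a j\<bar> \<le> \<epsilon> * \<bar>of_int j\<bar>" by (simp add: abs_divide field_simps)
    moreover have "B \<ge> 0" unfolding B_def by (intro sum_nonneg) auto
    ultimately show ?thesis by linarith
  qed
  then show "\<exists>B. \<forall>j. \<bar>a j\<bar> \<le> \<epsilon> * \<bar>of_int j\<bar> + B" by blast
next
  assume R: "\<forall>\<epsilon>>0. \<exists>B. \<forall>j. \<bar>a j\<bar> \<le> \<epsilon> * \<bar>of_int j\<bar> + B"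
  have key: "\<exists>N::int. N > 0 \<and> (\<forall>n. \<bar>n\<bar> \<ge> N \<longrightarrow> \<bar>a n / of_int n\<bar> < e)" if e: "e > 0" for e
  proof -
    obtain B where B: "\<And>j. \<bar>a j\<bar> \<le> e / 2 * \<bar>of_int j\<bar> + B" using R e half_gt_zero by blast
    obtain N :: nat where N: "2 * \<bar>B\<bar> / e + 1 < real N" using reals_Archimedean2 by blast
    have "0 \<le> 2 * \<bar>B\<bar> / e" using e by simp
    then have Np: "N > 0" using N by linarith
    have "\<bar>a n / of_int n\<bar> < e" if n: "\<bar>n\<bar> \<ge> int N" for n
    proof -
      have n': "real N \<le> \<bar>of_int n\<bar>" using n by (metis of_int_abs of_int_le_iff of_int_of_nat_eq)
      have "2 * \<bar>B\<bar> / e < \<bar>of_int n\<bar>" using N n' by linarith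
      then have "2 * \<bar>B\<bar> < e * \<bar>of_int n\<bar>" using e by (simp add: field_simps)
      then have "\<bar>a n\<bar> < e * \<bar>of_int n\<bar>" using B[of n] by linarith
      moreover have "n \<noteq> 0" using n Np by auto
      ultimately show ?thesis by (simp add: abs_divide field_simps)
    qed
    then show ?thesis using Np by (intro exI[of _ "int N"]) auto
  qed
  show "((\<lambda>n. a n / of_int n) \<longlongrightarrow> 0) at_top"
  proof (rule tendstoI)
    fix e :: real assume "e > 0"
    then obtain N :: int where N: "N > 0" "\<And>n. \<bar>n\<bar> \<ge> N \<Longrightarrow> \<bar>a n / of_int n\<bar> < e" using key by blast
    then show "\<forall>\<^sub>F x in at_top. dist (a x / of_int x) 0 < e"
      unfolding eventually_at_top_linorder by (intro exI[of _ N]) (auto simp: dist_real_def simp del: abs_divide)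
  qed
  show "((\<lambda>n. a n / of_int n) \<longlongrightarrow> 0) at_bot"
  proof (rule tendstoI)
    fix e :: real assume "e > 0"
    then obtain N :: int where N: "N > 0" "\<And>n. \<bar>n\<bar> \<ge> N \<Longrightarrow> \<bar>a n / of_int n\<bar> < e" using key by blast
    then show "\<forall>\<^sub>F x in at_bot. dist (a x / of_int x) 0 < e"
      unfolding eventually_at_bot_linorder by (intro exI[of _ "-N"]) (auto simp: dist_real_def simp del: abs_divide)
  qed
qed

lemma subexponential_along_iff:
  "subexponential_along M \<theta> f z \<longleftrightarrow>
    (\<forall>\<epsilon>>0. \<exists>B. \<forall>j. \<bar>ln (f (theta_iter M \<theta> j z))\<bar> \<le> \<epsilon> * \<bar>real_of_int j\<bar> + B)"
  unfolding subexponential_along_def by (rule int_sequence_sublinear_iff)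

lemma theta_iter_of_nat: "theta_iter M \<theta> (int n) z = (\<theta> ^^ n) z"
  unfolding theta_iter_def by simp

lemma theta_iter_neg: "theta_iter M \<theta> (- int n) z = (inv_into (space M) \<theta> ^^ n) z"
  by (cases "n = 0") (auto simp: theta_iter_def)

section \<open>Two-sided orbits and invariant sets of full measure\<close>

context linear_rds
begin

abbreviation "\<psi> \<equiv> inv_into (space M) \<theta>"
abbreviation "orb \<equiv> theta_iter M \<theta>"

sublocale dyn: invertible_dynamics "space M" \<theta> \<psi>
proof
  fix z assume z: "z \<in> space M"
  have im: "\<theta> ` space M = space M" and inj: "inj_on \<theta> (space M)" using theta_bij unfolding bij_betw_def by auto
  show "\<theta> z \<in> space M" using im z by blast
  show "\<psi> z \<in> space M" using inv_into_into[of z \<theta> "space M"] im z by simp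
  show "\<theta> (\<psi> z) = z" using f_inv_into_f[of z \<theta> "space M"] im z by simp
  show "\<psi> (\<theta> z) = z" using inv_into_f_f[OF inj z] .
qed

lemma theta_iter_Suc:
  assumes z: "z \<in> space M"
  shows "orb (j + 1) z = \<theta> (orb j z)"
proof (cases "j \<ge> 0")
  case True
  then have "nat (j + 1) = Suc (nat j)" by simp
  then show ?thesis using True by (simp add: theta_iter_def)
next
  case False
  then obtain n where n: "j = - int (Suc n)" by (metis add.inverse_inverse int_cases not_le negD)
  then have "j + 1 = - int n" by simp
  then show ?thesis unfolding n by (simp only: theta_iter_neg) (simp add: dyn.theta_psi dyn.psi_pow_W[OF z])
qed

lemma theta_iter_space: "z \<in> space M \<Longrightarrow> orb j z \<in> space M"
  unfolding theta_iter_def by (auto simp: dyn.theta_pow_W dyn.psi_pow_W)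

lemma theta_iter_pred:
  assumes z: "z \<in> space M"
  shows "orb (j - 1) z = \<psi> (orb j z)"
  using theta_iter_Suc[OF z, of "j - 1"] dyn.psi_theta[OF theta_iter_space[OF z]] by simp

lemma theta_iter_add_nat:
  assumes z: "z \<in> space M"
  shows "orb (j + int n) z = (\<theta> ^^ n) (orb j z)"
proof (induction n)
  case (Suc n)
  have "j + int (Suc n) = (j + int n) + 1" by simp
  then show ?case using theta_iter_Suc[OF z, of "j + int n"] Suc by (metis comp_apply funpow.simps(2))
qed simp

lemma theta_iter_diff_nat:
  assumes z: "z \<in> space M"
  shows "orb (j - int n) z = (\<psi> ^^ n) (orb j z)"
proof (induction n)
  case (Suc n)
  have "j - int (Suc n) = (j - int n) - 1" by simp
  then show ?case using theta_iter_pred[OF z, of "j - int n"] Suc by (metis comp_apply funpow.simps(2))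
qed simp

lemma theta_iter_add:
  assumes z: "z \<in> space M"
  shows "orb i (orb j z) = orb (i + j) z"
proof (cases "i \<ge> 0")
  case True
  then show ?thesis using theta_iter_add_nat[OF z, of j "nat i"]
    by (simp add: theta_iter_def[of M \<theta> i] add.commute)
next
  case False
  then show ?thesis using theta_iter_diff_nat[OF z, of j "nat (-i)"]
    by (simp add: theta_iter_def[of M \<theta> i] add.commute)
qed

lemma subexponential_compose:
  assumes z: "z \<in> space M" and f: "subexponential_along M \<theta> f z"
  shows "subexponential_along M \<theta> (\<lambda>z. f (orb m z)) z"
  unfolding subexponential_along_iff
proof (intro allI impI)
  fix \<epsilon> :: real assume \<epsilon>: "\<epsilon> > 0"
  obtain B where B: "\<And>j. \<bar>ln (f (orb j z))\<bar> \<le> \<epsilon> * \<bar>real_of_int j\<bar> + B"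
    using f \<epsilon> unfolding subexponential_along_iff by blast
  have "\<bar>ln (f (orb m (orb j z)))\<bar> \<le> \<epsilon> * \<bar>real_of_int j\<bar> + (\<epsilon> * \<bar>real_of_int m\<bar> + B)" for j
  proof -
    have "\<bar>ln (f (orb m (orb j z)))\<bar> \<le> \<epsilon> * \<bar>real_of_int (m + j)\<bar> + B"
      unfolding theta_iter_add[OF z] by (rule B)
    also have "\<epsilon> * \<bar>real_of_int (m + j)\<bar> \<le> \<epsilon> * (\<bar>real_of_int m\<bar> + \<bar>real_of_int j\<bar>)"
      using \<epsilon> by (intro mult_left_mono) auto
    finally show ?thesis by (simp add: algebra_simps)
  qed
  then show "\<exists>B. \<forall>j. \<bar>ln (f (orb m (orb j z)))\<bar> \<le> \<epsilon> * \<bar>real_of_int j\<bar> + B" by blast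
qed

lemma subexponential_theta:
  "z \<in> space M \<Longrightarrow> subexponential_along M \<theta> f z \<Longrightarrow> subexponential_along M \<theta> (\<lambda>z. f (\<theta> z)) z"
  using subexponential_compose[of z f 1] by (simp add: theta_iter_def)

lemma subexponential_psi:
  "z \<in> space M \<Longrightarrow> subexponential_along M \<theta> f z \<Longrightarrow> subexponential_along M \<theta> (\<lambda>z. f (\<psi> z)) z"
  using subexponential_compose[of z f "-1"] by (simp add: theta_iter_def)

lemma measurable_theta_iter: "orb j \<in> measurable M M"
proof -
  have "\<theta> ^^ n \<in> measurable M M" "\<psi> ^^ n \<in> measurable M M" for n
    by (induction n) (auto intro: measurable_comp theta_measurable theta_inv_measurable)
  moreover have "orb j = (if j \<ge> 0 then \<theta> ^^ nat j else \<psi> ^^ nat (- j))"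
    by (auto simp: theta_iter_def)
  ultimately show ?thesis by simp
qed

lemma AE_theta_iter:
  assumes "AE z in M. P z"
  shows "AE z in M. P (orb j z)"
proof -
  have comp: "AE z in M. P (T z)" if "T \<in> measurable M M" "distr M M T = M" "AE z in M. P z" for T P
    using AE_distrD[OF that(1), of P] that(2,3) by metis
  have "AE z in M. P ((\<theta> ^^ n) z)" for n
  proof (induction n)
    case (Suc n)
    show ?case using comp[OF theta_measurable theta_preserving Suc] by (simp add: funpow_swap1)
  qed (use assms in simp)
  moreover have "AE z in M. P ((\<psi> ^^ n) z)" for n
  proof (induction n)
    case (Suc n)
    show ?case using comp[OF theta_inv_measurable theta_inv_preserving Suc] by (simp add: funpow_swap1)
  qed (use assms in simp)
  ultimately show ?thesis unfolding theta_iter_def by (cases "j \<ge> 0") auto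
qed

text \<open>The exceptional set is enlarged to a measurable null set, and every point whose
  two-sided orbit ever meets it is discarded; this removes countably many null sets and leaves whole
  orbits.\<close>

lemma invariant_full_set:
  assumes "AE z in M. P z"
  obtains W where "W \<in> sets M" "emeasure M W = emeasure M (space M)" "\<theta> ` W = W" "\<psi> ` W = W"
    "\<And>z. z \<in> W \<Longrightarrow> P z"
proof -
  obtain N where N: "{z \<in> space M. \<not> P z} \<subseteq> N" "N \<in> null_sets M" using assms by (auto simp: eventually_ae_filter)
  define W where "W = {z \<in> space M. \<forall>j. orb j z \<notin> N}"
  have Ns: "N \<in> sets M" using N(2) by blast
  have "{z \<in> space M. orb j z \<notin> N} \<in> sets M" for j
  proof -
    have "{z \<in> space M. orb j z \<notin> N} = space M - (orb j -` N \<inter> space M)" by auto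
    then show ?thesis using measurable_sets[OF measurable_theta_iter Ns] by auto
  qed
  moreover have "W = (\<Inter>j. {z \<in> space M. orb j z \<notin> N})" unfolding W_def by auto
  ultimately have W: "W \<in> sets M" by auto
  have "AE z in M. \<forall>j. orb j z \<notin> N"
    unfolding AE_all_countable using AE_theta_iter[OF AE_not_in[OF N(2)]] by blast
  then have "AE z in M. z \<in> W" unfolding W_def by (auto elim: AE_mp)
  then have full: "emeasure M W = emeasure M (space M)"
    using emeasure_eq_1_AE[OF W] emeasure_space_1 by simp
  have Ws: "W \<subseteq> space M" unfolding W_def by blast
  have inv: "orb i z \<in> W" if "z \<in> W" for i z
    using that theta_iter_space theta_iter_add unfolding W_def by auto
  have th: "\<theta> z \<in> W" "\<psi> z \<in> W" if "z \<in> W" for z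
    using inv[OF that, of 1] inv[OF that, of "-1"] by (auto simp: theta_iter_def)
  have "\<theta> ` W = W"
  proof
    show "W \<subseteq> \<theta> ` W" using th(2) dyn.theta_psi Ws by force
  qed (use th(1) in blast)
  moreover have "\<psi> ` W = W"
  proof
    show "W \<subseteq> \<psi> ` W" using th(1) dyn.psi_theta Ws by force
  qed (use th(2) in blast)
  moreover have "P z" if "z \<in> W" for z
  proof -
    have "orb 0 z \<notin> N" "z \<in> space M" using that unfolding W_def by blast+
    then show ?thesis using N(1) by (auto simp: theta_iter_def)
  qed
  ultimately show ?thesis using that[OF W full] by blast
qed

text \<open>The sign for negative \<open>j\<close> makes this an additive cocycle over the integers.\<close>

definition "orbit_sum g z j = (if j \<ge> 0 then (\<Sum>i<nat j. g ((\<theta> ^^ i) z)) else - (\<Sum>i<nat (-j). g ((\<psi> ^^ Suc i) z)))"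

lemma orbit_sum_step:
  assumes z: "z \<in> space M"
  shows "orbit_sum g z (j + 1) = orbit_sum g z j + (g (orb j z) :: real)"
proof (cases "j \<ge> 0")
  case True
  then have "nat (j + 1) = Suc (nat j)" by simp
  then show ?thesis using True by (simp add: orbit_sum_def theta_iter_def)
next
  case False
  then obtain n where n: "j = - int (Suc n)" by (metis add.inverse_inverse int_cases not_le negD)
  then have "j + 1 = - int n" by simp
  moreover have neg: "orbit_sum g z (- int n) = - (\<Sum>i<n. g ((\<psi> ^^ Suc i) z))" for n
    by (cases "n = 0") (auto simp: orbit_sum_def)
  ultimately show ?thesis unfolding n by (simp only: neg theta_iter_neg) simp
qed

lemma orbit_sum_add:
  assumes z: "z \<in> space M"
  shows "orbit_sum g z (j + int n) = orbit_sum g z j + (\<Sum>i<n. g ((\<theta> ^^ i) (orb j z)) :: real)"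
proof (induction n)
  case (Suc n)
  have "j + int (Suc n) = (j + int n) + 1" by simp
  then have "orbit_sum g z (j + int (Suc n)) = orbit_sum g z (j + int n) + g (orb (j + int n) z)"
    using orbit_sum_step[OF z, of g "j + int n"] by metis
  then show ?case using Suc theta_iter_add_nat[OF z, of j n] by simp
qed simp

text \<open>A set is invariant under \<theta> iff it is under \<psi>, so one conditional expectation
  \<open>h\<close> is the average in both directions of time.\<close>

lemma two_sided_birkhoff:
  fixes g :: "'w \<Rightarrow> real"
  assumes g: "integrable M g" and pos: "AE z in M. g z > 0"
  obtains \<delta> where "\<delta> \<in> borel_measurable M" "\<And>z. z \<in> space M \<Longrightarrow> 0 < \<delta> z \<and> \<delta> (\<theta> z) = \<delta> z"
    "AE z in M. \<forall>\<epsilon>>0. \<exists>B. \<forall>j. \<bar>orbit_sum g z j - 2 * of_int j * \<delta> z\<bar> \<le> \<epsilon> * \<bar>real_of_int j\<bar> + B"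
proof -
  define Inv where "Inv = invariant_sets M \<theta>"
  have sub: "subalgebra M Inv" unfolding Inv_def using subalgebra_invariant_sets theta_measurable by blast
  interpret sub: finite_measure_subalgebra M Inv by unfold_locales fact
  define h where "h = real_cond_exp M Inv g"
  have hm: "h \<in> borel_measurable Inv" unfolding h_def by simp
  have inv: "f (\<theta> x) = f x" if "f \<in> borel_measurable Inv" "x \<in> space M" for f :: "'w \<Rightarrow> real" and x
    using invariant_sets_measurable_imp_invariant[OF theta_measurable] that unfolding Inv_def by blast
  have inv': "f (\<psi> x) = f x" if "f \<in> borel_measurable Inv" "x \<in> space M" for f :: "'w \<Rightarrow> real" and x
    using inv[OF that(1) dyn.psi_W[OF that(2)]] dyn.theta_psi[OF that(2)] by simp
  have Inv: "S \<in> sets Inv" if "S \<in> sets M" "\<theta> -` S \<inter> space M = S" for S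
    unfolding Inv_def sets_invariant_sets[OF theta_measurable] using that by simp
  have Inv': "S \<in> sets Inv" if S: "S \<in> sets M" "\<psi> -` S \<inter> space M = S" for S
  proof (rule Inv[OF S(1)])
    have *: "\<psi> x \<in> S \<longleftrightarrow> x \<in> S" if "x \<in> space M" for x using S(2) that by blast
    have "\<theta> x \<in> S \<longleftrightarrow> x \<in> S" if "x \<in> space M" for x
      using *[OF dyn.theta_W[OF that]] dyn.psi_theta[OF that] by simp
    then show "\<theta> -` S \<inter> space M = S" using sets.sets_into_space[OF S(1)] by auto
  qed
  \<comment> \<open>Half of the Birkhoff average; the other half is reserved for tempered errors.
    Where \<open>h\<close> fails to be positive, on a null invariant set, 1 keeps \<delta> positive
    and invariant everywhere.\<close>
  define \<delta> where "\<delta> z = (if h z > 0 then h z / 2 else 1)" for z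
  have [measurable]: "h \<in> borel_measurable M" unfolding h_def by simp
  have "\<delta> \<in> borel_measurable M" unfolding \<delta>_def by measurable
  moreover have "0 < \<delta> z \<and> \<delta> (\<theta> z) = \<delta> z" if "z \<in> space M" for z
    unfolding \<delta>_def using inv[OF hm that] by simp
  moreover have "AE z in M. \<forall>\<epsilon>>0. \<exists>B. \<forall>j. \<bar>orbit_sum g z j - 2 * of_int j * \<delta> z\<bar> \<le> \<epsilon> * \<bar>real_of_int j\<bar> + B"
  proof -
    have hpos: "AE z in M. h z > 0" unfolding h_def using sub.real_cond_exp_gr_c[OF g pos] .
    have fw: "AE x in M. \<forall>\<epsilon>>0. \<exists>B. \<forall>n. \<bar>(\<Sum>i<n. g ((\<theta> ^^ i) x)) - real n * h x\<bar> \<le> real n * \<epsilon> + B"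
      unfolding h_def using birkhoff[OF theta_measurable theta_preserving g sub Inv inv] by blast
    have bw: "AE x in M. \<forall>\<epsilon>>0. \<exists>B. \<forall>n. \<bar>(\<Sum>i<n. g ((\<psi> ^^ i) x)) - real n * h x\<bar> \<le> real n * \<epsilon> + B"
      unfolding h_def using birkhoff[OF theta_inv_measurable theta_inv_preserving g sub Inv' inv'] by blast
    \<comment> \<open>For negative \<open>j\<close> the orbit sum starts at \<open>\<psi> z\<close>
      rather than at \<open>z\<close>, so the backward estimate is taken at the preceding
      point.\<close>
    from hpos fw bw AE_theta_iter[OF bw, of "-1"] AE_space show ?thesis
    proof eventually_elim
      case (elim z)
      have d: "2 * \<delta> z = h z" unfolding \<delta>_def using elim(1) by simp
      have hpsi: "h (\<psi> z) = h z" using inv'[OF hm elim(5)] .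
      show ?case
      proof (intro allI impI)
        fix \<epsilon> :: real assume \<epsilon>: "\<epsilon> > 0"
        obtain B1 where B1: "\<And>n. \<bar>(\<Sum>i<n. g ((\<theta> ^^ i) z)) - real n * h z\<bar> \<le> real n * \<epsilon> + B1"
          using elim(2) \<epsilon> by blast
        have "\<forall>\<epsilon>>0. \<exists>B. \<forall>n. \<bar>(\<Sum>i<n. g ((\<psi> ^^ Suc i) z)) - real n * h z\<bar> \<le> real n * \<epsilon> + B"
          using elim(4) by (simp add: theta_iter_def funpow_swap1 hpsi)
        then obtain B2 where B2: "\<And>n. \<bar>(\<Sum>i<n. g ((\<psi> ^^ Suc i) z)) - real n * h z\<bar> \<le> real n * \<epsilon> + B2"
          using \<epsilon> by blast
        have "\<bar>orbit_sum g z j - 2 * of_int j * \<delta> z\<bar> \<le> \<epsilon> * \<bar>real_of_int j\<bar> + max B1 B2" for j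
        proof (cases "j \<ge> 0")
          case True
          then have "real (nat j) = real_of_int j" by simp
          then show ?thesis using B1[of "nat j"] True d
            by (simp add: orbit_sum_def mult.commute mult.left_commute)
        next
          case False
          then have r: "real (nat (-j)) = - real_of_int j" by simp
          have "orbit_sum g z j - 2 * of_int j * \<delta> z = - ((\<Sum>i<nat (-j). g ((\<psi> ^^ Suc i) z)) - real (nat (-j)) * h z)"
            using False unfolding orbit_sum_def r d[symmetric] by simp
          then have "\<bar>orbit_sum g z j - 2 * of_int j * \<delta> z\<bar> \<le> real (nat (-j)) * \<epsilon> + B2"
            using B2[of "nat (-j)"] by (metis abs_minus_cancel)
          then show ?thesis using False r by (simp add: mult.commute)
        qed
        then show "\<exists>B. \<forall>j. \<bar>orbit_sum g z j - 2 * of_int j * \<delta> z\<bar> \<le> \<epsilon> * \<bar>real_of_int j\<bar> + B" by blast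
      qed
    qed
  qed
  ultimately show ?thesis using that by blast
qed

end

section \<open>Measurability of solutions and projections\<close>

text \<open>For a simple function in place of \<open>x\<close> this is a countable case distinction;
  continuity of each \<open>B z\<close> then gives the limit.\<close>

lemma strongly_measurable_apply:
  fixes B :: "'w \<Rightarrow> 'x::{banach, second_countable_topology} \<Rightarrow>\<^sub>L 'x"
  assumes B: "strongly_measurable M B" and x: "x \<in> borel_measurable M"
  shows "(\<lambda>z. B z (x z)) \<in> borel_measurable M"
proof -
  obtain s where s: "\<And>i. simple_function M (s i)" "\<And>z. z \<in> space M \<Longrightarrow> (\<lambda>i. s i z) \<longlonglongrightarrow> x z"
    using borel_measurable_implies_sequence_metric[OF x, of 0] by blast
  show ?thesis
  proof (rule borel_measurable_LIMSEQ_metric)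
    show "(\<lambda>z. B z (s i z)) \<in> borel_measurable M" for i
    proof (rule measurable_compose_countable'[where f = "\<lambda>v z. B z v" and I = "s i ` space M"])
      show "(\<lambda>z. B z v) \<in> borel_measurable M" for v using B unfolding strongly_measurable_def by blast
      show "s i \<in> measurable M (count_space (s i ` space M))"
        using measurable_simple_function[OF s(1)[of i]] by (auto simp: measurable_def)
      show "countable (s i ` space M)" using s(1)[of i] by (auto simp: simple_function_def countable_finite)
    qed
    show "(\<lambda>i. B z (s i z)) \<longlonglongrightarrow> B z (x z)" if "z \<in> space M" for z
      using s(2)[OF that] by (intro tendsto_intros)
  qed
qed

lemma strongly_measurable_compose:
  fixes B B' :: "'w \<Rightarrow> 'x::{banach, second_countable_topology} \<Rightarrow>\<^sub>L 'x"
  assumes "strongly_measurable M B" "strongly_measurable M B'"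
  shows "strongly_measurable M (\<lambda>z. B z o\<^sub>L B' z)"
  unfolding strongly_measurable_def
  using strongly_measurable_apply[OF assms(1)] assms(2) by (simp add: strongly_measurable_def)

lemma strongly_measurable_shift:
  assumes "strongly_measurable M B" "T \<in> measurable M M"
  shows "strongly_measurable M (\<lambda>z. B (T z))"
  using assms measurable_compose[of T M M] unfolding strongly_measurable_def by blast

text \<open>The bound defining \<open>norm (B z) \<le> a\<close> is a closed condition on the
  vector, so a countable dense set of vectors decides it.\<close>

lemma strongly_measurable_norm:
  fixes B :: "'w \<Rightarrow> 'x::{banach, second_countable_topology} \<Rightarrow>\<^sub>L 'x"
  assumes B: "strongly_measurable M B"
  shows "(\<lambda>z. norm (B z)) \<in> borel_measurable M"
proof -
  obtain D :: "'x set" where D: "countable D" "\<And>X. open X \<Longrightarrow> X \<noteq> {} \<Longrightarrow> \<exists>d\<in>D. d \<in> X"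
    by (rule countable_dense_setE) blast
  have [measurable]: "(\<lambda>z. B z d) \<in> borel_measurable M" for d using B unfolding strongly_measurable_def by blast
  have "norm (B z) \<le> a \<longleftrightarrow> 0 \<le> a \<and> (\<forall>d\<in>D. norm (B z d) \<le> a * norm d)" for z a
  proof (intro iffI conjI ballI)
    assume R: "0 \<le> a \<and> (\<forall>d\<in>D. norm (B z d) \<le> a * norm d)"
    have "norm (B z x) \<le> a * norm x" for x
    proof (rule ccontr)
      assume "\<not> ?thesis"
      then have "x \<in> {x. norm (B z x) > a * norm x}" by simp
      moreover have "open {x. norm (B z x) > a * norm x}" by (intro open_Collect_less continuous_intros)
      ultimately show False using D(2) R by fastforce
    qed
    then show "norm (B z) \<le> a" using R norm_blinfun_bound by blast
  next
    fix d assume "norm (B z) \<le> a"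
    then show "norm (B z d) \<le> a * norm d"
      using norm_blinfun[of "B z" d] mult_right_mono[of "norm (B z)" a "norm d"] by auto
  qed (use norm_ge_zero order_trans in blast)
  moreover have "{z \<in> space M. 0 \<le> a \<and> (\<forall>d\<in>D. norm (B z d) \<le> a * norm d)} \<in> sets M" for a
    using D(1) by measurable
  ultimately have "{z \<in> space M. norm (B z) \<le> a} \<in> sets M" for a by presburger
  then show ?thesis unfolding borel_measurable_iff_le by blast
qed

text \<open>The approximate solutions from a dense sequence may well diverge, but the bound of
  \<open>H z\<close> by \<open>L z\<close> makes their images under \<open>H z\<close> converge to
  \<open>r z\<close>. The constant in it may vary with \<open>z\<close> in any way.\<close>

lemma measurable_linear_solution:
  fixes L H :: "'w \<Rightarrow> 'x::{banach, second_countable_topology} \<Rightarrow>\<^sub>L 'x"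
  assumes L: "strongly_measurable M L" and H: "strongly_measurable M H"
    and rhs: "rhs \<in> borel_measurable M" and W: "W \<in> sets M"
    and sol: "\<And>z. z \<in> W \<Longrightarrow> \<exists>c y. L z y = rhs z \<and> r z = H z y \<and> (\<forall>d. norm (H z d) \<le> c * norm (L z d))"
  shows "(\<lambda>z. if z \<in> W then r z else 0) \<in> borel_measurable M"
proof -
  obtain D :: "'x set" where D: "countable D" "\<And>X. open X \<Longrightarrow> X \<noteq> {} \<Longrightarrow> \<exists>d\<in>D. d \<in> X"
    by (rule countable_dense_setE) blast
  have "D \<noteq> {}" using D(2)[of UNIV] by auto
  define d where "d = from_nat_into D"
  have dense: "\<exists>j::nat. d j \<in> X" if X: "open X" "X \<noteq> {}" for X
  proof -
    obtain v where "v \<in> D" "v \<in> X" using D(2)[OF X] by blast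
    then show ?thesis using from_nat_into_surj[OF D(1)] unfolding d_def by metis
  qed
  note [measurable] = rhs W
  have [measurable]: "(\<lambda>z. L z v) \<in> borel_measurable M" "(\<lambda>z. H z v) \<in> borel_measurable M" for v
    using L H unfolding strongly_measurable_def by blast+
  \<comment> \<open>A least index with a measurable property is measurable; on \<open>W\<close> it
    exists by density, because there is an exact solution \<open>y\<close>.\<close>
  define J where "J n z = (LEAST j. norm (L z (d j) - rhs z) < inverse (real (Suc n)))" for n z
  have J[measurable]: "J n \<in> measurable M (count_space UNIV)" for n unfolding J_def by measurable
  have Hd: "(\<lambda>z. H z (d (J n z))) \<in> borel_measurable M" for n
    by (rule measurable_compose_countable[OF _ J]) measurable
  show ?thesis
  proof (rule borel_measurable_LIMSEQ_metric)
    show "(\<lambda>z. if z \<in> W then H z (d (J n z)) else 0) \<in> borel_measurable M" for n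
      using Hd W by (intro measurable_If_set) auto
    fix z
    show "(\<lambda>n. if z \<in> W then H z (d (J n z)) else 0) \<longlonglongrightarrow> (if z \<in> W then r z else 0)"
    proof (cases "z \<in> W")
      case True
      then obtain c y where y: "L z y = rhs z" "r z = H z y" "\<And>v. norm (H z v) \<le> c * norm (L z v)"
        using sol by blast
      have small: "norm (L z (d (J n z)) - rhs z) < inverse (real (Suc n))" for n
      proof -
        have "open {v. norm (L z v - rhs z) < inverse (real (Suc n))}"
          by (intro open_Collect_less continuous_intros)
        moreover have "y \<in> {v. norm (L z v - rhs z) < inverse (real (Suc n))}" using y(1) by simp
        ultimately have "\<exists>j. norm (L z (d j) - rhs z) < inverse (real (Suc n))" using dense by blast
        then show ?thesis unfolding J_def by (rule LeastI_ex)
      qed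
      have "norm (H z (d (J n z)) - r z) \<le> \<bar>c\<bar> * inverse (real (Suc n))" for n
      proof -
        have "norm (H z (d (J n z)) - r z) = norm (H z (d (J n z) - y))"
          using y(2) by (simp add: blinfun.diff_right)
        also have "\<dots> \<le> c * norm (L z (d (J n z) - y))" by (rule y(3))
        also have "\<dots> = c * norm (L z (d (J n z)) - rhs z)" using y(1) by (simp add: blinfun.diff_right)
        also have "\<dots> \<le> \<bar>c\<bar> * inverse (real (Suc n))" using small[of n] by (intro mult_mono) auto
        finally show ?thesis .
      qed
      moreover have "(\<lambda>n. \<bar>c\<bar> * inverse (real (Suc n))) \<longlonglongrightarrow> 0"
        using tendsto_mult_right_zero[OF LIMSEQ_inverse_real_of_nat] by blast
      ultimately have "(\<lambda>n. H z (d (J n z)) - r z) \<longlonglongrightarrow> 0"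
        by (intro Lim_null_comparison[of "\<lambda>n. H z (d (J n z)) - r z"]) (auto intro: always_eventually)
      then show ?thesis using True by (simp add: LIM_zero_iff)
    qed simp
  qed
qed

text \<open>The projection onto the range of \<open>H z\<close> along the kernel of
  \<open>J z\<close> is found by solving \<open>J z (H z y) = J z x\<close> for \<open>y\<close>.
  Finite dimension of the range yields the pointwise bound that this requires.\<close>

lemma strongly_measurable_projection:
  fixes H J P :: "'w \<Rightarrow> 'x::{banach, second_countable_topology} \<Rightarrow>\<^sub>L 'x"
  assumes H: "strongly_measurable M H" and J: "strongly_measurable M J" and W: "W \<in> sets M"
    and dim: "\<And>z. z \<in> W \<Longrightarrow> has_dim (range (H z)) (k z)"
    and inj: "\<And>z x. z \<in> W \<Longrightarrow> x \<in> range (H z) \<Longrightarrow> J z x = 0 \<Longrightarrow> x = 0"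
    and P: "\<And>z x. z \<in> W \<Longrightarrow> P z x \<in> range (H z) \<and> J z (x - P z x) = 0"
  shows "strongly_measurable M (\<lambda>z. if z \<in> W then P z else 0)"
  unfolding strongly_measurable_def
proof
  fix x
  have "(\<lambda>z. if z \<in> W then P z x else 0) \<in> borel_measurable M"
  proof (rule measurable_linear_solution[OF strongly_measurable_compose[OF J H] H _ W, where rhs = "\<lambda>z. J z x"])
    show "(\<lambda>z. J z x) \<in> borel_measurable M" using J unfolding strongly_measurable_def by blast
    fix z assume z: "z \<in> W"
    have "linear (J z)" using blinfun.bounded_linear_right bounded_linear.linear by blast
    then obtain c where c: "\<And>v. v \<in> range (H z) \<Longrightarrow> norm v \<le> c * norm (J z v)"
      using has_dim_bounded_below[OF dim[OF z]] inj[OF z] by blast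
    obtain y where "P z x = H z y" using P[OF z] by blast
    then show "\<exists>c y. (J z o\<^sub>L H z) y = J z x \<and> P z x = H z y \<and>
        (\<forall>d. norm (H z d) \<le> c * norm ((J z o\<^sub>L H z) d))"
      using P[OF z, of x] c by (intro exI[of _ c] exI[of _ y]) (auto simp: blinfun.diff_right)
  qed
  moreover have "(\<lambda>z. (if z \<in> W then P z else 0) x) = (\<lambda>z. if z \<in> W then P z x else 0)" by auto
  ultimately show "(\<lambda>z. (if z \<in> W then P z else 0) x) \<in> borel_measurable M" by simp
qed

lemma splitting_with_projection:
  assumes "splitting_with k E F P Q"
  shows "range (blinfun_apply P) = E" "P x = 0 \<longleftrightarrow> x \<in> F" "Q x = x - P x" "subspace E" "subspace F"
    "e \<in> E \<Longrightarrow> P e = e"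
proof -
  show E: "subspace E" using assms has_dim_subspace unfolding splitting_with_def by blast
  show F: "subspace F" using assms unfolding splitting_with_def has_codim_def by blast
  have PQ: "P x \<in> E" "Q x \<in> F" "P x + Q x = x" for x using assms unfolding splitting_with_def by blast+
  have EF: "E \<inter> F = {0}" using assms unfolding splitting_with_def by blast
  show Q: "Q x = x - P x" for x using PQ(3)[of x] by (metis add_diff_cancel_left')
  show id: "P e = e" if "e \<in> E" for e
  proof -
    have "e - P e \<in> E" using subspace_diff[OF E that PQ(1)] .
    moreover have "e - P e \<in> F" using PQ(2)[of e] unfolding Q .
    ultimately have "e - P e = 0" using EF by blast
    then show ?thesis by simp
  qed
  show "range (blinfun_apply P) = E" using PQ(1) id by (metis image_subsetI rangeI subsetI subset_antisym)
  show "P x = 0 \<longleftrightarrow> x \<in> F"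
  proof
    assume "x \<in> F"
    have "x - (x - P x) \<in> F" using subspace_diff[OF F \<open>x \<in> F\<close>] PQ(2)[of x] unfolding Q by blast
    then have "P x \<in> F" by simp
    then show "P x = 0" using EF PQ(1) by blast
  qed (use PQ(2)[of x] Q in simp)
qed

text \<open>The vectorwise inequality becomes one for two suprema. A nonzero vector of
  \<open>E\<close> bounds the quotients on \<open>F\<close>, so that supremum is genuine; the
  quotient at the zero vector is 0 by convention.\<close>

lemma onorm_on_inverse_product_le:
  fixes T :: "'x::real_normed_vector \<Rightarrow>\<^sub>L 'x"
  assumes inj: "inj_on T E" and img: "T ` E = E'" and E: "\<exists>e\<in>E. e \<noteq> 0" and E0: "0 \<in> E" and F0: "0 \<in> F"
    and D: "D \<ge> 0" "\<And>v w. v \<in> E \<Longrightarrow> w \<in> F \<Longrightarrow> norm (T w) * norm v \<le> D * norm w * norm (T v)"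
  shows "onorm_on E' (inv_into E T) * onorm_on F T \<le> D"
proof -
  have Tz: "T v \<noteq> 0" if "v \<in> E" "v \<noteq> 0" for v
    using inj_onD[OF inj _ that(1) E0] that(2) by (metis blinfun.zero_right)
  define b where "b = onorm_on F T"
  have le: "norm (T w) / norm w * (norm v / norm (T v)) \<le> D" if "v \<in> E" "v \<noteq> 0" "w \<in> F" for v w
    using D(1) D(2)[OF that(1,3)] Tz[OF that(1,2)] by (cases "w = 0") (auto simp: field_simps)
  have le': "norm (T w) / norm w \<le> D * norm (T v) / norm v" if "v \<in> E" "v \<noteq> 0" "w \<in> F" for v w
  proof -
    have "norm v / norm (T v) > 0" using Tz[OF that(1,2)] that(2) by simp
    then have "norm (T w) / norm w \<le> D / (norm v / norm (T v))"
      using le[OF that] by (subst pos_le_divide_eq) auto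
    then show ?thesis by simp
  qed
  obtain e where e: "e \<in> E" "e \<noteq> 0" using E by blast
  have bdd: "bdd_above ((\<lambda>w. norm (T w) / norm w) ` F)"
    using le'[OF e] by (intro bdd_aboveI2)
  have b0: "b \<ge> 0" unfolding b_def onorm_on_def using cSUP_upper[OF F0 bdd] by (simp add: blinfun.zero_right)
  have bv: "b \<le> D * norm (T v) / norm v" if "v \<in> E" "v \<noteq> 0" for v
    unfolding b_def onorm_on_def using F0 le'[OF that] by (intro cSUP_least) auto
  show ?thesis
  \<comment> \<open>For \<open>b = 0\<close> the product vanishes whatever the first factor;
    otherwise \<open>D / b\<close> bounds the quotients of the inverse.\<close>
  proof (cases "b = 0")
    case False
    then have "b > 0" using b0 by simp
    have "onorm_on E' (inv_into E T) \<le> D / b"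
      unfolding onorm_on_def
    proof (rule cSUP_least)
      show "E' \<noteq> {}" using img e by blast
      fix x assume "x \<in> E'"
      then obtain v where v: "v \<in> E" "x = T v" using img by blast
      have "norm v / norm (T v) \<le> D / b"
      proof (cases "v = 0")
        case False
        then show ?thesis using bv[OF v(1) False] \<open>b > 0\<close> Tz[OF v(1) False] by (simp add: field_simps)
      qed (use D(1) \<open>b > 0\<close> in simp)
      then show "norm (inv_into E T x) / norm x \<le> D / b" using v inv_into_f_f[OF inj v(1)] by simp
    qed
    then show ?thesis using \<open>b > 0\<close> by (simp add: field_simps b_def)
  qed (use D(1) b_def in simp)
qed

section \<open>Separation indices\<close>

lemma sep_index_ge:
  assumes "\<And>v u. v \<in> L \<Longrightarrow> norm v = 1 \<Longrightarrow> u \<in> C \<Longrightarrow> r \<le> norm (v - u)"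
  shows "sep_index L C \<ge> ereal r"
  unfolding sep_index_def using assms by (intro INF_greatest) auto

lemma sep_index_le:
  assumes "sep_index L C \<ge> ereal r" "v \<in> L" "norm v = 1" "u \<in> C"
  shows "r \<le> norm (v - u)"
proof -
  have "sep_index L C \<le> ereal (norm (v - u))"
    unfolding sep_index_def using assms by (intro INF_lower2[of v] INF_lower2[of u]) auto
  then have "ereal r \<le> ereal (norm (v - u))" using assms(1) order_trans by blast
  then show ?thesis by simp
qed

lemma has_dim_nonzero:
  assumes "has_dim E k" "k \<ge> 1"
  shows "\<exists>e\<in>E. e \<noteq> 0"
proof -
  obtain B where B: "finite B" "independent B" "card B = k" "span B = E"
    using assms unfolding has_dim_def by blast
  then obtain b where "b \<in> B" using assms(2) by fastforce
  moreover have "b \<noteq> 0" using B(2) \<open>b \<in> B\<close> dependent_zero by blast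
  ultimately show ?thesis using B(4) span_base by blast
qed

text \<open>A unit vector of \<open>E\<close>, available as \<open>k \<ge> 1\<close>, and the vector
  0 of \<open>F\<close> keep the infimum at most 1, so the conversion to a real number loses
  nothing.\<close>

lemma real_sep_index_bounds:
  assumes "\<And>v u. v \<in> E \<Longrightarrow> u \<in> F \<Longrightarrow> norm v \<le> c * norm (v - u)" and c: "c > 0"
    and E: "has_dim E k" "k \<ge> 1" and F: "0 \<in> F"
  shows "1 / c \<le> real_of_ereal (sep_index E F)" "real_of_ereal (sep_index E F) \<le> 1"
    "sep_index E F = ereal (real_of_ereal (sep_index E F))"
proof -
  obtain e where e: "e \<in> E" "e \<noteq> 0" using has_dim_nonzero E by blast
  define v where "v = (1 / norm e) *\<^sub>R e"
  have v: "v \<in> E" "norm v = 1" unfolding v_def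
    using subspace_scale[OF has_dim_subspace[OF E(1)] e(1)] e(2) by auto
  have ge: "sep_index E F \<ge> ereal (1 / c)"
    using assms(1) c by (intro sep_index_ge) (fastforce simp: field_simps)
  have "sep_index E F \<le> ereal (norm (v - 0))"
    unfolding sep_index_def using v F by (intro INF_lower2[of v] INF_lower2[of 0]) auto
  then have le: "sep_index E F \<le> ereal 1" using v by simp
  have fin: "\<bar>sep_index E F\<bar> \<noteq> \<infinity>" using ge le by (cases "sep_index E F") auto
  then show *: "sep_index E F = ereal (real_of_ereal (sep_index E F))" by (simp add: ereal_real)
  show "1 / c \<le> real_of_ereal (sep_index E F)" "real_of_ereal (sep_index E F) \<le> 1"
    using ge le * by (metis ereal_less_eq(3))+
qed

section \<open>From contracting cones to a dominated splitting\<close>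

lemma tendsto_zero_exp_bound:
  fixes X :: "nat \<Rightarrow> real"
  assumes "\<And>n. 0 \<le> X n" "\<And>n. X n \<le> exp (B - d * real n)" "d > 0"
  shows "X \<longlonglongrightarrow> 0"
proof (rule tendsto_sandwich[OF _ _ tendsto_const])
  have "exp (- d) < 1" using assms(3) by simp
  then have "(\<lambda>n. exp B * exp (- d) ^ n) \<longlonglongrightarrow> 0"
    by (intro tendsto_mult_right_zero LIMSEQ_realpow_zero) auto
  moreover have "exp B * exp (- d) ^ n = exp (B - d * real n)" for n
    by (simp add: exp_of_nat_mult[symmetric] exp_add[symmetric] mult.commute)
  ultimately show "(\<lambda>n. exp (B - d * real n)) \<longlonglongrightarrow> 0" by simp
qed (use assms in auto)

section \<open>A full invariant domain with an invariant rate\<close>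

locale rds_domain = linear_rds M \<theta> A
  for M :: "'w measure" and \<theta> :: "'w \<Rightarrow> 'w"
    and A :: "'w \<Rightarrow> 'x::{banach, second_countable_topology} \<Rightarrow>\<^sub>L 'x" +
  fixes W :: "'w set" and \<delta> :: "'w \<Rightarrow> real"
  assumes W_sets: "W \<in> sets M" and W_full: "emeasure M W = emeasure M (space M)" and W_image: "\<theta> ` W = W"
    and \<delta>_measurable: "\<delta> \<in> borel_measurable M"
    and \<delta>_invariant: "z \<in> space M \<Longrightarrow> 0 < \<delta> z \<and> \<delta> (\<theta> z) = \<delta> z"
begin

lemma W_space: "z \<in> W \<Longrightarrow> z \<in> space M"
  using W_sets sets.sets_into_space by blast

sublocale invertible_dynamics W \<theta> "inv_into (space M) \<theta>"
proof
  fix z assume z: "z \<in> W"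
  show "\<theta> z \<in> W" using z W_image by blast
  show "\<theta> (\<psi> z) = z" "\<psi> (\<theta> z) = z" using dyn.theta_psi dyn.psi_theta W_space[OF z] by auto
  obtain y where "y \<in> W" "z = \<theta> y" using z W_image by blast
  then show "\<psi> z \<in> W" using dyn.psi_theta W_space by simp
qed

lemma theta_iter_W: "z \<in> W \<Longrightarrow> orb j z \<in> W"
  unfolding theta_iter_def by (auto simp: theta_pow_W psi_pow_W)

lemma AE_W: "AE z in M. z \<in> W"
  using emeasure_eq_1_AE[OF W_sets] W_full emeasure_space_1 prob_eq_1[OF W_sets]
  by (simp add: emeasure_eq_measure)

lemma \<delta>_theta_pow: "z \<in> W \<Longrightarrow> \<delta> ((\<theta> ^^ n) z) = \<delta> z"
  using \<delta>_invariant theta_pow_W W_space by (induction n) auto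

lemma \<delta>_theta_iter:
  assumes z: "z \<in> W" shows "\<delta> (orb j z) = \<delta> z"
proof -
  have "\<delta> ((\<psi> ^^ n) z) = \<delta> z" for n
    using \<delta>_theta_pow[OF psi_pow_W[OF z], of n n] theta_pow_psi_pow[OF z] by simp
  then show ?thesis unfolding theta_iter_def using \<delta>_theta_pow[OF z] by simp
qed

lemma theta_pow_measurable: "\<theta> ^^ n \<in> measurable M M"
proof -
  have "\<theta> ^^ n = orb (int n)" by (auto simp: theta_iter_of_nat)
  then show ?thesis using measurable_theta_iter by metis
qed

end

locale contracting_rds =
  rds_domain M \<theta> A W \<delta> + contracting_cones W \<theta> "inv_into (space M) \<theta>" A k C E0 F0 c
  for M :: "'w measure" and \<theta> :: "'w \<Rightarrow> 'w"
    and A :: "'w \<Rightarrow> 'x::{banach, second_countable_topology} \<Rightarrow>\<^sub>L 'x"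
    and W :: "'w set" and \<delta> :: "'w \<Rightarrow> real"
    and k :: "'w \<Rightarrow> nat" and C E0 F0 :: "'w \<Rightarrow> 'x set" and c :: "'w \<Rightarrow> real" +
  fixes P0 Q0 :: "'w \<Rightarrow> 'x \<Rightarrow>\<^sub>L 'x"
  assumes index: "invariant_index M \<theta> k"
    and c_measurable: "c \<in> borel_measurable M"
    and c_tempered: "z \<in> W \<Longrightarrow> subexponential_along M \<theta> c z"
    and splitting0: "z \<in> W \<Longrightarrow> splitting_with (k z) (E0 z) (F0 z) (P0 z) (Q0 z)"
    and P0_measurable: "strongly_measurable M P0"
    and growth_rate: "z \<in> W \<Longrightarrow> \<epsilon> > 0 \<Longrightarrow> \<exists>B. \<forall>j.
      \<bar>orbit_sum (\<lambda>z. ln (1 + 1 / (4 * (c z)\<^sup>2))) z j - 2 * of_int j * \<delta> z\<bar> \<le> \<epsilon> * \<bar>real_of_int j\<bar> + B"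
begin

lemma c_exp_bound:
  assumes z: "z \<in> W" and \<epsilon>: "\<epsilon> > 0"
  shows "\<exists>B. \<forall>j. c (orb j z) \<le> exp (\<epsilon> * \<bar>real_of_int j\<bar> + B)"
proof -
  obtain B where B: "\<And>j. \<bar>ln (c (orb j z))\<bar> \<le> \<epsilon> * \<bar>real_of_int j\<bar> + B"
    using c_tempered[OF z] \<epsilon> unfolding subexponential_along_iff by blast
  have "c (orb j z) \<le> exp (\<epsilon> * \<bar>real_of_int j\<bar> + B)" for j
    using B[of j] c_pos[OF theta_iter_W[OF z], of j] exp_le_cancel_iff[of "ln (c (orb j z))"] by simp
  then show ?thesis by blast
qed

text \<open>The product in \<open>dom_const\<close> is the exponential of a difference of two orbit
  sums based at \<open>z\<close>, so the two-sided estimate at \<open>z\<close> covers all base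
  points on its orbit at the price of an error linear in the absolute value of
  \<open>m\<close>.\<close>

lemma dom_const_bound:
  assumes z: "z \<in> W" and \<epsilon>: "\<epsilon> > 0"
  shows "\<exists>B. \<forall>m n. dom_const n (orb m z) \<le>
    exp (\<epsilon> * \<bar>real_of_int m\<bar> + B - (2 * \<delta> z - \<epsilon>) * real n)"
proof -
  \<comment> \<open>Four terms contribute an error proportional to the absolute value of
    \<open>m\<close>: the two values of \<open>c\<close> and the two orbit sums.\<close>
  define e where "e = \<epsilon> / 4"
  have e: "e > 0" "\<epsilon> = 4 * e" using \<epsilon> unfolding e_def by auto
  have zs: "z \<in> space M" using W_space z .
  define g where "g z = ln (1 + 1 / (4 * (c z)\<^sup>2))" for z
  obtain B1 where cexp: "\<And>j. c (orb j z) \<le> exp (e * \<bar>real_of_int j\<bar> + B1)"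
    using c_exp_bound[OF z e(1)] by blast
  obtain B2 where B2: "\<And>j. \<bar>orbit_sum g z j - 2 * of_int j * \<delta> z\<bar> \<le> e * \<bar>real_of_int j\<bar> + B2"
    using growth_rate[OF z e(1)] unfolding g_def by blast
  \<comment> \<open>The term \<open>2 * \<delta> z\<close> pays for the product having only
    \<open>n - 1\<close> factors; the maximum with 0 covers \<open>n = 0\<close>, where
    \<open>dom_const\<close> is 1.\<close>
  define B where "B = max 0 (ln 2 + 4 * e + 2 * B1 + 2 * B2 + 2 * \<delta> z)"
  have "dom_const n (orb m z) \<le> exp (\<epsilon> * \<bar>real_of_int m\<bar> + B - (2 * \<delta> z - \<epsilon>) * real n)" for m n
  proof (cases n)
    case 0
    then show ?thesis using \<epsilon> unfolding dom_const_def B_def by simp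
  next
    case (Suc l)
    let ?m = "\<bar>real_of_int m\<bar>"
    define \<eta> where "\<eta> = orb m z"
    have \<eta>: "\<eta> \<in> W" unfolding \<eta>_def using theta_iter_W[OF z] .
    have thl: "(\<theta> ^^ l) \<eta> = orb (m + int l) z"
      unfolding \<eta>_def using theta_iter_add_nat[OF zs] by simp
    have psi: "\<psi> \<eta> = orb (m - 1) z" unfolding \<eta>_def using theta_iter_pred[OF zs] by simp
    have abs1: "e * \<bar>real_of_int (m + int l)\<bar> \<le> e * (?m + real l)" using e(1) by (intro mult_left_mono) auto
    have abs2: "e * \<bar>real_of_int (m - 1)\<bar> \<le> e * (?m + 1)" using e(1) by (intro mult_left_mono) auto
    have "1 + c ((\<theta> ^^ l) \<eta>) \<le> 2 * c ((\<theta> ^^ l) \<eta>)" using c_ge_1[OF theta_pow_W[OF \<eta>]] by simp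
    also have "\<dots> \<le> exp (ln 2) * exp (e * (?m + real l) + B1)"
      unfolding thl using order_trans[OF cexp[of "m + int l"]] abs1 by (simp add: mult_left_mono)
    also have "\<dots> = exp (ln 2 + e * (?m + real l) + B1)" by (simp only: exp_add mult.assoc)
    finally have 1: "1 + c ((\<theta> ^^ l) \<eta>) \<le> exp (ln 2 + e * (?m + real l) + B1)" .
    have 2: "c (\<psi> \<eta>) \<le> exp (e * (?m + 1) + B1)"
      unfolding psi using order_trans[OF cexp[of "m - 1"]] abs2 by simp
    have pos: "1 + 1 / (4 * (c ((\<theta> ^^ i) \<eta>))\<^sup>2) > 0" for i by (simp add: add_pos_nonneg)
    have "(\<Prod>i<l. 1 + 1 / (4 * (c ((\<theta> ^^ i) \<eta>))\<^sup>2)) = exp (\<Sum>i<l. g ((\<theta> ^^ i) \<eta>))"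
      unfolding exp_sum[OF finite_lessThan] g_def using pos by (intro prod.cong refl) (simp add: exp_ln)
    also have "(\<Sum>i<l. g ((\<theta> ^^ i) \<eta>)) = orbit_sum g z (m + int l) - orbit_sum g z m"
      unfolding \<eta>_def using orbit_sum_add[OF zs, of g m l] by simp
    finally have prod: "(\<Prod>i<l. 1 + 1 / (4 * (c ((\<theta> ^^ i) \<eta>))\<^sup>2)) = exp (orbit_sum g z (m + int l) - orbit_sum g z m)" .
    have "orbit_sum g z (m + int l) - orbit_sum g z m \<ge>
        2 * \<delta> z * real l - e * (?m + real l) - e * ?m - 2 * B2"
      using B2[of m] B2[of "m + int l"] abs1 by (simp add: algebra_simps abs_le_iff)
    then have 3: "exp (2 * \<delta> z * real l - e * (?m + real l) - e * ?m - 2 * B2)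
        \<le> (\<Prod>i<l. 1 + 1 / (4 * (c ((\<theta> ^^ i) \<eta>))\<^sup>2))" unfolding prod by simp
    have "dom_const n \<eta> = (1 + c ((\<theta> ^^ l) \<eta>)) * c (\<psi> \<eta>) / (\<Prod>i<l. 1 + 1 / (4 * (c ((\<theta> ^^ i) \<eta>))\<^sup>2))"
      unfolding dom_const_def Suc by simp
    also have "\<dots> \<le> (exp (ln 2 + e * (?m + real l) + B1) * exp (e * (?m + 1) + B1)) /
        exp (2 * \<delta> z * real l - e * (?m + real l) - e * ?m - 2 * B2)"
      using c_pos[OF psi_W[OF \<eta>]] c_pos[OF theta_pow_W[OF \<eta>, of l]]
      by (intro frac_le mult_mono 1 2 3) auto
    also have "\<dots> = exp ((ln 2 + e * (?m + real l) + B1) + (e * (?m + 1) + B1) -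
        (2 * \<delta> z * real l - e * (?m + real l) - e * ?m - 2 * B2))"
      by (simp only: exp_add exp_diff)
    also have "\<dots> \<le> exp (\<epsilon> * ?m + B - (2 * \<delta> z - \<epsilon>) * real n)"
    proof -
      have "B \<ge> ln 2 + 4 * e + 2 * B1 + 2 * B2 + 2 * \<delta> z" unfolding B_def by simp
      moreover have "0 \<le> e * real l" using e(1) by simp
      moreover have "(4 * e * ?m + B - (2 * \<delta> z - 4 * e) * real (Suc l)) -
          ((ln 2 + e * (?m + real l) + B1) + (e * (?m + 1) + B1) -
          (2 * \<delta> z * real l - e * (?m + real l) - e * ?m - 2 * B2)) =
          (B - (ln 2 + 4 * e + 2 * B1 + 2 * B2 + 2 * \<delta> z)) + 7 * e + 2 * (e * real l)"
        by (simp add: algebra_simps)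
      ultimately show ?thesis using e(1) unfolding e(2) Suc exp_le_cancel_iff by linarith
    qed
    finally show ?thesis unfolding \<eta>_def .
  qed
  then show ?thesis by blast
qed

sublocale tempered_contracting_cones W \<theta> "inv_into (space M) \<theta>" A k C E0 F0 c
proof
  fix z assume z: "z \<in> W"
  have zs: "z \<in> space M" using W_space z .
  \<comment> \<open>The decay rate \<open>2 * \<delta> z - e\<close> is then \<open>7 * e\<close>,
    while the growth of \<open>c\<close> and of the base point along the backward orbit costs at
    most \<open>2 * e\<close>.\<close>
  define e where "e = \<delta> z / 4"
  have e: "e > 0" "\<delta> z = 4 * e" unfolding e_def using \<delta>_invariant[OF zs] by auto
  obtain B1 where cexp: "\<And>j. c (orb j z) \<le> exp (e * \<bar>real_of_int j\<bar> + B1)"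
    using c_exp_bound[OF z e(1)] by blast
  obtain B where B: "\<And>m n. dom_const n (orb m z) \<le>
    exp (e * \<bar>real_of_int m\<bar> + B - (2 * \<delta> z - e) * real n)" using dom_const_bound[OF z e(1)] by blast
  show "(\<lambda>n. c ((\<theta> ^^ n) z) * dom_const (Suc n) z) \<longlonglongrightarrow> 0"
  proof (rule tendsto_zero_exp_bound[OF _ _ e(1)])
    show "0 \<le> c ((\<theta> ^^ n) z) * dom_const (Suc n) z" for n
      using c_pos[OF theta_pow_W[OF z]] dom_const_nonneg[OF z] by (simp add: less_imp_le)
    show "c ((\<theta> ^^ n) z) * dom_const (Suc n) z \<le> exp (B1 + B - e * real n)" for n
    proof -
      have "c ((\<theta> ^^ n) z) * dom_const (Suc n) z \<le> exp (e * real n + B1) * exp (B - (2 * \<delta> z - e) * real (Suc n))"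
        using cexp[of "int n"] B[of "Suc n" 0] dom_const_nonneg[OF z]
        by (intro mult_mono) (simp_all add: theta_iter_of_nat, simp add: theta_iter_def)
      also have "\<dots> = exp ((e * real n + B1) + (B - (2 * \<delta> z - e) * real (Suc n)))" by (simp only: exp_add)
      also have "\<dots> \<le> exp (B1 + B - e * real n)" using e(1) by (simp add: e(2) algebra_simps)
      finally show ?thesis .
    qed
  qed
  show "(\<lambda>n. (1 + c ((\<psi> ^^ Suc n) z)) * dom_const n ((\<psi> ^^ n) z)) \<longlonglongrightarrow> 0"
  proof (rule tendsto_zero_exp_bound[OF _ _ e(1)])
    show "0 \<le> (1 + c ((\<psi> ^^ Suc n) z)) * dom_const n ((\<psi> ^^ n) z)" for n
      using c_pos[OF psi_pow_W[OF z, of "Suc n"]] dom_const_nonneg[OF psi_pow_W[OF z]] by (simp add: less_imp_le)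
    show "(1 + c ((\<psi> ^^ Suc n) z)) * dom_const n ((\<psi> ^^ n) z) \<le> exp (ln 2 + e + B1 + B - e * real n)" for n
    proof -
      have p: "(\<psi> ^^ Suc n) z = orb (- int (Suc n)) z" "(\<psi> ^^ n) z = orb (- int n) z"
        by (simp_all only: theta_iter_neg)
      have "1 + c ((\<psi> ^^ Suc n) z) \<le> exp (ln 2) * c ((\<psi> ^^ Suc n) z)"
        using c_ge_1[OF psi_pow_W[OF z, of "Suc n"]] by simp
      also have "\<dots> \<le> exp (ln 2) * exp (e * (real n + 1) + B1)"
        unfolding p using cexp[of "- int (Suc n)"] by (intro mult_left_mono) (simp_all add: add.commute)
      finally have 1: "1 + c ((\<psi> ^^ Suc n) z) \<le> exp (ln 2) * exp (e * (real n + 1) + B1)" .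
      have 2: "dom_const n ((\<psi> ^^ n) z) \<le> exp (e * real n + B - (2 * \<delta> z - e) * real n)"
        unfolding p using B[of n "- int n"] by simp
      have "(1 + c ((\<psi> ^^ Suc n) z)) * dom_const n ((\<psi> ^^ n) z) \<le>
          exp (ln 2) * exp (e * (real n + 1) + B1) * exp (e * real n + B - (2 * \<delta> z - e) * real n)"
        using dom_const_nonneg[OF psi_pow_W[OF z]] by (intro mult_mono 1 2) auto
      also have "\<dots> = exp (ln 2 + (e * (real n + 1) + B1) + (e * real n + B - (2 * \<delta> z - e) * real n))"
        by (simp only: exp_add)
      also have "\<dots> \<le> exp (ln 2 + e + B1 + B - e * real n)"
        using e(1) unfolding exp_le_cancel_iff by (simp add: e(2) algebra_simps)
      finally show ?thesis .
    qed
  qed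
qed

text \<open>On \<open>W\<close> the least constant with which \<open>dom_const\<close> decays at
  rate \<delta>; it is finite because the actual rate is close to twice that, and at least 1 by the
  term \<open>n = 0\<close>. The value 1 elsewhere keeps it measurable and at least 1.\<close>

definition "K z = (SUP n. if z \<in> W then dom_const n z * exp (real n * \<delta> z) else 1)"

lemma K_bound:
  assumes z: "z \<in> W" and \<epsilon>: "\<epsilon> > 0"
  shows "\<exists>B. \<forall>m n. dom_const n (orb m z) * exp (real n * \<delta> (orb m z)) \<le> exp (\<epsilon> * \<bar>real_of_int m\<bar> + B)"
proof -
  have zs: "z \<in> space M" using W_space z .
  \<comment> \<open>With \<open>e \<le> \<delta> z\<close> the exponent
    \<open>- (2 * \<delta> z - e) * real n + real n * \<delta> z\<close> is nonpositive, so the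
    bound is free of \<open>n\<close> and passes to the supremum.\<close>
  define e where "e = min \<epsilon> (\<delta> z)"
  have e: "e > 0" "e \<le> \<epsilon>" "e \<le> \<delta> z" unfolding e_def using \<epsilon> \<delta>_invariant[OF zs] by auto
  obtain B where B: "\<And>m n. dom_const n (orb m z) \<le>
    exp (e * \<bar>real_of_int m\<bar> + B - (2 * \<delta> z - e) * real n)" using dom_const_bound[OF z e(1)] by blast
  have "dom_const n (orb m z) * exp (real n * \<delta> (orb m z)) \<le> exp (\<epsilon> * \<bar>real_of_int m\<bar> + B)" for m n
  proof -
    have "dom_const n (orb m z) * exp (real n * \<delta> (orb m z)) \<le>
        exp (e * \<bar>real_of_int m\<bar> + B - (2 * \<delta> z - e) * real n) * exp (real n * \<delta> z)"
      unfolding \<delta>_theta_iter[OF z] by (intro mult_right_mono B) auto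
    also have "\<dots> = exp ((e * \<bar>real_of_int m\<bar> + B - (2 * \<delta> z - e) * real n) + real n * \<delta> z)"
      by (simp only: exp_add)
    also have "\<dots> \<le> exp (\<epsilon> * \<bar>real_of_int m\<bar> + B)"
    proof -
      have "e * real n \<le> \<delta> z * real n" using e(3) by (intro mult_right_mono) auto
      moreover have "e * \<bar>real_of_int m\<bar> \<le> \<epsilon> * \<bar>real_of_int m\<bar>" using e(2) by (intro mult_right_mono) auto
      ultimately show ?thesis unfolding exp_le_cancel_iff by (simp add: algebra_simps)
    qed
    finally show ?thesis .
  qed
  then show ?thesis by blast
qed

lemma K_bdd: "bdd_above (range (\<lambda>n. if z \<in> W then dom_const n z * exp (real n * \<delta> z) else 1))"
proof (cases "z \<in> W")
  case True
  obtain B where B: "\<And>m n. dom_const n (orb m z) * exp (real n * \<delta> (orb m z)) \<le>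
      exp (1 * \<bar>real_of_int m\<bar> + B)" using K_bound[OF True, of 1] by auto
  have "dom_const n z * exp (real n * \<delta> z) \<le> exp B" for n
    using B[of n 0] by (simp add: theta_iter_def)
  then show ?thesis using True by (intro bdd_aboveI2) auto
qed (auto intro: bdd_aboveI2)

lemma K_upper: "z \<in> W \<Longrightarrow> dom_const n z * exp (real n * \<delta> z) \<le> K z"
  using cSUP_upper[OF UNIV_I[of n] K_bdd[of z]] unfolding K_def[symmetric] by simp

lemma K_ge: "z \<in> W \<Longrightarrow> dom_const n z \<le> K z * exp (- real n * \<delta> z)"
  using K_upper[of z n] by (simp add: exp_minus field_simps)

lemma K_ge_1: "1 \<le> K z"
proof (cases "z \<in> W")
  case True
  then show ?thesis using K_upper[of z 0] by (simp add: dom_const_def)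
qed (simp add: K_def)

lemma K_tempered:
  assumes z: "z \<in> W" shows "subexponential_along M \<theta> K z"
  unfolding subexponential_along_iff
proof (intro allI impI)
  fix \<epsilon> :: real assume "\<epsilon> > 0"
  then obtain B where B: "\<And>m n. dom_const n (orb m z) * exp (real n * \<delta> (orb m z)) \<le>
      exp (\<epsilon> * \<bar>real_of_int m\<bar> + B)" using K_bound[OF z] by blast
  have "\<bar>ln (K (orb m z))\<bar> \<le> \<epsilon> * \<bar>real_of_int m\<bar> + B" for m
  proof -
    have "K (orb m z) \<le> exp (\<epsilon> * \<bar>real_of_int m\<bar> + B)"
      unfolding K_def using B theta_iter_W[OF z] by (intro cSUP_least) auto
    then have "ln (K (orb m z)) \<le> \<epsilon> * \<bar>real_of_int m\<bar> + B"
      using K_ge_1[of "orb m z"] by (subst ln_le_cancel_iff[symmetric, of _ "exp _", simplified ln_exp, symmetric]) auto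
    then show ?thesis using K_ge_1[of "orb m z"] by simp
  qed
  then show "\<exists>B. \<forall>m. \<bar>ln (K (orb m z))\<bar> \<le> \<epsilon> * \<bar>real_of_int m\<bar> + B" by blast
qed

lemma psi_pow_measurable: "\<psi> ^^ n \<in> measurable M M"
proof -
  have "\<psi> ^^ n = orb (- int n)" by (simp only: theta_iter_neg fun_eq_iff) simp
  then show ?thesis using measurable_theta_iter by metis
qed

lemma K_measurable: "K \<in> borel_measurable M"
proof -
  have [measurable]: "(\<lambda>z. c ((\<theta> ^^ n) z)) \<in> borel_measurable M" for n
    using measurable_compose[OF theta_pow_measurable c_measurable] .
  have [measurable]: "(\<lambda>z. c (\<psi> z)) \<in> borel_measurable M"
    using measurable_compose[OF theta_inv_measurable c_measurable] .
  note [measurable] = W_sets \<delta>_measurable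
  have [measurable]: "dom_const n \<in> borel_measurable M" for n
    unfolding dom_const_def by (cases "n = 0") simp_all
  show ?thesis unfolding K_def
  proof (rule borel_measurable_cSUP[OF _ _ K_bdd])
    show "(\<lambda>z. if z \<in> W then dom_const n z * exp (real n * \<delta> z) else 1) \<in> borel_measurable M" for n
      by measurable
  qed simp
qed

section \<open>Strong measurability of the projections\<close>

lemma T_measurable: "strongly_measurable M (T n)"
proof (induction n)
  case 0
  then show ?case unfolding strongly_measurable_def by simp
next
  case (Suc n)
  have "strongly_measurable M (\<lambda>z. A ((\<theta> ^^ n) z))"
    using strongly_measurable_shift[OF A_measurable theta_pow_measurable] .
  then show ?case using strongly_measurable_compose[OF _ Suc] unfolding cocycle.simps by blast
qed

lemma range_P0: "z \<in> W \<Longrightarrow> range (P0 z) = E0 z"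
  using splitting_with_projection(1)[OF splitting0] .

lemma kernel_P0: "z \<in> W \<Longrightarrow> P0 z x = 0 \<longleftrightarrow> x \<in> F0 z"
  using splitting_with_projection(2)[OF splitting0] .

text \<open>Presents the pushforward as the range of a strongly measurable operator, the form in
  which \<open>strongly_measurable_projection\<close> takes subspaces.\<close>

lemma E_pre_param:
  "strongly_measurable M (\<lambda>z. T n ((\<psi> ^^ n) z) o\<^sub>L P0 ((\<psi> ^^ n) z))"
  "z \<in> W \<Longrightarrow> range (T n ((\<psi> ^^ n) z) o\<^sub>L P0 ((\<psi> ^^ n) z)) = E_pre n z"
proof -
  show "strongly_measurable M (\<lambda>z. T n ((\<psi> ^^ n) z) o\<^sub>L P0 ((\<psi> ^^ n) z))"
    using strongly_measurable_shift[OF strongly_measurable_compose[OF T_measurable P0_measurable] psi_pow_measurable] .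
  show "range (T n ((\<psi> ^^ n) z) o\<^sub>L P0 ((\<psi> ^^ n) z)) = E_pre n z" if "z \<in> W"
  proof -
    have "range (T n ((\<psi> ^^ n) z) o\<^sub>L P0 ((\<psi> ^^ n) z)) = T n ((\<psi> ^^ n) z) ` range (P0 ((\<psi> ^^ n) z))"
      by (auto simp: image_image)
    then show ?thesis unfolding E_pre_def range_P0[OF psi_pow_W[OF that]] .
  qed
qed

text \<open>The kernel is presented by an operator too: \<open>F_pre\<close> is the kernel of
  \<open>T (Suc n) z\<close> followed by \<open>P0\<close> at the end point.\<close>

lemma PF_measurable: "strongly_measurable M (\<lambda>z. if z \<in> W then PF n z else 0)"
proof (rule strongly_measurable_projection[OF E_pre_param(1)[of 1] _ W_sets])
  show "strongly_measurable M (\<lambda>z. P0 ((\<theta> ^^ Suc n) z) o\<^sub>L T (Suc n) z)"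
    by (intro strongly_measurable_compose T_measurable strongly_measurable_shift[OF P0_measurable theta_pow_measurable])
  fix z assume z: "z \<in> W"
  have W': "(\<theta> ^^ Suc n) z \<in> W" using theta_pow_W[OF z] .
  have ker: "(P0 ((\<theta> ^^ Suc n) z) o\<^sub>L T (Suc n) z) x = 0 \<longleftrightarrow> x \<in> F_pre (Suc n) z" for x
    unfolding blinfun_apply_blinfun_compose comp_apply kernel_P0[OF W'] F_pre_def by blast
  show "has_dim (range (T 1 ((\<psi> ^^ 1) z) o\<^sub>L P0 ((\<psi> ^^ 1) z))) (k z)"
    unfolding E_pre_param(2)[OF z] using E_pre_dim[OF z] .
  fix x
  show "PF n z x \<in> range (T 1 ((\<psi> ^^ 1) z) o\<^sub>L P0 ((\<psi> ^^ 1) z)) \<and>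
      (P0 ((\<theta> ^^ Suc n) z) o\<^sub>L T (Suc n) z) (x - PF n z x) = 0"
    unfolding E_pre_param(2)[OF z] ker using PF(1,2)[OF z] by blast
  assume "x \<in> range (T 1 ((\<psi> ^^ 1) z) o\<^sub>L P0 ((\<psi> ^^ 1) z))"
    and "(P0 ((\<theta> ^^ Suc n) z) o\<^sub>L T (Suc n) z) x = 0"
  then have "x \<in> E_pre 1 z" "x \<in> F_pre (Suc n) z" unfolding E_pre_param(2)[OF z] ker .
  then show "x = 0"
    using F_pre_avoids[OF z] avoids_C E_pre_core[OF z, of 0] core_subset[OF z] by fastforce
qed

lemma strongly_measurable_limit:
  fixes X :: "nat \<Rightarrow> 'w \<Rightarrow> 'x \<Rightarrow>\<^sub>L 'x" and Y :: "'w \<Rightarrow> 'x \<Rightarrow>\<^sub>L 'x"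
  assumes "\<And>n. strongly_measurable M (\<lambda>z. if z \<in> W then X n z else 0)"
    and "\<And>z x. z \<in> W \<Longrightarrow> (\<lambda>n. blinfun_apply (X n z) x) \<longlonglongrightarrow> Y z x"
  shows "strongly_measurable M (\<lambda>z. if z \<in> W then Y z else 0)"
  unfolding strongly_measurable_def
proof
  fix x
  show "(\<lambda>z. (if z \<in> W then Y z else 0) x) \<in> borel_measurable M"
  proof (rule borel_measurable_LIMSEQ_metric)
    show "(\<lambda>z. (if z \<in> W then X n z else 0) x) \<in> borel_measurable M" for n
      using assms(1) unfolding strongly_measurable_def by blast
    show "(\<lambda>n. (if z \<in> W then X n z else 0) x) \<longlonglongrightarrow> (if z \<in> W then Y z else 0) x" for z
      using assms(2) by (cases "z \<in> W") auto
  qed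
qed

lemma PF_lim_measurable: "strongly_measurable M (\<lambda>z. if z \<in> W then PF_lim z else 0)"
  using strongly_measurable_limit[OF PF_measurable PF_tendsto_apply] .

text \<open>\<open>F z\<close> is by definition the kernel of \<open>PF_lim z\<close>, whose
  measurability therefore has to come first.\<close>

lemma QE_measurable: "strongly_measurable M (\<lambda>z. if z \<in> W then QE n z else 0)"
proof (rule strongly_measurable_projection[OF E_pre_param(1)[of "Suc n"] PF_lim_measurable W_sets])
  fix z assume z: "z \<in> W"
  have ker: "(if z \<in> W then PF_lim z else 0) x = 0 \<longleftrightarrow> x \<in> F z" for x
    using z unfolding F_def by simp
  show "has_dim (range (T (Suc n) ((\<psi> ^^ Suc n) z) o\<^sub>L P0 ((\<psi> ^^ Suc n) z))) (k z)"
    unfolding E_pre_param(2)[OF z] using E_pre_dim[OF z] .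
  fix x
  show "QE n z x \<in> range (T (Suc n) ((\<psi> ^^ Suc n) z) o\<^sub>L P0 ((\<psi> ^^ Suc n) z)) \<and>
      (if z \<in> W then PF_lim z else 0) (x - QE n z x) = 0"
    unfolding E_pre_param(2)[OF z] ker using QE(1,2)[OF z] by blast
  assume "x \<in> range (T (Suc n) ((\<psi> ^^ Suc n) z) o\<^sub>L P0 ((\<psi> ^^ Suc n) z))"
    and "(if z \<in> W then PF_lim z else 0) x = 0"
  then have "x \<in> E_pre (Suc n) z" "x \<in> F z" unfolding E_pre_param(2)[OF z] ker .
  then show "x = 0" using F_C[OF z] E_pre_core[OF z] core_subset[OF z] by blast
qed

lemma QE_lim_measurable: "strongly_measurable M (\<lambda>z. if z \<in> W then QE_lim z else 0)"
  using strongly_measurable_limit[OF QE_measurable QE_tendsto_apply] .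

text \<open>\<open>E z\<close> lies in the core and \<open>F z\<close> avoids the cone, so the index
  lies between \<open>1 / c (\<psi> z)\<close> and 1, and \<open>c\<close> is tempered.\<close>

lemma sep_index_tempered:
  assumes z: "z \<in> W"
  shows "subexponential_along M \<theta> (\<lambda>z. real_of_ereal (sep_index (E z) (F z))) z"
  unfolding subexponential_along_iff
proof (intro allI impI)
  fix \<epsilon> :: real assume "\<epsilon> > 0"
  then obtain B where B: "\<And>j. \<bar>ln (c (\<psi> (orb j z)))\<bar> \<le> \<epsilon> * \<bar>real_of_int j\<bar> + B"
    using subexponential_psi[OF W_space[OF z] c_tempered[OF z]] unfolding subexponential_along_iff by blast
  have "\<bar>ln (real_of_ereal (sep_index (E (orb j z)) (F (orb j z))))\<bar> \<le> \<epsilon> * \<bar>real_of_int j\<bar> + B" for j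
  proof -
    define \<eta> where "\<eta> = orb j z"
    have \<eta>: "\<eta> \<in> W" unfolding \<eta>_def using theta_iter_W[OF z] .
    have cp: "c (\<psi> \<eta>) > 0" using c_pos[OF psi_W[OF \<eta>]] .
    have sep: "norm v \<le> c (\<psi> \<eta>) * norm (v - u)" if "v \<in> E \<eta>" "u \<in> F \<eta>" for v u
      using core_sep[OF \<eta>] E_core[OF \<eta>] F_C[OF \<eta>] that by blast
    have k1: "k \<eta> \<ge> 1" using index W_space[OF \<eta>] unfolding invariant_index_def by blast
    define s where "s = real_of_ereal (sep_index (E \<eta>) (F \<eta>))"
    have s: "1 / c (\<psi> \<eta>) \<le> s" "s \<le> 1"
      unfolding s_def using real_sep_index_bounds[OF sep cp E_dim[OF \<eta>] k1 subspace_0[OF subspace_F]] by blast+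
    have s0: "s > 0" using s(1) cp by (meson divide_pos_pos less_le_trans zero_less_one)
    have "ln (1 / c (\<psi> \<eta>)) \<le> ln s" using s cp s0 by (subst ln_le_cancel_iff) auto
    moreover have "ln s \<le> 0" using s s0 by simp
    ultimately have "\<bar>ln s\<bar> \<le> \<bar>ln (c (\<psi> \<eta>))\<bar>" using cp by (simp add: ln_div)
    then show ?thesis using B[of j] unfolding s_def \<eta>_def by linarith
  qed
  then show "\<exists>B. \<forall>j. \<bar>ln (real_of_ereal (sep_index (E (orb j z)) (F (orb j z))))\<bar> \<le>
      \<epsilon> * \<bar>real_of_int j\<bar> + B" by blast
qed

lemma T_E: "z \<in> W \<Longrightarrow> T n z ` E z = E ((\<theta> ^^ n) z)"
proof (induction n)
  case (Suc n)
  have "T (Suc n) z ` E z = A ((\<theta> ^^ n) z) ` T n z ` E z" by (simp add: image_image)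
  then show ?case using Suc A_E[OF theta_pow_W[OF Suc.prems]] by simp
qed simp

lemma dominated_splitting: "measurably_dominated_splitting M \<theta> A k E F"
  unfolding measurably_dominated_splitting_def
proof (intro conjI index exI ballI allI)
  show "W \<in> sets M" "emeasure M W = emeasure M (space M)" "\<theta> ` W = W" by (fact W_sets W_full W_image)+
  let ?P = "\<lambda>z. if z \<in> W then QE_lim z else 0"
  let ?Q = "\<lambda>z. if z \<in> W then id_blinfun - QE_lim z else 0"
  show "strongly_measurable M ?P" by (rule QE_lim_measurable)
  show "strongly_measurable M ?Q"
    unfolding strongly_measurable_def
  proof
    fix x
    have "(\<lambda>z. ?P z x) \<in> borel_measurable M"
      using QE_lim_measurable unfolding strongly_measurable_def by blast
    then have "(\<lambda>z. if z \<in> W then x - ?P z x else 0) \<in> borel_measurable M"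
      using W_sets by (intro measurable_If_set) auto
    moreover have "(\<lambda>z. ?Q z x) = (\<lambda>z. if z \<in> W then x - ?P z x else 0)" by (auto simp: blinfun.diff_left)
    ultimately show "(\<lambda>z. ?Q z x) \<in> borel_measurable M" by simp
  qed
  show "\<delta> \<in> borel_measurable M" "K \<in> borel_measurable M" by (fact \<delta>_measurable K_measurable)+
  fix z
  show "0 < \<delta> z" "\<delta> (\<theta> z) = \<delta> z" if "z \<in> space M" using \<delta>_invariant[OF that] by auto
  show "1 \<le> K z" by (rule K_ge_1)
  assume z: "z \<in> W"
  show "splitting_with (k z) (E z) (F z) (?P z) (?Q z)" using splitting[OF z] z by simp
  show "A z ` E z = E (\<theta> z)" using A_E[OF z] .
  show "A z ` F z \<subseteq> F (\<theta> z)" using F_inv[OF z] by blast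
  show "subexponential_along M \<theta> (\<lambda>z. real_of_ereal (sep_index (E z) (F z))) z" using sep_index_tempered[OF z] .
  show "subexponential_along M \<theta> K z" using K_tempered[OF z] .
  fix n
  have k1: "k z \<ge> 1" using index W_space[OF z] unfolding invariant_index_def by blast
  have "onorm_on (E ((\<theta> ^^ n) z)) (inv_into (E z) (T n z)) * onorm_on (F z) (T n z) \<le> dom_const n z"
    by (rule onorm_on_inverse_product_le[OF inj_on_T[OF z] T_E[OF z] has_dim_nonzero[OF E_dim[OF z] k1]
        subspace_0[OF has_dim_subspace[OF E_dim[OF z]]] subspace_0[OF subspace_F] dom_const_nonneg[OF z]
        E_F_domination[OF z]])
  then show "onorm_on (E ((\<theta> ^^ n) z)) (inv_into (E z) (T n z)) * onorm_on (F z) (T n z)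
      \<le> K z * exp (- real n * \<delta> z)" using K_ge[OF z, of n] by linarith
qed

end

theorem contracting_imp_dominated:
  fixes A :: "'w \<Rightarrow> 'x::{banach, second_countable_topology} \<Rightarrow>\<^sub>L 'x"
  assumes "linear_rds M \<theta> A" and mc: "measurably_contracting M \<theta> A k C"
  shows "\<exists>E F. measurably_dominated_splitting M \<theta> A k E F"
proof -
  interpret linear_rds M \<theta> A by fact
  have fam: "solid_cone_family M C" and C1: "cone_C1 M \<theta> A k C" and C2: "cone_C2 M k C" and C3: "cone_C3 M \<theta> A C"
    using mc unfolding measurably_contracting_def by auto
  have index: "invariant_index M \<theta> k" using C1 unfolding cone_C1_def by blast
  obtain E0 F0 P0 Q0 where P0: "strongly_measurable M P0" "strongly_measurable M Q0"
    and AE2: "AE z in M. splitting_with (k z) (E0 z) (F0 z) (P0 z) (Q0 z) \<and>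
        E0 z \<subseteq> interior (C z) \<union> {0} \<and> F0 z \<inter> C z = {0}"
    using C2 unfolding cone_C2_def by blast
  obtain c where c: "c \<in> borel_measurable M" "\<And>z. z \<in> space M \<Longrightarrow> 1 \<le> c z"
    and AE3: "AE z in M. subexponential_along M \<theta> c z \<and>
        sep_index (A z ` C z) (- C (\<theta> z)) \<ge> ereal (1 / c z)"
    using C3 unfolding cone_C3_def by blast
  \<comment> \<open>Logarithm of the growth factor of one step; its sums along an orbit are the
    logarithms of the products in \<open>dom_const\<close>.\<close>
  define g where "g z = ln (1 + 1 / (4 * (c z)\<^sup>2))" for z
  note [measurable] = c(1)
  have g_bounds: "0 < g z" "g z \<le> 1" if "z \<in> space M" for z
  proof -
    have c1: "(c z)\<^sup>2 \<ge> 1" using c(2)[OF that] by (simp add: one_le_power)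
    then have pos: "4 * (c z)\<^sup>2 > 0" by linarith
    then have pos': "1 / (4 * (c z)\<^sup>2) > 0" by (rule divide_pos_pos[OF zero_less_one])
    then show "0 < g z" unfolding g_def by (intro ln_gt_zero) linarith
    have "1 / (4 * (c z)\<^sup>2) \<le> 1" using c1 pos by (subst divide_le_eq_1_pos) linarith+
    moreover have "g z \<le> 1 / (4 * (c z)\<^sup>2)" unfolding g_def using pos' by (intro ln_add_one_self_le_self less_imp_le)
    ultimately show "g z \<le> 1" by linarith
  qed
  have "g \<in> borel_measurable M" unfolding g_def by measurable
  then have g_int: "integrable M g"
    using g_bounds by (intro integrable_const_bound[where B = 1]) (auto intro!: AE_I2 simp: abs_of_pos)
  obtain \<delta> where \<delta>: "\<delta> \<in> borel_measurable M" "\<And>z. z \<in> space M \<Longrightarrow> 0 < \<delta> z \<and> \<delta> (\<theta> z) = \<delta> z"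
    "AE z in M. \<forall>\<epsilon>>0. \<exists>B. \<forall>j. \<bar>orbit_sum g z j - 2 * of_int j * \<delta> z\<bar> \<le> \<epsilon> * \<bar>real_of_int j\<bar> + B"
    using two_sided_birkhoff[OF g_int AE_I2[OF g_bounds(1)]] by blast
  \<comment> \<open>Gathered into one predicate, so that a single invariant set of full measure
    serves all conditions.\<close>
  let ?good = "\<lambda>z. inj (A z) \<and> k_cone (k z) (C z) \<and> A z ` C z \<subseteq> C (\<theta> z) \<and>
    splitting_with (k z) (E0 z) (F0 z) (P0 z) (Q0 z) \<and> E0 z \<subseteq> interior (C z) \<union> {0} \<and> F0 z \<inter> C z = {0} \<and>
    subexponential_along M \<theta> c z \<and> sep_index (A z ` C z) (- C (\<theta> z)) \<ge> ereal (1 / c z) \<and>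
    (\<forall>\<epsilon>>0. \<exists>B. \<forall>j. \<bar>orbit_sum g z j - 2 * of_int j * \<delta> z\<bar> \<le> \<epsilon> * \<bar>real_of_int j\<bar> + B)"
  have AE1: "AE z in M. k_cone (k z) (C z) \<and> solid (C z) \<and> A z ` C z \<subseteq> C (\<theta> z)"
    using C1 unfolding cone_C1_def by blast
  have "AE z in M. ?good z" using A_inj AE1 AE2 AE3 \<delta>(3) by eventually_elim (elim conjE, intro conjI)
  then obtain W where W: "W \<in> sets M" "emeasure M W = emeasure M (space M)" "\<theta> ` W = W" "\<psi> ` W = W"
    and good: "\<And>z. z \<in> W \<Longrightarrow> ?good z" using invariant_full_set by blast
  have Ws: "z \<in> space M" if "z \<in> W" for z using that W(1) sets.sets_into_space by blast
  have thW: "\<theta> z \<in> W" "\<psi> z \<in> W" if "z \<in> W" for z using that W(3,4) by blast+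
  have scale: "l *\<^sub>R v \<in> C z" if "z \<in> W" "v \<in> C z" for z v l
  proof -
    have "\<forall>v\<in>C z. \<forall>l::real. l *\<^sub>R v \<in> C z" using good[OF that(1)] unfolding k_cone_def by (elim conjE)
    then show ?thesis using that(2) by blast
  qed
  have "contracting_rds M \<theta> A W \<delta> k C E0 F0 c P0 Q0"
  proof unfold_locales
    show "W \<in> sets M" "emeasure M W = emeasure M (space M)" "\<theta> ` W = W" by (fact W)+
    show "invariant_index M \<theta> k" "c \<in> borel_measurable M" "strongly_measurable M P0" "\<delta> \<in> borel_measurable M"
      by (fact index c(1) P0(1) \<delta>(1))+
    fix z
    show "0 < \<delta> z \<and> \<delta> (\<theta> z) = \<delta> z" if "z \<in> space M" using \<delta>(2)[OF that] .
    assume z: "z \<in> W"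
    note G = good[OF z]
    show "\<theta> z \<in> W" "\<psi> z \<in> W" using thW[OF z] by auto
    show "\<theta> (\<psi> z) = z" "\<psi> (\<theta> z) = z" using dyn.theta_psi dyn.psi_theta Ws[OF z] by auto
    have "inj (A z)" using G by (elim conjE)
    then show "v = 0" if "A z v = 0" for v
      using that injD[of "A z" v 0] by (metis blinfun.zero_right)
    show "k (\<theta> z) = k z" using index Ws[OF z] unfolding invariant_index_def by blast
    show "closed (C z)" using G unfolding k_cone_def by (elim conjE)
    show "l *\<^sub>R v \<in> C z" if "v \<in> C z" for v l using scale[OF z that] .
    have "A z ` C z \<subseteq> C (\<theta> z)" using G by (elim conjE)
    then show "A z v \<in> C (\<theta> z)" if "v \<in> C z" for v using that by blast
    show "has_dim (E0 z) (k z)" using G unfolding splitting_with_def by (elim conjE)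
    show "has_codim (F0 z) (k z)" using G unfolding splitting_with_def by (elim conjE)
    show F0: "F0 z \<inter> C z = {0}" using G by (elim conjE)
    have "E0 z \<subseteq> interior (C z) \<union> {0}" using G by (elim conjE)
    then show "E0 z \<subseteq> C z" using F0 interior_subset by blast
    show "1 \<le> c z" using c(2)[OF Ws[OF z]] .
    show "subexponential_along M \<theta> c z" using G by (elim conjE)
    show "splitting_with (k z) (E0 z) (F0 z) (P0 z) (Q0 z)" using G by (elim conjE)
    show "\<exists>B. \<forall>j. \<bar>orbit_sum (\<lambda>z. ln (1 + 1 / (4 * (c z)\<^sup>2))) z j - 2 * of_int j * \<delta> z\<bar> \<le> \<epsilon> * \<bar>real_of_int j\<bar> + B"
      if "\<epsilon> > 0" for \<epsilon> using G that unfolding g_def by blast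
    show "norm (A z v) \<le> c z * norm (A z v - u)" if v: "v \<in> C z" and u: "u \<notin> C (\<theta> z)" for v u
    proof (cases "A z v = 0")
      case True
      then show ?thesis using c(2)[OF Ws[OF z]] by simp
    next
      case False
      have sep: "sep_index (A z ` C z) (- C (\<theta> z)) \<ge> ereal (1 / c z)" using G by (elim conjE)
      \<comment> \<open>C3 speaks of unit vectors; dividing \<open>v\<close> and \<open>u\<close> by
        \<open>r\<close> leaves each on its side of the cone.\<close>
      define r where "r = norm (A z v)"
      have r: "r > 0" using False unfolding r_def by simp
      have 1: "A z ((1 / r) *\<^sub>R v) \<in> A z ` C z" using scale[OF z v] by blast
      have 2: "norm (A z ((1 / r) *\<^sub>R v)) = 1" using r by (simp add: blinfun.scaleR_right r_def)
      have 3: "(1 / r) *\<^sub>R u \<in> - C (\<theta> z)"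
        using u scale[OF thW(1)[OF z], of "(1 / r) *\<^sub>R u" r] r by auto
      have "1 / c z \<le> norm (A z ((1 / r) *\<^sub>R v) - (1 / r) *\<^sub>R u)"
        using sep_index_le[OF sep 1 2 3] .
      also have "\<dots> = norm (A z v - u) / r"
        using r by (simp add: blinfun.scaleR_right scaleR_diff_right[symmetric])
      finally show ?thesis using r c(2)[OF Ws[OF z]] by (simp add: field_simps r_def)
    qed
  qed
  then show ?thesis using contracting_rds.dominated_splitting by blast
qed

section \<open>From a dominated splitting to contracting cones\<close>

text \<open>Lift a basis of the image back to \<open>E\<close>; the lifted vectors span a space of
  dimension \<open>k\<close>, hence all of \<open>E\<close>. This gives injectivity of
  \<open>T n z\<close> on \<open>E z\<close> at every point of the invariant set of the splitting,
  where \<open>A z\<close> is known to be injective only almost everywhere.\<close>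

lemma linear_inj_on_of_has_dim:
  assumes f: "linear f" and E: "has_dim E k" and fE: "has_dim (f ` E) k"
  shows "inj_on f E"
proof -
  obtain B where B: "finite B" "independent B" "card B = k" "span B = f ` E"
    using fE unfolding has_dim_def by blast
  have "\<forall>b\<in>B. \<exists>e\<in>E. f e = b" using B(4) span_superset[of B] by force
  then obtain q where q: "\<And>b. b \<in> B \<Longrightarrow> q b \<in> E \<and> f (q b) = b" by metis
  obtain g where g: "linear g" "\<And>b. b \<in> B \<Longrightarrow> g b = q b"
    using linear_independent_extend[OF B(2), of q] by blast
  have "linear (\<lambda>y. f (g y))" using linear_compose[OF g(1) f] by (simp add: o_def)
  then have fg: "f (g y) = y" if "y \<in> span B" for y
    using linear_eq_on[OF _ linear_id[unfolded id_def], of "\<lambda>y. f (g y)" y B] that g(2) q by simp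
  have "g ` span B = span (g ` B)" using linear_span_image[OF g(1)] by metis
  also have "\<dots> \<subseteq> E" using g(2) q has_dim_subspace[OF E] by (intro span_minimal) auto
  finally have sub: "g ` span B \<subseteq> E" .
  have "inj_on g (span B)" using fg by (rule inj_on_inverseI)
  then have "has_dim (g ` span B) k"
    using has_dim_image[OF g(1), of "span B" k] B unfolding has_dim_def by blast
  then have "g ` span B = E" using has_dim_subset_eq[OF _ E sub] by blast
  then show ?thesis using fg by (intro inj_onI) force
qed

lemma has_dim_1_multiple:
  assumes "has_dim E 1" "v \<in> E" "v \<noteq> 0" "u \<in> E"
  obtains a where "u = a *\<^sub>R v"
proof -
  obtain B where B: "finite B" "independent B" "card B = 1" "span B = E"
    using assms(1) unfolding has_dim_def by blast
  then obtain b where "B = {b}" using card_1_singletonE by metis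
  then obtain s t where "v = s *\<^sub>R b" "u = t *\<^sub>R b" using B(4) assms(2,4) by (auto simp: span_singleton)
  then have "u = (t / s) *\<^sub>R v" using assms(3) by auto
  then show ?thesis using that by blast
qed

locale dominated_rds = rds_domain M \<theta> A W \<delta>
  for M :: "'w measure" and \<theta> :: "'w \<Rightarrow> 'w"
    and A :: "'w \<Rightarrow> 'x::{banach, second_countable_topology} \<Rightarrow>\<^sub>L 'x"
    and W :: "'w set" and \<delta> :: "'w \<Rightarrow> real" +
  fixes k :: "'w \<Rightarrow> nat" and E F :: "'w \<Rightarrow> 'x set" and P Q :: "'w \<Rightarrow> 'x \<Rightarrow>\<^sub>L 'x" and K :: "'w \<Rightarrow> real"
  assumes index: "invariant_index M \<theta> k"
    and splitting: "z \<in> W \<Longrightarrow> splitting_with (k z) (E z) (F z) (P z) (Q z)"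
    and A_E: "z \<in> W \<Longrightarrow> blinfun_apply (A z) ` E z = E (\<theta> z)"
    and A_F: "z \<in> W \<Longrightarrow> blinfun_apply (A z) ` F z \<subseteq> F (\<theta> z)"
    and P_measurable: "strongly_measurable M P" and Q_measurable: "strongly_measurable M Q"
    and sep_tempered: "z \<in> W \<Longrightarrow> subexponential_along M \<theta> (\<lambda>z. real_of_ereal (sep_index (E z) (F z))) z"
    and K_measurable: "K \<in> borel_measurable M" and K_ge_1: "z \<in> space M \<Longrightarrow> 1 \<le> K z"
    and K_tempered: "z \<in> W \<Longrightarrow> subexponential_along M \<theta> K z"
    and onorm_domination: "z \<in> W \<Longrightarrow>
      onorm_on (E ((\<theta> ^^ n) z)) (inv_into (E z) (blinfun_apply (cocycle \<theta> A n z))) *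
      onorm_on (F z) (blinfun_apply (cocycle \<theta> A n z)) \<le> K z * exp (- real n * \<delta> z)"
begin

abbreviation "T \<equiv> cocycle \<theta> A"

lemma k_theta_pow: "z \<in> W \<Longrightarrow> k ((\<theta> ^^ n) z) = k z"
  using index theta_pow_W W_space unfolding invariant_index_def by (induction n) auto

lemma linear_T: "linear (blinfun_apply (T n z))"
  using blinfun.bounded_linear_right bounded_linear.linear by blast

lemma E_dim: "z \<in> W \<Longrightarrow> has_dim (E z) (k z)"
  using splitting unfolding splitting_with_def by blast

lemma F_codim: "z \<in> W \<Longrightarrow> has_codim (F z) (k z)"
  using splitting unfolding splitting_with_def by blast

lemma E_F: "z \<in> W \<Longrightarrow> E z \<inter> F z = {0}"
  using splitting unfolding splitting_with_def by blast

lemma PQ: "z \<in> W \<Longrightarrow> P z x \<in> E z" "z \<in> W \<Longrightarrow> Q z x \<in> F z" "z \<in> W \<Longrightarrow> P z x + Q z x = x"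
  using splitting unfolding splitting_with_def by blast+

lemma P_eqI: "z \<in> W \<Longrightarrow> e \<in> E z \<Longrightarrow> x - e \<in> F z \<Longrightarrow> P z x = e"
  using is_projection_unique[of "E z" "F z" "P z" e x] PQ splitting_with_projection[OF splitting] E_F
  unfolding is_projection_def by metis

lemma T_E: "z \<in> W \<Longrightarrow> T n z ` E z = E ((\<theta> ^^ n) z)"
proof (induction n)
  case (Suc n)
  have "T (Suc n) z ` E z = A ((\<theta> ^^ n) z) ` T n z ` E z" by (simp add: image_image)
  then show ?case using Suc A_E[OF theta_pow_W[OF Suc.prems]] by simp
qed simp

lemma inj_on_T: "z \<in> W \<Longrightarrow> inj_on (T n z) (E z)"
  using linear_inj_on_of_has_dim[OF linear_T E_dim] T_E E_dim[OF theta_pow_W] k_theta_pow by metis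

lemma zero_E_F: "z \<in> W \<Longrightarrow> 0 \<in> E z" "z \<in> W \<Longrightarrow> 0 \<in> F z"
  using E_F by blast+

lemma T_E_nonzero: "z \<in> W \<Longrightarrow> v \<in> E z \<Longrightarrow> v \<noteq> 0 \<Longrightarrow> T n z v \<noteq> 0"
  using inj_onD[OF inj_on_T _ _ zero_E_F(1)] by (metis blinfun.zero_right)

text \<open>Passing from the suprema back to vectors requires both to be taken over bounded sets: on
  \<open>F z\<close> the norm of \<open>T n z\<close> is a bound, and for the inverse finite
  dimension of \<open>E z\<close> provides one.\<close>

lemma domination:
  assumes z: "z \<in> W" and v: "v \<in> E z" and w: "w \<in> F z"
  shows "exp (real n * \<delta> z) * norm (T n z w) * norm v \<le> K z * norm w * norm (T n z v)"
proof (cases "v = 0 \<or> w = 0")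
  case True
  then show ?thesis using K_ge_1[OF W_space[OF z]] by (auto simp: blinfun.zero_right)
next
  case False
  have ker: "x = 0" if "x \<in> E z" "T n z x = 0" for x using T_E_nonzero[OF z] that by blast
  obtain c where c: "\<And>x. x \<in> E z \<Longrightarrow> norm x \<le> c * norm (T n z x)"
    using has_dim_bounded_below[OF E_dim[OF z] linear_T ker] by metis
  have Tv: "norm (T n z v) > 0" using T_E_nonzero[OF z v] False by simp
  let ?I = "inv_into (E z) (T n z)"
  have I: "?I (T n z x) = x" if "x \<in> E z" for x using inv_into_f_f[OF inj_on_T[OF z] that] .
  have "bdd_above ((\<lambda>x. norm (?I x) / norm x) ` E ((\<theta> ^^ n) z))"
  proof (rule bdd_aboveI2)
    fix y assume "y \<in> E ((\<theta> ^^ n) z)"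
    then obtain x where x: "x \<in> E z" "y = T n z x" using T_E[OF z] by blast
    show "norm (?I y) / norm y \<le> max c 0"
    proof (cases "y = 0")
      case False
      have "norm x \<le> max c 0 * norm (T n z x)"
        using c[OF x(1)] mult_right_mono[of c "max c 0" "norm (T n z x)"] by simp
      then show ?thesis using False I[OF x(1)] x(2) by (simp add: divide_le_eq)
    qed simp
  qed
  then have 1: "norm v / norm (T n z v) \<le> onorm_on (E ((\<theta> ^^ n) z)) ?I"
    unfolding onorm_on_def using cSUP_upper[of "T n z v" "E ((\<theta> ^^ n) z)" "\<lambda>x. norm (?I x) / norm x"]
      I[OF v] T_E[OF z] v by auto
  have "bdd_above ((\<lambda>x. norm (T n z x) / norm x) ` F z)"
  proof (rule bdd_aboveI2)
    fix x
    show "norm (T n z x) / norm x \<le> norm (T n z)"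
      using norm_blinfun[of "T n z" x] by (cases "x = 0") (auto simp: field_simps)
  qed
  then have 2: "norm (T n z w) / norm w \<le> onorm_on (F z) (T n z)"
    unfolding onorm_on_def using w cSUP_upper[of w "F z" "\<lambda>x. norm (T n z x) / norm x"] by blast
  have "(norm v / norm (T n z v)) * (norm (T n z w) / norm w) \<le>
      onorm_on (E ((\<theta> ^^ n) z)) ?I * onorm_on (F z) (T n z)"
    using order_trans[OF _ 1] by (intro mult_mono 1 2) auto
  also have "\<dots> \<le> K z * exp (- real n * \<delta> z)" by (rule onorm_domination[OF z])
  finally show ?thesis using False Tv by (simp add: exp_minus field_simps)
qed

lemma P_A:
  assumes z: "z \<in> W" shows "P (\<theta> z) (A z x) = A z (P z x)"
proof (rule P_eqI[OF theta_W[OF z]])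
  show "A z (P z x) \<in> E (\<theta> z)" using A_E[OF z] PQ(1)[OF z] by blast
  have "A z x - A z (P z x) = A z (Q z x)"
    using PQ(3)[OF z, of x] by (metis add_diff_cancel_left' blinfun.diff_right)
  then show "A z x - A z (P z x) \<in> F (\<theta> z)" using A_F[OF z] PQ(2)[OF z] by auto
qed

lemma Q_eq: "z \<in> W \<Longrightarrow> Q z x = x - P z x"
  using PQ(3) by (metis add_diff_cancel_left')

lemma Q_A: "z \<in> W \<Longrightarrow> Q (\<theta> z) (A z x) = A z (Q z x)"
  using P_A Q_eq theta_W by (simp add: blinfun.diff_right)

text \<open>Imposing the condition for all \<open>n\<close> acts like an adapted norm: no constant
  is lost under \<open>A\<close>. The parameter \<open>s\<close> measures the opening;
  \<open>s = 1\<close> will be the cone itself.\<close>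

definition narrow_cone :: "real \<Rightarrow> 'w \<Rightarrow> 'x set" where
  "narrow_cone s z = {x. \<forall>n. exp (real n * \<delta> z) * norm (T n z (Q z x)) \<le> s * norm (T n z (P z x))}"

text \<open>The value off \<open>W\<close> keeps the family closed, homogeneous and solid at every
  point of the space.\<close>

definition cone :: "'w \<Rightarrow> 'x set" where
  "cone z = (if z \<in> W then narrow_cone 1 z else UNIV)"

lemma closed_cone: "closed (cone z)"
proof -
  have "narrow_cone 1 z = (\<Inter>n. {x. exp (real n * \<delta> z) * norm (T n z (Q z x)) \<le> 1 * norm (T n z (P z x))})"
    unfolding narrow_cone_def by auto
  also have "closed \<dots>" by (intro closed_INT ballI closed_Collect_le continuous_intros)
  finally show ?thesis unfolding cone_def by simp
qed

lemma narrow_cone_scale: "x \<in> narrow_cone s z \<Longrightarrow> l *\<^sub>R x \<in> narrow_cone s z"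
proof -
  assume x: "x \<in> narrow_cone s z"
  have "exp (real n * \<delta> z) * (\<bar>l\<bar> * norm (T n z (Q z x))) \<le> s * (\<bar>l\<bar> * norm (T n z (P z x)))" for n
    using mult_left_mono[of _ _ "\<bar>l\<bar>"] x unfolding narrow_cone_def by (fastforce simp: mult.left_commute)
  then show ?thesis unfolding narrow_cone_def by (simp add: blinfun.scaleR_right)
qed

lemma cone_scale: "x \<in> cone z \<Longrightarrow> l *\<^sub>R x \<in> cone z"
  unfolding cone_def using narrow_cone_scale by (cases "z \<in> W") auto

lemma E_narrow_cone: "z \<in> W \<Longrightarrow> E z \<subseteq> narrow_cone 0 z"
  using P_eqI Q_eq zero_E_F(2) unfolding narrow_cone_def by (auto simp: blinfun.zero_right)

lemma narrow_cone_mono: "s \<le> t \<Longrightarrow> narrow_cone s z \<subseteq> narrow_cone t z"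
  unfolding narrow_cone_def using mult_right_mono[OF _ norm_ge_zero] order_trans by blast

lemma F_cone:
  assumes z: "z \<in> W" shows "F z \<inter> cone z = {0}"
proof -
  have "x = 0" if "x \<in> F z" "x \<in> narrow_cone 1 z" for x
  proof -
    have Px: "P z x = 0" using P_eqI[OF z zero_E_F(1)[OF z]] that(1) by simp
    have "exp (real 0 * \<delta> z) * norm (T 0 z (Q z x)) \<le> 1 * norm (T 0 z (P z x))"
      using that(2) unfolding narrow_cone_def by blast
    then show ?thesis using Px Q_eq[OF z] by simp
  qed
  moreover have "0 \<in> narrow_cone 1 z" unfolding narrow_cone_def by (simp add: blinfun.zero_right)
  ultimately show ?thesis unfolding cone_def using z zero_E_F(2)[OF z] by auto
qed

text \<open>\<open>A\<close> intertwines the projections, so the condition with index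
  \<open>n\<close> at the image is the one with index \<open>Suc n\<close> at \<open>z\<close>,
  which is stronger by the factor \<open>exp (\<delta> z)\<close>.\<close>

lemma A_narrow_cone:
  assumes z: "z \<in> W" and x: "x \<in> narrow_cone s z"
  shows "A z x \<in> narrow_cone (exp (- \<delta> z) * s) (\<theta> z)"
  unfolding narrow_cone_def
proof (intro CollectI allI)
  fix n
  have \<delta>: "\<delta> (\<theta> z) = \<delta> z" using \<delta>_invariant W_space[OF z] by blast
  have sh: "T n (\<theta> z) (A z y) = T (Suc n) z y" for y
    using cocycle_add[of \<theta> A n 1 z] by simp
  have "exp (real (Suc n) * \<delta> z) * norm (T (Suc n) z (Q z x)) \<le> s * norm (T (Suc n) z (P z x))"
    using x unfolding narrow_cone_def by blast
  then have "exp (- \<delta> z) * (exp (real (Suc n) * \<delta> z) * norm (T (Suc n) z (Q z x))) \<le>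
      exp (- \<delta> z) * (s * norm (T (Suc n) z (P z x)))" by (intro mult_left_mono) auto
  moreover have "exp (- \<delta> z) * exp (real (Suc n) * \<delta> z) = exp (real n * \<delta> z)"
    by (simp add: exp_add[symmetric] algebra_simps)
  ultimately show "exp (real n * \<delta> (\<theta> z)) * norm (T n (\<theta> z) (Q (\<theta> z) (A z x))) \<le>
      exp (- \<delta> z) * s * norm (T n (\<theta> z) (P (\<theta> z) (A z x)))"
    unfolding \<delta> Q_A[OF z] P_A[OF z] sh by (metis mult.assoc)
qed

lemma T_narrow_cone:
  "z \<in> W \<Longrightarrow> x \<in> narrow_cone s z \<Longrightarrow> T m z x \<in> narrow_cone (exp (- real m * \<delta> z) * s) ((\<theta> ^^ m) z)"
proof (induction m)
  case (Suc m)
  have "A ((\<theta> ^^ m) z) (T m z x) \<in>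
      narrow_cone (exp (- \<delta> ((\<theta> ^^ m) z)) * (exp (- real m * \<delta> z) * s)) (\<theta> ((\<theta> ^^ m) z))"
    using A_narrow_cone[OF theta_pow_W] Suc by blast
  moreover have "exp (- \<delta> ((\<theta> ^^ m) z)) * (exp (- real m * \<delta> z) * s) = exp (- real (Suc m) * \<delta> z) * s"
    unfolding \<delta>_theta_pow[OF Suc.prems(1)] mult.assoc[symmetric] exp_add[symmetric] by (simp add: algebra_simps)
  ultimately have "A ((\<theta> ^^ m) z) (T m z x) \<in> narrow_cone (exp (- real (Suc m) * \<delta> z) * s) (\<theta> ((\<theta> ^^ m) z))"
    by metis
  then show ?case by (simp del: of_nat_Suc)
qed simp

section \<open>Distance of narrow cones from the complement of the cone\<close>

definition "pnorm z = 1 + norm (P z) + norm (Q z)"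

lemma pnorm_ge_1: "pnorm z \<ge> 1"
  unfolding pnorm_def by simp

lemma pnorm_bound: "norm (P z x) \<le> pnorm z * norm x" "norm (Q z x) \<le> pnorm z * norm x"
proof -
  have "norm (P z) * norm x \<le> pnorm z * norm x" "norm (Q z) * norm x \<le> pnorm z * norm x"
    unfolding pnorm_def by (intro mult_right_mono, auto)+
  then show "norm (P z x) \<le> pnorm z * norm x" "norm (Q z x) \<le> pnorm z * norm x"
    using norm_blinfun[of "P z" x] norm_blinfun[of "Q z" x] by linarith+
qed

lemma narrow_cone_0: "x \<in> narrow_cone s z \<Longrightarrow> norm (Q z x) \<le> s * norm (P z x)"
  unfolding narrow_cone_def by (auto dest: spec[of _ 0])

text \<open>One inequality at time 0 with the factor \<open>K z\<close> to spare implies those at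
  all times, by domination. All estimates from the interior of the cone in arbitrary dimension go
  through this criterion.\<close>

lemma cone_contains:
  assumes z: "z \<in> W" and u: "K z * norm (Q z u) \<le> norm (P z u)"
  shows "u \<in> cone z"
proof -
  have "exp (real n * \<delta> z) * norm (T n z (Q z u)) \<le> 1 * norm (T n z (P z u))" for n
  proof (cases "P z u = 0")
    case True
    then have "norm (Q z u) \<le> 0"
      using u K_ge_1[OF W_space[OF z]] mult_right_mono[of 1 "K z" "norm (Q z u)"] by (simp del: norm_le_zero_iff)
    then show ?thesis by (simp add: blinfun.zero_right)
  next
    case False
    have "exp (real n * \<delta> z) * norm (T n z (Q z u)) * norm (P z u) \<le> K z * norm (Q z u) * norm (T n z (P z u))"
      using domination[OF z PQ(1)[OF z] PQ(2)[OF z]] .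
    also have "\<dots> \<le> norm (P z u) * norm (T n z (P z u))" using u by (intro mult_right_mono) auto
    finally show ?thesis using False by (simp add: mult.commute)
  qed
  then show ?thesis unfolding cone_def narrow_cone_def using z by simp
qed

lemma narrow_cone_norm:
  assumes z: "z \<in> W" and y: "y \<in> narrow_cone s z" and s: "s \<le> 1"
  shows "norm y \<le> 2 * norm (P z y)"
proof -
  have "norm y \<le> norm (P z y) + norm (Q z y)" using PQ(3)[OF z, of y] norm_triangle_ineq by metis
  moreover have "norm (Q z y) \<le> 1 * norm (P z y)"
    using narrow_cone_0[OF y] mult_right_mono[OF s norm_ge_zero] order_trans by blast
  ultimately show ?thesis by simp
qed

text \<open>Let \<open>p = norm (P z y)\<close>, so \<open>norm y \<le> 2 * p\<close>. If the claim
  failed, \<open>K z * pnorm z * d\<close> would be below \<open>p / 4\<close>; then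
  \<open>K z * norm (Q z u)\<close> is at most \<open>p / 2 + p / 4\<close> while
  \<open>norm (P z u)\<close> stays above three quarters of \<open>p\<close>, and
  \<open>cone_contains\<close> applies to \<open>u\<close>.\<close>

lemma narrow_cone_separated:
  assumes z: "z \<in> W" and y: "y \<in> narrow_cone s z" and s: "s \<le> 1" "K z * s \<le> 1 / 2" and u: "u \<notin> cone z"
  shows "norm y \<le> 8 * pnorm z * K z * norm (y - u)"
proof (rule ccontr)
  assume neg: "\<not> ?thesis"
  define p where "p = norm (P z y)"
  define d where "d = norm (y - u)"
  have K: "K z \<ge> 1" using K_ge_1[OF W_space[OF z]] .
  have "8 * pnorm z * K z * d < 2 * p"
    using neg narrow_cone_norm[OF z y s(1)] unfolding d_def p_def by linarith
  then have 1: "K z * (pnorm z * d) < p / 4" by (simp add: mult_ac)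
  have "1 * (pnorm z * d) \<le> K z * (pnorm z * d)"
    using K pnorm_ge_1[of z] unfolding d_def by (intro mult_right_mono mult_nonneg_nonneg) auto
  then have 2: "pnorm z * d < p / 4" using 1 by linarith
  have P: "norm (P z u) \<ge> p - pnorm z * d"
  proof -
    have "p \<le> norm (P z u) + norm (P z (y - u))"
      unfolding p_def using norm_triangle_ineq[of "P z u" "P z (y - u)"] by (simp add: blinfun.diff_right)
    then show ?thesis using pnorm_bound(1)[of z "y - u"] unfolding d_def by linarith
  qed
  have "norm (Q z u) \<le> norm (Q z y) + norm (Q z (y - u))"
    using norm_triangle_ineq4[of "Q z y" "Q z (y - u)"] by (simp add: blinfun.diff_right)
  then have "norm (Q z u) \<le> s * p + pnorm z * d"
    using narrow_cone_0[OF y] pnorm_bound(2)[of z "y - u"] unfolding d_def p_def by linarith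
  then have "K z * norm (Q z u) \<le> K z * (s * p + pnorm z * d)" using K by (intro mult_left_mono) auto
  also have "\<dots> = (K z * s) * p + K z * (pnorm z * d)" by (simp add: algebra_simps)
  also have "\<dots> \<le> 1 / 2 * p + p / 4" using s(2) 1 unfolding p_def by (intro add_mono mult_right_mono) auto
  also have "\<dots> \<le> norm (P z u)" using P 2 by linarith
  finally show False using cone_contains[OF z] u by blast
qed

text \<open>\<open>E z\<close> lies in the narrow cone with \<open>s = 0\<close>, which satisfies
  \<open>K z * s \<le> 1 / 2\<close> for every \<open>K z\<close>.\<close>

lemma E_interior_cone:
  assumes z: "z \<in> W" and e: "e \<in> E z" "e \<noteq> 0"
  shows "e \<in> interior (cone z)"
proof -
  define c where "c = 8 * pnorm z * K z"
  have c: "c > 0" unfolding c_def using pnorm_ge_1[of z] K_ge_1[OF W_space[OF z]] by simp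
  have "ball e (norm e / c) \<subseteq> cone z"
  proof (rule subsetI, rule ccontr)
    fix u assume u: "u \<in> ball e (norm e / c)" "u \<notin> cone z"
    have "norm e \<le> c * norm (e - u)"
      unfolding c_def using E_narrow_cone[OF z] e(1) u(2) by (intro narrow_cone_separated[OF z, of _ 0]) auto
    then show False using u(1) c by (simp add: dist_norm field_simps)
  qed
  moreover have "norm e / c > 0" using e(2) c by simp
  ultimately show ?thesis by (meson centre_in_ball interior_maximal open_ball subsetD)
qed

lemma k_ge_1: "z \<in> W \<Longrightarrow> k z \<ge> 1"
  using index W_space unfolding invariant_index_def by blast

lemma solid_cone: "solid (cone z)"
proof (cases "z \<in> W")
  case True
  then show ?thesis
    using has_dim_nonzero[OF E_dim[OF True] k_ge_1[OF True]] E_interior_cone[OF True] unfolding solid_def by blast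
qed (simp add: cone_def solid_def)

lemma A_cone: "z \<in> W \<Longrightarrow> x \<in> cone z \<Longrightarrow> A z x \<in> cone (\<theta> z)"
proof -
  assume z: "z \<in> W" and x: "x \<in> cone z"
  have "exp (- \<delta> z) * 1 \<le> 1" using \<delta>_invariant[OF W_space[OF z]] by simp
  then show ?thesis
    using A_narrow_cone[OF z, of x 1] x narrow_cone_mono[of "exp (- \<delta> z) * 1" 1 "\<theta> z"] z theta_W[OF z]
    unfolding cone_def by auto
qed

lemma cone_family: "solid_cone_family M cone"
  unfolding solid_cone_family_def using closed_cone cone_scale solid_cone by blast

lemma E_cone: "z \<in> W \<Longrightarrow> E z \<subseteq> interior (cone z) \<union> {0}"
  using E_interior_cone by blast

lemma cone_C1: "cone_C1 M \<theta> A k cone"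
  unfolding cone_C1_def
proof (intro conjI index)
  show "AE z in M. k_cone (k z) (cone z) \<and> solid (cone z) \<and> A z ` cone z \<subseteq> cone (\<theta> z)"
    using AE_W
  proof eventually_elim
    case (elim z)
    have "E z \<subseteq> cone z" using E_narrow_cone[OF elim] narrow_cone_mono[of 0 1 z] elim unfolding cone_def by auto
    then have "k_cone (k z) (cone z)"
      unfolding k_cone_def using closed_cone cone_scale E_dim[OF elim] F_codim[OF elim] F_cone[OF elim] by blast
    then show ?case using solid_cone A_cone[OF elim] by blast
  qed
qed

lemma cone_C2: "cone_C2 M k cone"
  unfolding cone_C2_def
proof (intro exI conjI)
  show "strongly_measurable M P" "strongly_measurable M Q" by (fact P_measurable Q_measurable)+
  show "AE z in M. splitting_with (k z) (E z) (F z) (P z) (Q z) \<and>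
      E z \<subseteq> interior (cone z) \<union> {0} \<and> F z \<inter> cone z = {0}"
    using AE_W by eventually_elim (intro conjI splitting E_cone F_cone)
qed

text \<open>Translates temperedness of the separation index into that of the projection norms. With
  \<open>s\<close> the index, normalizing \<open>P z x\<close> gives
  \<open>norm (P z) \<le> 1 / s\<close>; then \<open>norm (Q z) \<le> 1 + 1 / s\<close>, and
  \<open>s \<le> 1\<close> collects everything into \<open>4 / s\<close>.\<close>

lemma pnorm_sep:
  assumes z: "z \<in> W"
  shows "ln (pnorm z) \<le> ln 4 + \<bar>ln (real_of_ereal (sep_index (E z) (F z)))\<bar>"
proof -
  define s where "s = real_of_ereal (sep_index (E z) (F z))"
  define c where "c = 1 + norm (P z)"
  have c: "c > 0" unfolding c_def by (simp add: add_pos_nonneg)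
  have sep: "norm v \<le> c * norm (v - u)" if "v \<in> E z" "u \<in> F z" for v u
  proof -
    have "P z (v - u) = v"
      using P_eqI[OF z that(1)] subspace_neg[OF splitting_with_projection(5)[OF splitting[OF z]] that(2)] by simp
    then have "norm v \<le> norm (P z) * norm (v - u)" using norm_blinfun[of "P z" "v - u"] by simp
    also have "\<dots> \<le> c * norm (v - u)" unfolding c_def by (intro mult_right_mono) auto
    finally show ?thesis .
  qed
  note b = real_sep_index_bounds[OF sep c E_dim[OF z] k_ge_1[OF z] zero_E_F(2)[OF z], folded s_def]
  have s: "s > 0" "s \<le> 1" using b(1,2) c by (auto intro: less_le_trans[of 0 "1 / c"])
  have Px: "s * norm (P z x) \<le> norm x" for x
  proof (cases "P z x = 0")
    case False
    define r where "r = norm (P z x)"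
    have r: "r > 0" using False unfolding r_def by simp
    have "s \<le> norm ((1 / r) *\<^sub>R P z x - (- (1 / r)) *\<^sub>R Q z x)"
    proof (rule sep_index_le)
      show "ereal s \<le> sep_index (E z) (F z)" using b(3) by simp
      show "(1 / r) *\<^sub>R P z x \<in> E z" "(- (1 / r)) *\<^sub>R Q z x \<in> F z"
        using subspace_scale PQ[OF z] splitting_with_projection(4,5)[OF splitting[OF z]] by blast+
      show "norm ((1 / r) *\<^sub>R P z x) = 1" using r by (simp add: r_def)
    qed
    also have "(1 / r) *\<^sub>R P z x - (- (1 / r)) *\<^sub>R Q z x = (1 / r) *\<^sub>R (P z x + Q z x)"
      by (simp add: scaleR_add_right)
    also have "norm \<dots> = norm x / r" unfolding PQ(3)[OF z] using r by simp
    finally show ?thesis using r unfolding r_def by (simp add: field_simps)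
  qed simp
  have nP: "norm (P z) \<le> 1 / s"
    by (rule norm_blinfun_bound) (use s Px in \<open>auto simp: field_simps\<close>)
  have nQ: "norm (Q z) \<le> 1 + norm (P z)"
  proof (rule norm_blinfun_bound)
    fix x
    have "norm (Q z x) \<le> norm x + norm (P z x)" unfolding Q_eq[OF z] by (rule norm_triangle_ineq4)
    then show "norm (Q z x) \<le> (1 + norm (P z)) * norm x"
      using norm_blinfun[of "P z" x] by (simp add: algebra_simps)
  qed simp
  have "1 \<le> 1 / s" using s by simp
  then have "pnorm z \<le> 4 / s" unfolding pnorm_def using nP nQ by linarith
  then have "ln (pnorm z) \<le> ln (4 / s)" using pnorm_ge_1[of z] s by (subst ln_le_cancel_iff) auto
  also have "\<dots> = ln 4 - ln s" using s by (simp add: ln_div)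
  finally show ?thesis unfolding s_def[symmetric] by linarith
qed

lemma tempered_bound:
  assumes z: "z \<in> W"
    and h: "\<And>j. 1 \<le> h (orb j z)"
      "\<And>j. ln (h (orb j z)) \<le> B0 + ln (pnorm (orb j z)) + ln (K (orb j z))"
  shows "subexponential_along M \<theta> h z"
  unfolding subexponential_along_iff
proof (intro allI impI)
  fix \<epsilon> :: real assume "\<epsilon> > 0"
  then have e: "\<epsilon> / 2 > 0" by simp
  obtain B1 where B1: "\<And>j. \<bar>ln (K (orb j z))\<bar> \<le> \<epsilon> / 2 * \<bar>real_of_int j\<bar> + B1"
    using K_tempered[OF z] e unfolding subexponential_along_iff by blast
  obtain B2 where B2: "\<And>j. \<bar>ln (real_of_ereal (sep_index (E (orb j z)) (F (orb j z))))\<bar> \<le>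
      \<epsilon> / 2 * \<bar>real_of_int j\<bar> + B2"
    using sep_tempered[OF z] e unfolding subexponential_along_iff by blast
  have "\<bar>ln (h (orb j z))\<bar> \<le> \<epsilon> * \<bar>real_of_int j\<bar> + (B0 + ln 4 + B1 + B2)" for j
  proof -
    have "0 \<le> ln (h (orb j z))" using h(1) by simp
    then show ?thesis using h(2)[of j] B1[of j] B2[of j] pnorm_sep[OF theta_iter_W[OF z], of j] by (simp add: field_simps)
  qed
  then show "\<exists>B. \<forall>j. \<bar>ln (h (orb j z))\<bar> \<le> \<epsilon> * \<bar>real_of_int j\<bar> + B" by blast
qed

lemma pnorm_measurable: "pnorm \<in> borel_measurable M"
  unfolding pnorm_def
  using strongly_measurable_norm[OF P_measurable] strongly_measurable_norm[OF Q_measurable] by measurable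

lemma cone_C3_eventual: "cone_C3_eventual M \<theta> A cone"
proof -
  note [measurable] = pnorm_measurable K_measurable \<delta>_measurable W_sets
  define c where "c z = 8 * pnorm z * K z" for z
  have c1: "1 \<le> c z" if "z \<in> space M" for z
  proof -
    have "1 * 1 \<le> pnorm z * K z"
      using order_trans[OF zero_le_one pnorm_ge_1] pnorm_ge_1 K_ge_1[OF that] by (intro mult_mono) auto
    then show ?thesis unfolding c_def by simp
  qed
  have c_temp: "subexponential_along M \<theta> c z" if z: "z \<in> W" for z
  proof (rule tempered_bound[OF z, of _ "ln 8"])
    fix j
    let ?\<eta> = "orb j z"
    have \<eta>: "?\<eta> \<in> space M" using theta_iter_space W_space[OF z] by blast
    show "1 \<le> c ?\<eta>" using c1[OF \<eta>] .
    show "ln (c ?\<eta>) \<le> ln 8 + ln (pnorm ?\<eta>) + ln (K ?\<eta>)"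
      unfolding c_def using pnorm_ge_1[of ?\<eta>] K_ge_1[OF \<eta>] by (simp add: ln_mult)
  qed
  \<comment> \<open>The threshold 1/2 is the one of \<open>narrow_cone_separated\<close> for the
    opening reached after \<open>m\<close> steps. Since K is tempered, the product tends to 0, so
    such an \<open>n\<close> exists, and its least value is measurable.\<close>
  define G where "G n z \<longleftrightarrow> (1::nat) \<le> n \<and> (\<forall>m\<ge>n. K ((\<theta> ^^ m) z) * exp (- real m * \<delta> z) \<le> 1 / 2)" for n z
  define N where "N z = (if z \<in> W then LEAST n. G n z else 1)" for z
  have [measurable]: "(\<lambda>z. K ((\<theta> ^^ m) z)) \<in> borel_measurable M" for m
    using measurable_compose[OF theta_pow_measurable K_measurable] .
  have [measurable]: "Measurable.pred M (G n)" for n unfolding G_def by measurable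
  have "(\<lambda>z. LEAST n. G n z) \<in> measurable M (count_space UNIV)" by measurable
  then have N_meas: "N \<in> measurable M (count_space UNIV)"
    unfolding N_def using W_sets by (intro measurable_If_set) auto
  have ex: "\<exists>n. G n z" if z: "z \<in> W" for z
  proof -
    have d: "\<delta> z > 0" using \<delta>_invariant[OF W_space[OF z]] by simp
    then have "\<delta> z / 2 > 0" by simp
    then obtain B where B: "\<And>j. \<bar>ln (K (orb j z))\<bar> \<le> \<delta> z / 2 * \<bar>real_of_int j\<bar> + B"
      using K_tempered[OF z] unfolding subexponential_along_iff by blast
    have bound: "K ((\<theta> ^^ m) z) * exp (- real m * \<delta> z) \<le> exp (B - \<delta> z / 2 * real m)" for m
    proof -
      have Kp: "K ((\<theta> ^^ m) z) > 0" using K_ge_1[OF W_space[OF theta_pow_W[OF z]], of m] by linarith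
      have "ln (K ((\<theta> ^^ m) z)) \<le> \<delta> z / 2 * real m + B" using B[of "int m"] by (simp add: theta_iter_of_nat)
      then have "exp (ln (K ((\<theta> ^^ m) z)) - real m * \<delta> z) \<le> exp (B - \<delta> z / 2 * real m)"
        unfolding exp_le_cancel_iff by (simp add: field_simps)
      then show ?thesis using Kp by (simp add: exp_diff exp_minus field_simps)
    qed
    have "(\<lambda>m. K ((\<theta> ^^ m) z) * exp (- real m * \<delta> z)) \<longlonglongrightarrow> 0"
    proof (rule tendsto_zero_exp_bound[OF _ bound])
      show "0 \<le> K ((\<theta> ^^ n) z) * exp (- real n * \<delta> z)" for n
        using K_ge_1[OF W_space[OF theta_pow_W[OF z]], of n] by simp
    qed (use d in simp)
    then have "\<forall>\<^sub>F m in sequentially. K ((\<theta> ^^ m) z) * exp (- real m * \<delta> z) < 1 / 2"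
      by (rule order_tendstoD) simp
    then obtain n where "\<And>m. m \<ge> n \<Longrightarrow> K ((\<theta> ^^ m) z) * exp (- real m * \<delta> z) < 1 / 2"
      unfolding eventually_sequentially by blast
    then have "G (max 1 n) z" unfolding G_def by (auto intro: less_imp_le)
    then show ?thesis by blast
  qed
  have N: "G (N z) z" if "z \<in> W" for z
    unfolding N_def using LeastI_ex[OF ex[OF that]] that by simp
  have N1: "1 \<le> N z" for z
  proof (cases "z \<in> W")
    case True
    then show ?thesis using N unfolding G_def by blast
  qed (simp add: N_def)
  show ?thesis
    unfolding cone_C3_eventual_def
  proof (intro exI conjI ballI)
    show "c \<in> borel_measurable M" unfolding c_def by measurable
    show "N \<in> measurable M (count_space UNIV)" by fact
    show "1 \<le> c z" if "z \<in> space M" for z using c1[OF that] .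
    show "1 \<le> N z" for z using N1 .
    show "AE z in M. subexponential_along M \<theta> c z \<and>
        (\<forall>m\<ge>N z. sep_index (T m z ` cone z) (- cone ((\<theta> ^^ m) z)) \<ge> ereal (1 / c ((\<theta> ^^ m) z)))"
      using AE_W
    proof eventually_elim
      case (elim z)
      have "sep_index (T m z ` cone z) (- cone ((\<theta> ^^ m) z)) \<ge> ereal (1 / c ((\<theta> ^^ m) z))" if m: "m \<ge> N z" for m
      proof (rule sep_index_ge)
        fix v u assume v: "v \<in> T m z ` cone z" "norm v = 1" and u: "u \<in> - cone ((\<theta> ^^ m) z)"
        obtain x where x: "x \<in> narrow_cone 1 z" "v = T m z x" using v(1) elim unfolding cone_def by auto
        have v': "v \<in> narrow_cone (exp (- real m * \<delta> z) * 1) ((\<theta> ^^ m) z)"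
          using T_narrow_cone[OF elim x(1)] x(2) by simp
        have "\<delta> z > 0" using \<delta>_invariant[OF W_space[OF elim]] by simp
        then have s1: "exp (- real m * \<delta> z) * 1 \<le> 1" by simp
        have s2: "K ((\<theta> ^^ m) z) * (exp (- real m * \<delta> z) * 1) \<le> 1 / 2" using N[OF elim] m unfolding G_def by simp
        have "norm v \<le> c ((\<theta> ^^ m) z) * norm (v - u)"
          unfolding c_def using narrow_cone_separated[OF theta_pow_W[OF elim] v' s1 s2] u by blast
        then show "1 / c ((\<theta> ^^ m) z) \<le> norm (v - u)"
          using v(2) c1[OF W_space[OF theta_pow_W[OF elim]], of m] by (simp add: field_simps)
      qed
      then show ?case using c_temp[OF elim] by blast
    qed
  qed
qed

lemma eventually_contracting: "eventually_measurably_contracting M \<theta> A k cone"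
  unfolding eventually_measurably_contracting_def
  using cone_family cone_C1 cone_C2 cone_C3_eventual by blast

text \<open>On the line \<open>E z\<close> the perturbation \<open>P z d\<close> is a multiple
  \<open>a *\<^sub>R v\<close>, so at every time \<open>T n z (P z u)\<close> is exactly
  \<open>1 + a\<close> times the image of \<open>v\<close>. The gap \<open>1 - s\<close> then has to
  cover only the absolute value of \<open>a\<close> and the part \<open>Q z d\<close>; only the
  latter costs \<open>K z\<close>.\<close>

lemma narrow_cone_separated_dim_1:
  assumes z: "z \<in> W" and k: "k z = 1" and y: "y \<in> narrow_cone s z" and s: "s < 1" and u: "u \<notin> cone z"
  shows "norm y \<le> 2 * (K z + 1) * pnorm z / (1 - s) * norm (y - u)"
proof (rule ccontr)
  assume neg: "\<not> ?thesis"
  define v where "v = P z y"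
  define d where "d = u - y"
  have K: "K z \<ge> 1" using K_ge_1[OF W_space[OF z]] .
  have s': "1 - s > 0" using s by simp
  have yv: "norm y \<le> 2 * norm v" unfolding v_def using narrow_cone_norm[OF z y] s by simp
  have "2 * (K z + 1) * pnorm z * norm d < (1 - s) * norm y"
    using neg s' unfolding d_def by (simp add: field_simps norm_minus_commute)
  also have "\<dots> \<le> (1 - s) * (2 * norm v)" using yv s' by (intro mult_left_mono) auto
  finally have "2 * ((K z + 1) * (pnorm z * norm d)) < 2 * ((1 - s) * norm v)" by (simp only: mult_ac)
  then have "(K z + 1) * (pnorm z * norm d) < (1 - s) * norm v" by linarith
  moreover have "K z * norm (Q z d) + norm (P z d) \<le> K z * (pnorm z * norm d) + pnorm z * norm d"
    using K by (intro add_mono mult_left_mono pnorm_bound) auto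
  ultimately have small: "K z * norm (Q z d) + norm (P z d) < (1 - s) * norm v" by (simp add: algebra_simps)
  have v0: "v \<noteq> 0"
  proof
    assume "v = 0"
    then have "K z * norm (Q z d) + norm (P z d) < 0" using small by simp
    moreover have "0 \<le> K z * norm (Q z d)" using K by simp
    ultimately show False using norm_ge_zero[of "P z d"] by linarith
  qed
  have "has_dim (E z) 1" using E_dim[OF z] k by simp
  then obtain a where a: "P z d = a *\<^sub>R v"
    using has_dim_1_multiple[of "E z" v "P z d"] PQ(1)[OF z] v0 unfolding v_def by blast
  have u_eq: "u = y + d" unfolding d_def by simp
  have "exp (real n * \<delta> z) * norm (T n z (Q z u)) \<le> 1 * norm (T n z (P z u))" for n
  proof -
    define t where "t = norm (T n z v)"
    have "T n z (P z u) = (1 + a) *\<^sub>R T n z v"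
      unfolding u_eq by (simp add: blinfun.add_right a blinfun.scaleR_right algebra_simps v_def)
    then have "norm (T n z (P z u)) = \<bar>1 + a\<bar> * t" unfolding t_def by simp
    also have "\<dots> \<ge> (1 - \<bar>a\<bar>) * t" unfolding t_def by (intro mult_right_mono) auto
    finally have Pu: "norm (T n z (P z u)) \<ge> (1 - \<bar>a\<bar>) * t" .
    have Qy: "exp (real n * \<delta> z) * norm (T n z (Q z y)) \<le> s * t"
      using y unfolding narrow_cone_def t_def v_def by blast
    have "exp (real n * \<delta> z) * norm (T n z (Q z d)) * norm v \<le> K z * norm (Q z d) * t"
      unfolding t_def using domination[OF z _ PQ(2)[OF z]] PQ(1)[OF z] unfolding v_def by blast
    \<comment> \<open>The bound \<open>small\<close>, with \<open>norm (P z d)\<close> written as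
      the absolute value of \<open>a\<close> times \<open>norm v\<close>.\<close>
    also have "\<dots> \<le> ((1 - s) * norm v - \<bar>a\<bar> * norm v) * t"
      using small unfolding a t_def by (intro mult_right_mono) auto
    also have "\<dots> = ((1 - s - \<bar>a\<bar>) * t) * norm v" by (simp add: algebra_simps)
    finally have Qd: "exp (real n * \<delta> z) * norm (T n z (Q z d)) \<le> (1 - s - \<bar>a\<bar>) * t"
      using v0 by simp
    have "exp (real n * \<delta> z) * norm (T n z (Q z u)) \<le>
        exp (real n * \<delta> z) * (norm (T n z (Q z y)) + norm (T n z (Q z d)))"
      unfolding u_eq by (intro mult_left_mono) (auto simp: blinfun.add_right norm_triangle_ineq)
    also have "\<dots> \<le> s * t + (1 - s - \<bar>a\<bar>) * t" using Qy Qd by (simp add: distrib_left)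
    also have "\<dots> = (1 - \<bar>a\<bar>) * t" by (simp add: algebra_simps)
    finally show ?thesis using Pu by simp
  qed
  then show False using u z unfolding cone_def narrow_cone_def by simp
qed

lemma cone_C3:
  assumes k: "\<And>z. z \<in> space M \<Longrightarrow> k z = 1"
  shows "cone_C3 M \<theta> A cone"
proof -
  note [measurable] = pnorm_measurable K_measurable \<delta>_measurable
  define c where "c z = 2 * (K z + 1) * pnorm z / (1 - exp (- \<delta> z))" for z
  have e: "0 < 1 - exp (- \<delta> z)" "1 - exp (- \<delta> z) \<le> 1" if "z \<in> space M" for z
    using \<delta>_invariant[OF that] by auto
  have c1: "1 \<le> c z" if "z \<in> space M" for z
  proof -
    have "1 * 1 \<le> 2 * (K z + 1) * pnorm z"
      using pnorm_ge_1 K_ge_1[OF that] by (intro mult_mono) auto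
    then have "1 - exp (- \<delta> z) \<le> 2 * (K z + 1) * pnorm z" using e(2)[OF that] by linarith
    then show ?thesis unfolding c_def using e(1)[OF that] by simp
  qed
  have c_temp: "subexponential_along M \<theta> c z" if z: "z \<in> W" for z
  \<comment> \<open>The gap \<open>1 - exp (- \<delta> z)\<close> is constant along the orbit, so it
    enters the logarithm only as a constant.\<close>
  proof (rule tempered_bound[OF z, of _ "ln 4 - ln (1 - exp (- \<delta> z))"])
    fix j
    let ?\<eta> = "orb j z"
    have \<eta>: "?\<eta> \<in> space M" using theta_iter_space W_space[OF z] by blast
    show "1 \<le> c ?\<eta>" using c1[OF \<eta>] .
    have pos: "pnorm ?\<eta> > 0" "K ?\<eta> > 0" "0 < 1 - exp (- \<delta> z)"
      using pnorm_ge_1[of ?\<eta>] K_ge_1[OF \<eta>] e(1)[OF W_space[OF z]] by linarith+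
    have "c ?\<eta> \<le> 4 * K ?\<eta> * pnorm ?\<eta> / (1 - exp (- \<delta> z))"
      unfolding c_def \<delta>_theta_iter[OF z] using pos K_ge_1[OF \<eta>] by (intro divide_right_mono mult_right_mono) auto
    then have "ln (c ?\<eta>) \<le> ln (4 * K ?\<eta> * pnorm ?\<eta> / (1 - exp (- \<delta> z)))"
      using c1[OF \<eta>] pos by (subst ln_le_cancel_iff) auto
    also have "\<dots> = ln 4 + ln (K ?\<eta>) + ln (pnorm ?\<eta>) - ln (1 - exp (- \<delta> z))"
      using pos by (simp add: ln_div ln_mult)
    finally show "ln (c ?\<eta>) \<le> (ln 4 - ln (1 - exp (- \<delta> z))) + ln (pnorm ?\<eta>) + ln (K ?\<eta>)" by simp
  qed
  show ?thesis
    unfolding cone_C3_def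
  proof (intro exI conjI ballI)
    have [measurable]: "c \<in> borel_measurable M" unfolding c_def by measurable
    \<comment> \<open>The separation takes place in the cone at \<open>\<theta> z\<close>, whereas
      C3 indexes its constant by \<open>z\<close>; hence the shift.\<close>
    show "(\<lambda>z. c (\<theta> z)) \<in> borel_measurable M"
      using measurable_compose[OF theta_measurable \<open>c \<in> borel_measurable M\<close>] .
    show "1 \<le> c (\<theta> z)" if "z \<in> space M" for z using c1[OF dyn.theta_W[OF that]] .
    show "AE z in M. subexponential_along M \<theta> (\<lambda>z. c (\<theta> z)) z \<and>
        sep_index (A z ` cone z) (- cone (\<theta> z)) \<ge> ereal (1 / c (\<theta> z))"
      using AE_W
    proof eventually_elim
      case (elim z)
      have \<delta>: "\<delta> (\<theta> z) = \<delta> z" "\<delta> z > 0" using \<delta>_invariant[OF W_space[OF elim]] by auto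
      have "sep_index (A z ` cone z) (- cone (\<theta> z)) \<ge> ereal (1 / c (\<theta> z))"
      proof (rule sep_index_ge)
        fix v u assume v: "v \<in> A z ` cone z" "norm v = 1" and u: "u \<in> - cone (\<theta> z)"
        obtain x where x: "x \<in> narrow_cone 1 z" "v = A z x" using v(1) elim unfolding cone_def by auto
        have v': "v \<in> narrow_cone (exp (- \<delta> z)) (\<theta> z)" using A_narrow_cone[OF elim x(1)] x(2) by simp
        have "norm v \<le> c (\<theta> z) * norm (v - u)"
          unfolding c_def \<delta>(1)
          using narrow_cone_separated_dim_1[OF theta_W[OF elim] k v'] u \<delta>(2) W_space[OF theta_W[OF elim]] by simp
        then show "1 / c (\<theta> z) \<le> norm (v - u)"
          using v(2) c1[OF W_space[OF theta_W[OF elim]]] by (simp add: field_simps)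
      qed
      then show ?case using subexponential_theta[OF W_space[OF elim] c_temp[OF elim]] by blast
    qed
  qed
qed

end

lemma dominated_rdsI:
  assumes "linear_rds M \<theta> A" "measurably_dominated_splitting M \<theta> A k E F"
  shows "\<exists>W P Q \<delta> K. dominated_rds M \<theta> A W \<delta> k E F P Q K"
proof -
  have index: "invariant_index M \<theta> k" using assms(2) unfolding measurably_dominated_splitting_def by (elim conjE)
  obtain W P Q \<delta> K where W: "W \<in> sets M" "emeasure M W = emeasure M (space M)" "\<theta> ` W = W"
    and split: "\<forall>z\<in>W. splitting_with (k z) (E z) (F z) (P z) (Q z) \<and>
           blinfun_apply (A z) ` E z = E (\<theta> z) \<and> blinfun_apply (A z) ` F z \<subseteq> F (\<theta> z)"
    and meas: "strongly_measurable M P" "strongly_measurable M Q"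
    and sep: "\<forall>z\<in>W. subexponential_along M \<theta> (\<lambda>z'. real_of_ereal (sep_index (E z') (F z'))) z"
    and \<delta>: "\<delta> \<in> borel_measurable M" "\<forall>z\<in>space M. 0 < \<delta> z \<and> \<delta> (\<theta> z) = \<delta> z"
    and K: "K \<in> borel_measurable M" "\<forall>z\<in>space M. 1 \<le> K z" "\<forall>z\<in>W. subexponential_along M \<theta> K z"
    and dom: "\<forall>z\<in>W. \<forall>n::nat.
           onorm_on (E ((\<theta> ^^ n) z)) (inv_into (E z) (blinfun_apply (cocycle \<theta> A n z))) *
           onorm_on (F z) (blinfun_apply (cocycle \<theta> A n z)) \<le> K z * exp (- real n * \<delta> z)"
    using assms(2) unfolding measurably_dominated_splitting_def by (elim conjE exE) (rule that; assumption)
  have "rds_domain M \<theta> A W \<delta>"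
    using assms(1) W \<delta> unfolding rds_domain_def rds_domain_axioms_def by blast
  moreover have "dominated_rds_axioms M \<theta> A W \<delta> k E F P Q K"
    by (rule dominated_rds_axioms.intro[OF index
          split[rule_format, THEN conjunct1] split[rule_format, THEN conjunct2, THEN conjunct1]
          split[rule_format, THEN conjunct2, THEN conjunct2] meas sep[rule_format]
          K(1) K(2)[rule_format] K(3)[rule_format] dom[rule_format]])
  ultimately show ?thesis unfolding dominated_rds_def by blast
qed

theorem theoremB:
  fixes M :: "'w measure"
    and \<theta> :: "'w \<Rightarrow> 'w"
    and A :: "'w \<Rightarrow> ('x::{banach, second_countable_topology} \<Rightarrow>\<^sub>L 'x)"
    and k :: "'w \<Rightarrow> nat"
  assumes "linear_rds M \<theta> A"
    and "invariant_index M \<theta> k"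
  shows "((\<exists>C. measurably_contracting M \<theta> A k C) \<longrightarrow>
            (\<exists>E F. measurably_dominated_splitting M \<theta> A k E F)) \<and>
         ((\<exists>E F. measurably_dominated_splitting M \<theta> A k E F) \<longrightarrow>
            (\<exists>C. eventually_measurably_contracting M \<theta> A k C)) \<and>
         ((\<exists>C. measurably_contracting M \<theta> A (\<lambda>_. 1) C) \<longleftrightarrow>
            (\<exists>E F. measurably_dominated_splitting M \<theta> A (\<lambda>_. 1) E F))"
proof (intro conjI impI iffI)
  show "\<exists>E F. measurably_dominated_splitting M \<theta> A k E F" if "\<exists>C. measurably_contracting M \<theta> A k C"
    using contracting_imp_dominated[OF assms(1)] that by blast
  show "\<exists>E F. measurably_dominated_splitting M \<theta> A (\<lambda>_. 1) E F" if "\<exists>C. measurably_contracting M \<theta> A (\<lambda>_. 1) C"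
    using contracting_imp_dominated[OF assms(1)] that by blast
  show "\<exists>C. eventually_measurably_contracting M \<theta> A k C" if "\<exists>E F. measurably_dominated_splitting M \<theta> A k E F"
    using dominated_rdsI[OF assms(1)] that dominated_rds.eventually_contracting by blast
  assume "\<exists>E F. measurably_dominated_splitting M \<theta> A (\<lambda>_. 1) E F"
  then obtain E F W P Q \<delta> K where "dominated_rds M \<theta> A W \<delta> (\<lambda>_. 1) E F P Q K"
    using dominated_rdsI[OF assms(1)] by blast
  then interpret dominated_rds M \<theta> A W \<delta> "\<lambda>_. 1" E F P Q K .
  show "\<exists>C. measurably_contracting M \<theta> A (\<lambda>_. 1) C"
    unfolding measurably_contracting_def using cone_family cone_C1 cone_C2 cone_C3 by blast
qed

end
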